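(* Let $k\geq 4$ be an integer and let $\mathcal{H}$ be a $2$-contractible $\ell$-overlapping $k$-tree. If $p \gg \frac{(\log n)^2}{n^{ k -\ell - 1}}$, then with high probability \[\mathrm{ex}(G(n,p)^{(k)}, \mathcal{H})= (\sigma(\mathcal{H}) - 1 +o(1))\,p \binom{n}{k - 1} = p(1+o(1))\,\mathrm{ex}(n,\mathcal{H}).\]
   Context: $G(n,p)^{(k)}$ is the random $k$-graph on $[n]$ in which each $k$-subset is an edge independently with probability $p$. For a $k$-graph $\mathcal{G}$, $\mathrm{ex}(\mathcal{G},\mathcal{H})$ is the maximum number of edges of a subgraph of $\mathcal{G}$ containing no copy of $\mathcal{H}$, and $\mathrm{ex}(n,\mathcal{H})$ is the maximum number of edges of an $\mathcal{H}$-free $k$-graph on $n$ vertices. A hypergraph is $\ell$-overlapping if any two of its edges share at most $\ell$ vertices. Hypertrees: a single edge is a hypertree; a hypergraph $\mathcal{H}$ with at least two edges is a hypertree if it has an edge $E$ such that $\mathcal{H}'=\mathcal{H}\setminus\{E\}$ is a hypertree and some edge $F$ of $\mathcal{H}'$ satisfies $E\cap V(\mathcal{H}')=E\cap F$. A $k$-tree is a $k$-uniform hypertree. A $k$-graph is $2$-contractible if each edge contains at least $2$ vertices of degree $1$. A cross-cut of $\mathcal{H}$ is a vertex set meeting every edge in exactly one vertex; $\sigma(\mathcal{H})$ is the minimum size of a cross-cut.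
   Formalization: The form ex(G(n,p),H) = p(1+o(1)) ex(n,H) is stated only for σ(H) ≥ 2, as it fails for σ(H) = 1 (two edges sharing one vertex, p near the threshold); for σ(H) = 1 both ex(G(n,p),H) (whp) and p·ex(n,H) are shown to be (σ(H)−1+o(1)) p C(n,k−1). *)

theory Defs
  imports "HOL-Probability.Probability" "HOL-Library.Landau_Symbols"
begin

text \<open>
  A hypergraph is identified with its edge set; its vertex set is the union of the edges
  (hypertrees have no isolated vertices).  A subgraph is a subset of the edge set.
\<close>

definition k_subsets :: "nat \<Rightarrow> nat \<Rightarrow> nat set set" where
  "k_subsets k n = {e. e \<subseteq> {1..n} \<and> card e = k}"

definition uniform :: "nat \<Rightarrow> 'a set set \<Rightarrow> bool" where
  "uniform k H \<longleftrightarrow> (\<forall>E\<in>H. finite E \<and> card E = k)"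

inductive hypertree :: "'a set set \<Rightarrow> bool" where
  single: "hypertree {E}"
| extend: "hypertree H \<Longrightarrow> E \<notin> H \<Longrightarrow> F \<in> H \<Longrightarrow> E \<inter> \<Union>H = E \<inter> F \<Longrightarrow> hypertree (insert E H)"

definition k_tree :: "nat \<Rightarrow> 'a set set \<Rightarrow> bool" where
  "k_tree k H \<longleftrightarrow> uniform k H \<and> hypertree H"

definition overlapping :: "nat \<Rightarrow> 'a set set \<Rightarrow> bool" where
  "overlapping l H \<longleftrightarrow> (\<forall>E\<in>H. \<forall>F\<in>H. E \<noteq> F \<longrightarrow> card (E \<inter> F) \<le> l)"

definition hdegree :: "'a set set \<Rightarrow> 'a \<Rightarrow> nat" where
  "hdegree H v = card {E \<in> H. v \<in> E}"

definition two_contractible :: "'a set set \<Rightarrow> bool" where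
  "two_contractible H \<longleftrightarrow> (\<forall>E\<in>H. 2 \<le> card {v \<in> E. hdegree H v = 1})"

definition cross_cut :: "'a set set \<Rightarrow> 'a set \<Rightarrow> bool" where
  "cross_cut H S \<longleftrightarrow> S \<subseteq> \<Union>H \<and> (\<forall>E\<in>H. card (S \<inter> E) = 1)"

definition cross_cut_number :: "'a set set \<Rightarrow> nat" where
  "cross_cut_number H = Min (card ` {S. cross_cut H S})"

definition contains_copy :: "'b set set \<Rightarrow> 'a set set \<Rightarrow> bool" where
  "contains_copy G H \<longleftrightarrow> (\<exists>f. inj_on f (\<Union>H) \<and> (\<forall>E\<in>H. f ` E \<in> G))"

definition ex_in :: "'b set set \<Rightarrow> 'a set set \<Rightarrow> nat" where
  "ex_in G H = Max (card ` {F. F \<subseteq> G \<and> \<not> contains_copy F H})"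

definition turan_number :: "nat \<Rightarrow> nat \<Rightarrow> 'a set set \<Rightarrow> nat" where
  "turan_number k n H = Max (card ` {F. F \<subseteq> k_subsets k n \<and> \<not> contains_copy F H})"

definition random_k_graph :: "nat \<Rightarrow> nat \<Rightarrow> real \<Rightarrow> nat set set pmf" where
  "random_k_graph k n p =
     map_pmf (\<lambda>x. {e \<in> k_subsets k n. x e})
       (Pi_pmf (k_subsets k n) False (\<lambda>_. bernoulli_pmf p))"

end

theory Submission
  imports Defs
begin

text \<open>
  Lower bound: the edges of the random graph meeting a fixed set of \<open>\<sigma>(H) - 1\<close> vertices in exactly one
  vertex contain no copy of \<open>H\<close>, because the preimage of the set would be a smaller cross-cut.

  Upper bound: a \<open>k\<close>-graph with more than \<open>(\<sigma>(H) - 1 + \<epsilon>) n\<^bsup>k-1\<^esup>/(k-1)!\<close> edges carries a random copy of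
  \<open>H\<close> in which a given edge appears with probability \<open>O(n\<^bsup>-(k-1)\<^esup>)\<close> and each further given edge
  costs a factor \<open>O(n\<^bsup>-(k-1-l)\<^esup>)\<close>.  Let \<open>X\<close> be the boundedly many vertices of degree of order
  \<open>n\<^bsup>k-1\<^esup>\<close>.  If almost all edges meet \<open>X\<close>, then some \<open>\<sigma>(H)\<close> vertices of \<open>X\<close> have a dense
  common link; map a minimum cross-cut to them and embed the rest of \<open>H\<close> greedily into the link.
  Otherwise many edges avoid \<open>X\<close>, and most of these contain two vertices \<open>u, v\<close> such that only sets
  containing both can have positive density; sending the two private vertices of each edge of \<open>H\<close>
  to such pairs, \<open>H\<close> is again embedded greedily.  Sampling a random subset of the edges first makes
  the copies correspondingly more spread in denser graphs, so the container method, iterated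
  \<open>O(log n)\<close> times with fingerprints of \<open>O(n\<^sup>l)\<close> edges, covers all \<open>H\<close>-free graphs by
  \<open>exp (O(n\<^sup>l (log n)\<^sup>2))\<close> graphs with at most \<open>(\<sigma>(H) - 1 + \<epsilon>) n\<^bsup>k-1\<^esup>/(k-1)!\<close> edges.  A Chernoff
  bound and a union bound finish the proof.
\<close>

section \<open>A hypergraph container lemma\<close>

text \<open>Copies are forced from order n^(k-1) edges on, where the density tends to 0, so
  arguments for positive density do not apply: edges may pile up on a few small sets, and a greedy
  embedding gets stuck when all edges through a prescribed intersection reuse an occupied vertex.
  Piling up on single vertices is confined to \<open>X\<close>, whose links are dense again one
  uniformity lower. Piling up on larger sets is where two private vertices per edge are needed: a
  pair absorbs the concentration, and what remains of the edge behaves generically. The exponent of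
  n in the hypothesis on p has this origin: after sampling, \<open>\<alpha>\<close> is of order
  1/|G| and \<open>\<beta>\<close> of order n^l/|G|, so a fingerprint has about
  \<open>\<beta>\<close> |G| = n^l edges, whatever the size of G. One logarithm pays for choosing
  these edges among at most n^k, the other for the number of rounds. The union bound then needs p
  n^(k-1) to exceed n^l (log n)^2 by a large constant factor, which is the assumed rate.\<close>

definition wdeg :: "'v set \<Rightarrow> ('v set \<Rightarrow> real) \<Rightarrow> 'v set \<Rightarrow> real" where
  "wdeg V w J = (\<Sum>e | e \<subseteq> V \<and> J \<subseteq> e. w e)"

text \<open>Weights instead of edge sets, because two kinds of objects are treated alike: the law of
  the edge set of a random copy, and a sum of links in which one set may be added by several
  vertices.\<close>

definition weighted_on :: "'v set \<Rightarrow> nat \<Rightarrow> ('v set \<Rightarrow> real) \<Rightarrow> bool" where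
  "weighted_on V s w \<longleftrightarrow> (\<forall>e. 0 \<le> w e) \<and> (\<forall>e. w e \<noteq> 0 \<longrightarrow> e \<subseteq> V \<and> card e = s)"

definition independent_of :: "('v set \<Rightarrow> real) \<Rightarrow> 'v set \<Rightarrow> bool" where
  "independent_of w I \<longleftrightarrow> (\<forall>e. w e \<noteq> 0 \<longrightarrow> \<not> e \<subseteq> I)"

lemma sum_UNION_le:
  fixes w :: "'b \<Rightarrow> real"
  assumes "finite A" "\<And>x. x \<in> A \<Longrightarrow> finite (F x)" "\<And>e. 0 \<le> w e"
  shows "sum w (\<Union>x\<in>A. F x) \<le> (\<Sum>x\<in>A. sum w (F x))"
  using assms(1,2)
proof (induction A rule: finite_induct)
  case (insert x A)
  have "sum w (F x \<union> (\<Union>x\<in>A. F x)) \<le> sum w (F x) + sum w (\<Union>x\<in>A. F x)"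
    using insert by (subst sum.union_inter[symmetric]) (auto simp: sum_nonneg assms(3))
  then show ?case using insert by fastforce
qed simp

lemma wdeg_mono:
  assumes "\<And>e. u e \<le> u' e"
  shows "wdeg V u J \<le> wdeg V u' J"
  unfolding wdeg_def by (intro sum_mono assms)

lemma wdeg_empty: "wdeg V w {} = (\<Sum>e\<in>Pow V. w e)"
  by (simp add: wdeg_def Pow_def)

text \<open>
  The vertices are scanned one at a time.  A vertex \<open>v\<close> is big if its link in \<open>w\<close>, without the sets
  containing a \<open>J\<close> whose degree in the weight \<open>u\<close> built so far has reached its cap, still has weight
  at least \<open>\<theta>\<close>; the links of the big vertices in \<open>I\<close> are added to \<open>u\<close>.  Only the trace of \<open>I\<close> on
  the big vertices influences the run, so this small set serves as the fingerprint of \<open>I\<close>.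
\<close>

locale scan =
  fixes V :: "'v set" and cap :: "nat \<Rightarrow> real" and \<theta> :: real and w :: "'v set \<Rightarrow> real"
    and s :: nat
  assumes finV: "finite V" and w_on: "weighted_on V (Suc s) w"
begin

definition wlink :: "('v set \<Rightarrow> real) \<Rightarrow> 'v \<Rightarrow> 'v set \<Rightarrow> real" where
  "wlink u v f = (if v \<notin> f \<and> (\<forall>J. J \<subseteq> f \<and> J \<noteq> {} \<longrightarrow> wdeg V u J < cap (card J))
     then w (insert v f) else 0)"

definition wbig :: "('v set \<Rightarrow> real) \<Rightarrow> 'v \<Rightarrow> bool" where
  "wbig u v \<longleftrightarrow> \<theta> \<le> (\<Sum>f\<in>Pow V. wlink u v f)"

definition wadd :: "'v set \<Rightarrow> ('v set \<Rightarrow> real) \<Rightarrow> 'v \<Rightarrow> 'v set \<Rightarrow> real" where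
  "wadd I u v = (if v \<in> I \<and> wbig u v then (\<lambda>f. u f + wlink u v f) else u)"

primrec scan_weight :: "'v set \<Rightarrow> ('v set \<Rightarrow> real) \<Rightarrow> 'v list \<Rightarrow> 'v set \<Rightarrow> real" where
  "scan_weight I u [] = u"
| "scan_weight I u (v # vs) = scan_weight I (wadd I u v) vs"

primrec scan_big :: "'v set \<Rightarrow> ('v set \<Rightarrow> real) \<Rightarrow> 'v list \<Rightarrow> 'v set" where
  "scan_big I u [] = {}"
| "scan_big I u (v # vs) = (if wbig u v then {v} else {}) \<union> scan_big I (wadd I u v) vs"

lemma w_nonneg: "0 \<le> w e"
  and w_supp: "w e \<noteq> 0 \<Longrightarrow> e \<subseteq> V \<and> card e = Suc s"
  using w_on by (auto simp: weighted_on_def)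

lemma wlink_nonneg: "0 \<le> wlink u v f"
  by (simp add: wlink_def w_nonneg)

lemma wadd_ge: "u f \<le> wadd I u v f"
  by (simp add: wadd_def wlink_nonneg)

lemma scan_weight_ge: "u f \<le> scan_weight I u vs f"
proof (induction vs arbitrary: u)
  case (Cons v vs)
  show ?case using Cons[of "wadd I u v"] wadd_ge[of u f I v] by simp
qed simp

lemma wlink_antimono:
  assumes "\<And>f. u f \<le> u' f"
  shows "wlink u' v f \<le> wlink u v f"
proof -
  have "wdeg V u J \<le> wdeg V u' J" for J using assms by (rule wdeg_mono)
  then show ?thesis unfolding wlink_def using w_nonneg
    by (smt (verit) order_le_less_trans)
qed

text \<open>Only the run on \<open>I\<close> occurs in the hypothesis, so \<open>I'\<close> can be
  the fingerprint \<open>scan_big I u vs \<inter> I\<close> itself; that both runs find the same big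
  vertices is part of the conclusion.\<close>

lemma scan_cong:
  assumes "scan_big I u vs \<inter> I = scan_big I u vs \<inter> I'"
  shows "scan_weight I' u vs = scan_weight I u vs \<and> scan_big I' u vs = scan_big I u vs"
  using assms
proof (induction vs arbitrary: u)
  case (Cons v vs)
  have eq: "wadd I' u v = wadd I u v"
  proof (cases "wbig u v")
    case True
    then have "v \<in> I \<longleftrightarrow> v \<in> I'" using Cons.prems by auto
    then show ?thesis by (simp add: wadd_def)
  qed (simp add: wadd_def)
  have "scan_big I (wadd I u v) vs \<inter> I = scan_big I (wadd I u v) vs \<inter> I'"
    using Cons.prems by (auto split: if_splits)
  from Cons.IH[OF this] show ?case by (simp add: eq)
qed simp

lemma scan_big_subset: "scan_big I u vs \<subseteq> set vs"
  by (induction vs arbitrary: u) auto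

text \<open>Links are added for vertices of \<open>I\<close> only. Started from zero, a support set
  of the new weight inside \<open>I\<close> therefore extends to a support set of \<open>w\<close>
  inside \<open>I\<close>, so independence passes to the lower uniformity.\<close>

lemma scan_weight_supp:
  "scan_weight I u vs f \<noteq> 0 \<Longrightarrow> u f \<noteq> 0 \<or> (\<exists>v\<in>I. w (insert v f) \<noteq> 0)"
proof (induction vs arbitrary: u)
  case (Cons v vs)
  then have "wadd I u v f \<noteq> 0 \<or> (\<exists>v\<in>I. w (insert v f) \<noteq> 0)" by simp
  then show ?case by (auto simp: wadd_def wlink_def split: if_splits)
qed simp

lemma scan_weight_on:
  assumes "weighted_on V s u"
  shows "weighted_on V s (scan_weight I u vs)"
  using assms
proof (induction vs arbitrary: u)
  case (Cons v vs)
  have "weighted_on V s (wadd I u v)"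
    unfolding weighted_on_def
  proof (intro conjI allI impI)
    fix e show "0 \<le> wadd I u v e"
      using Cons.prems wadd_ge[of u e I v] by (auto simp: weighted_on_def intro: order_trans)
    assume "wadd I u v e \<noteq> 0"
    then have "u e \<noteq> 0 \<or> (v \<notin> e \<and> w (insert v e) \<noteq> 0)"
      by (auto simp: wadd_def wlink_def split: if_splits)
    then show "e \<subseteq> V" "card e = s"
      using Cons.prems w_supp[of "insert v e"] finite_subset[OF _ finV, of "insert v e"]
      by (auto simp: weighted_on_def)
  qed
  then show ?case using Cons.IH by simp
qed simp

lemma sum_wlink_le: "(\<Sum>f | f \<subseteq> V \<and> J \<subseteq> f. wlink u v f) \<le> (if v \<in> J then 0 else wdeg V w (insert v J))"
proof (cases "v \<in> J")
  case True
  then have "(\<Sum>f | f \<subseteq> V \<and> J \<subseteq> f. wlink u v f) = 0"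
    by (intro sum.neutral) (auto simp: wlink_def)
  then show ?thesis using True by simp
next
  case False
  let ?A = "{f. f \<subseteq> V \<and> J \<subseteq> f \<and> v \<notin> f \<and> w (insert v f) \<noteq> 0}"
  have fin: "finite {f. f \<subseteq> V \<and> J \<subseteq> f}" "finite {e. e \<subseteq> V \<and> insert v J \<subseteq> e}"
    using finV by (auto intro: finite_subset[of _ "Pow V"])
  have "(\<Sum>f | f \<subseteq> V \<and> J \<subseteq> f. wlink u v f) = (\<Sum>f\<in>?A. wlink u v f)"
    using fin by (intro sum.mono_neutral_right) (auto simp: wlink_def)
  also have "\<dots> \<le> (\<Sum>f\<in>?A. w (insert v f))"
    by (intro sum_mono) (simp add: wlink_def w_nonneg)
  also have "\<dots> = (\<Sum>e\<in>insert v ` ?A. w e)"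
    by (subst sum.reindex) (auto simp: inj_on_def)
  also have "\<dots> \<le> wdeg V w (insert v J)"
    unfolding wdeg_def using fin(2) w_supp by (intro sum_mono2) (auto simp: w_nonneg)
  finally show ?thesis using False by simp
qed

text \<open>The cap of \<open>J\<close> is overshot at most once: as soon as it is reached, every
  set containing \<open>J\<close> is excluded from later links, and a single link adds at most the
  degree of \<open>insert v J\<close> in \<open>w\<close>.\<close>

lemma scan_weight_deg:
  assumes D: "\<And>J. J \<noteq> {} \<Longrightarrow> finite J \<Longrightarrow> wdeg V w J \<le> D (card J)" "\<And>j. 0 \<le> D j"
    and "J \<noteq> {}" "finite J" "wdeg V u J \<le> cap (card J) + D (Suc (card J))"
  shows "wdeg V (scan_weight I u vs) J \<le> cap (card J) + D (Suc (card J))"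
  using assms(5)
proof (induction vs arbitrary: u)
  case (Cons v vs)
  have "wdeg V (wadd I u v) J \<le> cap (card J) + D (Suc (card J))"
  proof (cases "wdeg V u J < cap (card J)")
    case True
    have "wdeg V (wadd I u v) J \<le> wdeg V u J + (\<Sum>f | f \<subseteq> V \<and> J \<subseteq> f. wlink u v f)"
      by (auto simp: wdeg_def wadd_def sum.distrib sum_nonneg wlink_nonneg)
    also have "\<dots> \<le> cap (card J) + (if v \<in> J then 0 else wdeg V w (insert v J))"
      using True sum_wlink_le[where J=J and u=u and v=v] by linarith
    also have "\<dots> \<le> cap (card J) + D (Suc (card J))"
      using D(1)[of "insert v J"] D(2)[of "Suc (card J)"] assms(3,4) by auto
    finally show ?thesis .
  next
    case False
    then have "wlink u v f = 0" if "J \<subseteq> f" for f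
      using that assms(3) by (auto simp: wlink_def)
    then have "wdeg V (wadd I u v) J = wdeg V u J"
      by (auto simp: wdeg_def wadd_def intro!: sum.cong)
    then show ?thesis using Cons.prems by simp
  qed
  then show ?case using Cons.IH by simp
qed simp

text \<open>Each big vertex in \<open>I\<close> raises the total weight by at least
  \<open>\<theta>\<close>, and distinctness charges it once. An upper bound on the total thus bounds
  the fingerprint.\<close>

lemma scan_big_card:
  assumes "distinct vs" "0 \<le> \<theta>"
  shows "\<theta> * card (scan_big I u vs \<inter> I) \<le> wdeg V (scan_weight I u vs) {} - wdeg V u {}"
  using assms(1)
proof (induction vs arbitrary: u)
  case (Cons v vs)
  let ?R = "scan_big I (wadd I u v) vs"
  have fin: "finite (?R \<inter> I)"
    using scan_big_subset by (metis List.finite_set finite_Int finite_subset)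
  have nv: "v \<notin> ?R" using scan_big_subset Cons.prems by fastforce
  have IH: "\<theta> * card (?R \<inter> I) \<le> wdeg V (scan_weight I u (v # vs)) {} - wdeg V (wadd I u v) {}"
    using Cons by auto
  show ?case
  proof (cases "v \<in> I \<and> wbig u v")
    case True
    have "scan_big I u (v # vs) \<inter> I = insert v (?R \<inter> I)" using True by auto
    then have "card (scan_big I u (v # vs) \<inter> I) = Suc (card (?R \<inter> I))"
      using fin nv by simp
    moreover have "wdeg V (wadd I u v) {} \<ge> wdeg V u {} + \<theta>"
      using True by (simp add: wdeg_empty wadd_def sum.distrib wbig_def)
    ultimately show ?thesis using IH by (simp add: algebra_simps)
  next
    case False
    then have "scan_big I u (v # vs) \<inter> I = ?R \<inter> I" by auto
    moreover have "wadd I u v = u" using False by (auto simp: wadd_def)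
    ultimately show ?thesis using IH by simp
  qed
qed simp

text \<open>A link only loses terms while the weight grows, so its final total is at most the total
  at the moment when \<open>v\<close> was scanned and rejected.\<close>

lemma scan_small:
  assumes "v \<in> set vs" "v \<notin> scan_big I u vs"
  shows "(\<Sum>f\<in>Pow V. wlink (scan_weight I u vs) v f) < \<theta>"
  using assms
proof (induction vs arbitrary: u)
  case (Cons x vs)
  show ?case
  proof (cases "v = x")
    case True
    have "(\<Sum>f\<in>Pow V. wlink (scan_weight I u (x # vs)) v f) \<le> (\<Sum>f\<in>Pow V. wlink u v f)"
      by (intro sum_mono wlink_antimono) (rule scan_weight_ge)
    also have "\<dots> < \<theta>" using Cons.prems True by (auto simp: wbig_def split: if_splits)
    finally show ?thesis .
  qed (use Cons in auto)
qed simp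

end

lemma wdeg_sum_subsets:
  assumes "finite V" "weighted_on V s u"
  shows "(\<Sum>J\<in>Pow V. wdeg V u J) = 2 ^ s * wdeg V u {}"
proof -
  have "(\<Sum>J\<in>Pow V. wdeg V u J) = (\<Sum>J\<in>Pow V. \<Sum>e | e \<in> Pow V \<and> J \<subseteq> e. u e)"
    by (simp add: wdeg_def)
  also have "\<dots> = (\<Sum>e\<in>Pow V. \<Sum>J | J \<in> Pow V \<and> J \<subseteq> e. u e)"
    using assms(1) by (intro sum.swap_restrict) auto
  also have "\<dots> = (\<Sum>e\<in>Pow V. 2 ^ s * u e)"
  proof (rule sum.cong[OF refl])
    fix e assume e: "e \<in> Pow V"
    then have "{J \<in> Pow V. J \<subseteq> e} = Pow e" by auto
    then have "(\<Sum>J | J \<in> Pow V \<and> J \<subseteq> e. u e) = 2 ^ card e * u e"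
      using e assms(1) by (simp add: card_Pow finite_subset)
    then show "(\<Sum>J | J \<in> Pow V \<and> J \<subseteq> e. u e) = 2 ^ s * u e"
      using assms(2) by (cases "u e = 0") (auto simp: weighted_on_def)
  qed
  finally show ?thesis by (simp add: wdeg_empty sum_distrib_left)
qed

lemma wdeg_sum_singletons:
  assumes "finite V" "weighted_on V s u"
  shows "(\<Sum>v\<in>V. wdeg V u {v}) = s * wdeg V u {}"
proof -
  have "(\<Sum>v\<in>V. wdeg V u {v}) = (\<Sum>v\<in>V. \<Sum>e | e \<in> Pow V \<and> v \<in> e. u e)"
    by (simp add: wdeg_def)
  also have "\<dots> = (\<Sum>e\<in>Pow V. \<Sum>v | v \<in> V \<and> v \<in> e. u e)"
    using assms(1) by (intro sum.swap_restrict) auto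
  also have "\<dots> = (\<Sum>e\<in>Pow V. s * u e)"
  proof (rule sum.cong[OF refl])
    fix e assume e: "e \<in> Pow V"
    then have "{v. v \<in> V \<and> v \<in> e} = e" by auto
    then show "(\<Sum>v | v \<in> V \<and> v \<in> e. u e) = s * u e"
      using assms(2) by (cases "u e = 0") (auto simp: weighted_on_def)
  qed
  finally show ?thesis by (simp add: wdeg_empty sum_distrib_left)
qed

context scan
begin

text \<open>The sets are sorted into those meeting a big vertex, those containing a saturated
  \<open>J\<close>, and the rest. A saturated \<open>J\<close> has degree at most \<open>R\<close>
  times its degree in \<open>u\<close>, and every support set of \<open>u\<close> has
  \<open>2 ^ s\<close> subsets, which gives the last term. A set \<open>e\<close> of the rest, less
  any vertex \<open>v\<close>, is a member of the final link of the rejected vertex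
  \<open>v\<close>, so the rest costs at most \<open>\<theta>\<close> per vertex.\<close>

lemma total_le_scan:
  fixes I :: "'v set" and D R :: real
  assumes vs: "set vs = V" and \<theta>: "0 \<le> \<theta>"
    and D: "\<And>v. wdeg V w {v} \<le> D"
    and cap: "\<And>J. J \<noteq> {} \<Longrightarrow> J \<subseteq> V \<Longrightarrow> wdeg V w J \<le> R * cap (card J)" and R: "0 \<le> R"
    and u: "weighted_on V s u0"
  defines "B \<equiv> scan_big I u0 vs" and "u \<equiv> scan_weight I u0 vs"
  shows "wdeg V w {} \<le> card B * D + card V * \<theta> + R * 2 ^ s * wdeg V u {}"
proof -
  define sat where "sat J \<longleftrightarrow> J \<noteq> {} \<and> cap (card J) \<le> wdeg V u J" for J
  define E1 where "E1 = {e \<in> Pow V. e \<inter> B \<noteq> {}}"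
  define E2 where "E2 = {e \<in> Pow V. \<exists>J. J \<subseteq> e \<and> sat J}"
  define E3 where "E3 = {e \<in> Pow V. e \<noteq> {} \<and> e \<inter> B = {} \<and> (\<forall>J. J \<subseteq> e \<longrightarrow> \<not> sat J)}"
  have u_on: "weighted_on V s u" unfolding u_def by (rule scan_weight_on[OF u])
  have "B \<subseteq> V" using scan_big_subset[of I u0 vs] by (simp add: B_def vs)
  then have finB: "finite B" using finV by (rule finite_subset)
  have fins: "finite E1" "finite E2" "finite E3" using finV by (auto simp: E1_def E2_def E3_def)
  have "wdeg V w {} \<le> sum w (E1 \<union> E2 \<union> E3)"
  proof -
    have "w {} = 0" using w_supp[of "{}"] by auto
    then have "(\<Sum>e\<in>Pow V. w e) = sum w (E1 \<union> E2 \<union> E3)"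
      using finV by (intro sum.mono_neutral_right) (auto simp: E1_def E2_def E3_def)
    then show ?thesis by (simp add: wdeg_empty)
  qed
  also have "\<dots> \<le> sum w E1 + sum w E2 + sum w E3"
  proof -
    have "sum w (E1 \<union> E2) \<le> sum w E1 + sum w E2"
      using fins by (subst sum.union_inter[symmetric]) (auto simp: sum_nonneg w_nonneg)
    moreover have "sum w ((E1 \<union> E2) \<union> E3) \<le> sum w (E1 \<union> E2) + sum w E3"
      using fins by (subst sum.union_inter[symmetric]) (auto simp: sum_nonneg w_nonneg)
    ultimately show ?thesis by linarith
  qed
  also have "sum w E1 \<le> card B * D"
  proof -
    have "sum w E1 \<le> (\<Sum>v\<in>B. \<Sum>e | e \<subseteq> V \<and> {v} \<subseteq> e. w e)"
    proof -
      have E1: "(\<Union>v\<in>B. {e. e \<subseteq> V \<and> {v} \<subseteq> e}) = E1" by (auto simp: E1_def)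
      show ?thesis using finB finV
        by (subst E1[symmetric], intro sum_UNION_le) (auto simp: w_nonneg)
    qed
    also have "\<dots> \<le> (\<Sum>v\<in>B. D)" using D by (intro sum_mono) (simp add: wdeg_def)
    finally show ?thesis by simp
  qed
  also have "sum w E2 \<le> R * 2 ^ s * wdeg V u {}"
  proof -
    define SJ where "SJ = {J \<in> Pow V. sat J}"
    have finS: "finite SJ" using finV by (auto simp: SJ_def)
    have E2: "(\<Union>J\<in>SJ. {e. e \<subseteq> V \<and> J \<subseteq> e}) = E2" by (auto simp: E2_def SJ_def)
    have "sum w E2 \<le> (\<Sum>J\<in>SJ. wdeg V w J)"
      using finS finV unfolding wdeg_def
      by (subst E2[symmetric], intro sum_UNION_le) (auto simp: w_nonneg)
    also have "\<dots> \<le> (\<Sum>J\<in>SJ. R * wdeg V u J)"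
    proof (rule sum_mono)
      fix J assume "J \<in> SJ"
      then have J: "J \<subseteq> V" "J \<noteq> {}" "cap (card J) \<le> wdeg V u J" by (auto simp: SJ_def sat_def)
      show "wdeg V w J \<le> R * wdeg V u J"
        using cap[OF J(2,1)] mult_left_mono[OF J(3) R] by linarith
    qed
    also have "\<dots> \<le> (\<Sum>J\<in>Pow V. R * wdeg V u J)"
      using finV R u_on by (intro sum_mono2) (auto simp: SJ_def wdeg_def weighted_on_def sum_nonneg)
    also have "\<dots> = R * 2 ^ s * wdeg V u {}"
      using wdeg_sum_subsets[OF finV u_on] by (simp add: sum_distrib_left[symmetric])
    finally show ?thesis .
  qed
  also have "sum w E3 \<le> card V * \<theta>"
  proof -
    have "sum w E3 \<le> (\<Sum>v\<in>V - B. \<Sum>e\<in>{e\<in>E3. v \<in> e}. w e)"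
    proof -
      have E3: "(\<Union>v\<in>V - B. {e\<in>E3. v \<in> e}) = E3" by (auto simp: E3_def)
      have "sum w (\<Union>v\<in>V - B. {e\<in>E3. v \<in> e}) \<le> (\<Sum>v\<in>V - B. \<Sum>e\<in>{e\<in>E3. v \<in> e}. w e)"
        using finV fins by (intro sum_UNION_le) (auto simp: w_nonneg)
      then show ?thesis by (simp only: E3)
    qed
    also have "\<dots> \<le> (\<Sum>v\<in>V - B. \<theta>)"
    proof (rule sum_mono)
      fix v assume v: "v \<in> V - B"
      have "(\<Sum>e\<in>{e\<in>E3. v \<in> e}. w e) = (\<Sum>f\<in>(\<lambda>e. e - {v}) ` {e\<in>E3. v \<in> e}. w (insert v f))"
        by (subst sum.reindex) (auto simp: inj_on_def insert_absorb intro!: sum.cong)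
      also have "\<dots> = (\<Sum>f\<in>(\<lambda>e. e - {v}) ` {e\<in>E3. v \<in> e}. wlink u v f)"
        by (intro sum.cong refl) (auto simp: wlink_def E3_def sat_def not_le)
      also have "\<dots> \<le> (\<Sum>f\<in>Pow V. wlink u v f)"
        using finV by (intro sum_mono2) (auto simp: E3_def wlink_nonneg)
      also have "\<dots> < \<theta>" using scan_small[of v vs I u0] v vs by (auto simp: u_def B_def)
      finally show "(\<Sum>e\<in>{e\<in>E3. v \<in> e}. w e) \<le> \<theta>" by simp
    qed
    also have "\<dots> \<le> card V * \<theta>"
      using finV \<theta> by (simp add: card_mono mult_right_mono)
    finally show ?thesis .
  qed
  finally show ?thesis by simp
qed

end

section \<open>Counting fingerprints, and the container lemma by induction on the uniformity\<close>

lemma card_small_subsets: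
  assumes "finite V"
  shows "card {T. T \<subseteq> V \<and> card T \<le> m} \<le> (card V + 1) ^ m"
proof (induction m)
  case 0
  have "{T. T \<subseteq> V \<and> card T \<le> 0} = {{}}"
    using assms finite_subset by fastforce
  then show ?case by simp
next
  case (Suc m)
  let ?S = "\<lambda>m. {T. T \<subseteq> V \<and> card T \<le> m}"
  let ?g = "\<lambda>(T, x). case x of None \<Rightarrow> T | Some v \<Rightarrow> insert v T"
  have fin: "finite (?S m)" using assms by simp
  have "?S (Suc m) \<subseteq> ?g ` (?S m \<times> insert None (Some ` V))"
  proof
    fix T assume T: "T \<in> ?S (Suc m)"
    show "T \<in> ?g ` (?S m \<times> insert None (Some ` V))"
    proof (cases "card T \<le> m")
      case True
      then show ?thesis using T by (intro image_eqI[of _ _ "(T, None)"]) auto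
    next
      case False
      then obtain x where x: "x \<in> T" by fastforce
      have "finite T" using T assms finite_subset by blast
      then show ?thesis using x T
        by (intro image_eqI[of _ _ "(T - {x}, Some x)"]) auto
    qed
  qed
  then have "card (?S (Suc m)) \<le> card (?S m \<times> insert None (Some ` V))"
    using fin assms by (intro surj_card_le) auto
  also have "\<dots> = card (?S m) * (card V + 1)"
    using assms by (simp add: card_cartesian_product card_image)
  also have "\<dots> \<le> (card V + 1) ^ Suc m" using mult_le_mono1[OF Suc, of "card V + 1"] by (simp add: mult.commute)
  finally show ?case .
qed

lemma card_small_subsets_powr:
  assumes "finite V" "0 \<le> x"
  shows "real (card {T. T \<subseteq> V \<and> real (card T) \<le> x}) \<le> (real (card V) + 1) powr x"
proof -
  have "{T. T \<subseteq> V \<and> real (card T) \<le> x} = {T. T \<subseteq> V \<and> card T \<le> nat \<lfloor>x\<rfloor>}"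
    using assms(2) by (auto simp: le_nat_floor) linarith
  then have "real (card {T. T \<subseteq> V \<and> real (card T) \<le> x}) \<le> real ((card V + 1) ^ nat \<lfloor>x\<rfloor>)"
    using card_small_subsets[OF assms(1), of "nat \<lfloor>x\<rfloor>"] by (simp only: of_nat_le_iff)
  also have "\<dots> = (real (card V) + 1) powr (real (nat \<lfloor>x\<rfloor>))"
    by (subst powr_realpow) (auto simp: add.commute)
  also have "\<dots> \<le> (real (card V) + 1) powr x"
    using assms(2) by (intro powr_mono) auto
  finally show ?thesis .
qed

text \<open>For a fingerprint \<open>T\<close> the scan yields a weight of uniformity one less whose
  degrees are smaller by a factor \<open>\<tau>\<close>. If its total is at least
  \<open>\<eta>' * \<tau>\<close>, dividing by \<open>\<tau>\<close> restores the hypotheses with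
  \<open>2 * K\<close> for \<open>K\<close>, and induction applies. If it is smaller, little of
  \<open>w\<close> lies on sets containing saturated sets, so linearly many vertices must be big;
  those outside \<open>T\<close> are missed by every \<open>I\<close> with this fingerprint and can
  be removed from the container.\<close>

lemma container_lemma:
  fixes K \<eta> :: real
  assumes "0 < K" "0 < \<eta>"
  shows "\<exists>A \<delta> \<tau>0 :: real. 0 < A \<and> 0 < \<delta> \<and> 0 < \<tau>0 \<and> (\<forall>(V :: 'v set) w (\<tau> :: real).
    finite V \<and> V \<noteq> {} \<and> weighted_on V (Suc s) w \<and> 0 < \<tau> \<and> \<tau> \<le> \<tau>0 \<and> \<eta> \<le> wdeg V w {} \<and>
    (\<forall>J. J \<noteq> {} \<and> J \<subseteq> V \<longrightarrow> wdeg V w J \<le> K * \<tau> ^ (card J - 1) / real (card V)) \<longrightarrow>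
    (\<exists>CC. finite CC \<and> real (card CC) \<le> (real (card V) + 1) powr (A * \<tau> * real (card V)) \<and>
      (\<forall>C\<in>CC. C \<subseteq> V \<and> real (card C) \<le> (1 - \<delta>) * real (card V)) \<and>
      (\<forall>I. I \<subseteq> V \<and> independent_of w I \<longrightarrow> (\<exists>C\<in>CC. I \<subseteq> C))))"
  using assms
proof (induction s arbitrary: K \<eta>)
  case 0
  show ?case
  proof (rule exI[of _ "1::real"], rule exI[of _ "\<eta> / K"], rule exI[of _ "1::real"], (intro conjI allI impI; (elim conjE)?))
    show "0 < \<eta> / K" using 0 by simp
    fix V :: "'v set" and w :: "'v set \<Rightarrow> real" and \<tau> :: real
    assume V: "finite V" "V \<noteq> {}" and w: "weighted_on V (Suc 0) w" and \<tau>: "0 < \<tau>"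
      and \<eta>: "\<eta> \<le> wdeg V w {}"
      and K: "\<forall>J. J \<noteq> {} \<and> J \<subseteq> V \<longrightarrow> wdeg V w J \<le> K * \<tau> ^ (card J - 1) / real (card V)"
    define X where "X = {v \<in> V. w {v} \<noteq> 0}"
    have finX: "finite X" using V by (simp add: X_def)
    have N: "real (card V) > 0" using V by (simp add: card_gt_0_iff)
    have wd: "wdeg V w {v} \<ge> 0" for v using w by (auto simp: wdeg_def weighted_on_def sum_nonneg)
    have sing: "wdeg V w {v} = 0" if "v \<in> V - X" for v
    proof -
      have "w e = 0" if e: "v \<in> e" for e
      proof (rule ccontr)
        assume "w e \<noteq> 0"
        then have "card e = 1" using w by (auto simp: weighted_on_def)
        then have "e = {v}" using e by (auto simp: card_1_singleton_iff)
        then show False using \<open>v \<in> V - X\<close> \<open>w e \<noteq> 0\<close> by (auto simp: X_def)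
      qed
      then show ?thesis by (auto simp: wdeg_def intro!: sum.neutral)
    qed
    have "\<eta> \<le> (\<Sum>v\<in>V. wdeg V w {v})" using wdeg_sum_singletons[OF V(1) w] \<eta> by simp
    also have "\<dots> = (\<Sum>v\<in>X. wdeg V w {v})"
      using V sing by (intro sum.mono_neutral_right) (auto simp: X_def)
    also have "\<dots> \<le> (\<Sum>v\<in>X. K / real (card V))"
    proof (rule sum_mono)
      fix v assume "v \<in> X"
      then show "wdeg V w {v} \<le> K / real (card V)" using K[rule_format, of "{v}"] by (simp add: X_def)
    qed
    finally have X: "\<eta> / K * real (card V) \<le> card X"
      using 0 N by (simp add: field_simps)
    show "\<exists>CC. finite CC \<and> real (card CC) \<le> (real (card V) + 1) powr (1 * \<tau> * real (card V)) \<and>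
      (\<forall>C\<in>CC. C \<subseteq> V \<and> real (card C) \<le> (1 - \<eta> / K) * real (card V)) \<and>
      (\<forall>I. I \<subseteq> V \<and> independent_of w I \<longrightarrow> (\<exists>C\<in>CC. I \<subseteq> C))"
    proof (intro exI[of _ "{V - X}"] conjI)
      show "real (card {V - X}) \<le> (real (card V) + 1) powr (1 * \<tau> * real (card V))"
        using \<tau> by (simp add: ge_one_powr_ge_zero)
      have "card (V - X) = card V - card X" "card X \<le> card V"
        using finX V by (auto simp: X_def card_Diff_subset intro: card_mono)
      then have "real (card (V - X)) = real (card V) - real (card X)" by (simp add: of_nat_diff)
      then show "\<forall>C\<in>{V - X}. C \<subseteq> V \<and> real (card C) \<le> (1 - \<eta> / K) * real (card V)"
        using X by (simp add: algebra_simps)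
    qed (auto simp: X_def independent_of_def)
  qed simp_all
next
  case (Suc s)
  define s1 where "s1 = Suc s"
  \<comment> \<open>Chosen so that sets containing a saturated \<open>J\<close> carry at most
    \<open>\<eta> / 4\<close>, the factor \<open>2 ^ s1\<close> counting the subsets
    \<open>J\<close>. The rejected vertices account for another \<open>\<eta> / 4\<close>, so
    \<open>\<eta> / 2\<close> is left on sets meeting big vertices.\<close>
  define \<eta>' where "\<eta>' = \<eta> / (4 * 2 ^ s1)"
  have \<eta>': "0 < \<eta>'" using Suc.prems by (simp add: \<eta>'_def)
  have "0 < 2 * K" using Suc.prems by simp
  from Suc.IH[OF this \<eta>', folded s1_def] obtain A' \<delta>' \<tau>' where C': "0 < A' \<and> 0 < \<delta>' \<and> 0 < \<tau>' \<and>
    (\<forall>(V :: 'v set) w (\<tau> :: real).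
    finite V \<and> V \<noteq> {} \<and> weighted_on V s1 w \<and> 0 < \<tau> \<and> \<tau> \<le> \<tau>' \<and> \<eta>' \<le> wdeg V w {} \<and>
    (\<forall>J. J \<noteq> {} \<and> J \<subseteq> V \<longrightarrow> wdeg V w J \<le> (2 * K) * \<tau> ^ (card J - 1) / real (card V)) \<longrightarrow>
    (\<exists>CC. finite CC \<and> real (card CC) \<le> (real (card V) + 1) powr (A' * \<tau> * real (card V)) \<and>
      (\<forall>C\<in>CC. C \<subseteq> V \<and> real (card C) \<le> (1 - \<delta>') * real (card V)) \<and>
      (\<forall>I. I \<subseteq> V \<and> independent_of w I \<longrightarrow> (\<exists>C\<in>CC. I \<subseteq> C))))"
    by (elim exE) (rule that)
  note pos' = C'[THEN conjunct1] C'[THEN conjunct2, THEN conjunct1]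
    C'[THEN conjunct2, THEN conjunct2, THEN conjunct1]
  note IH = C'[THEN conjunct2, THEN conjunct2, THEN conjunct2]
  \<comment> \<open>Each fingerprint vertex adds \<open>\<eta> / (4 * N)\<close> to a total of at
    most \<open>2 * K * \<tau>\<close>; the quotient of the two is
    \<open>A1 * \<tau> * N\<close>.\<close>
  define A1 where "A1 = 8 * K / \<eta>"
  define \<delta>1 where "\<delta>1 = \<eta> / (4 * K)"
  have pos1: "0 < A1" "0 < \<delta>1" using Suc.prems by (auto simp: A1_def \<delta>1_def)
  define \<delta> where "\<delta> = min \<delta>' \<delta>1"
  \<comment> \<open>The second bound keeps the fingerprint below \<open>\<delta>1 * N\<close>, half
    of the at least \<open>2 * \<delta>1 * N\<close> big vertices present when \<open>u T\<close> is
    light; the other half is then outside \<open>T\<close>.\<close>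
  define \<tau>0 where "\<tau>0 = min \<tau>' (\<delta>1 / A1)"
  show ?case
  proof (rule exI[of _ "A1 + A'"], rule exI[of _ \<delta>], rule exI[of _ \<tau>0], (intro conjI allI impI; (elim conjE)?))
    show "0 < A1 + A'" "0 < \<delta>" "0 < \<tau>0" using pos' pos1 by (auto simp: \<delta>_def \<tau>0_def)
    fix V :: "'v set" and w :: "'v set \<Rightarrow> real" and \<tau> :: real
    assume V: "finite V" "V \<noteq> {}" and w: "weighted_on V (Suc (Suc s)) w" and \<tau>: "0 < \<tau>" "\<tau> \<le> \<tau>0"
      and \<eta>: "\<eta> \<le> wdeg V w {}"
      and K: "\<forall>J. J \<noteq> {} \<and> J \<subseteq> V \<longrightarrow> wdeg V w J \<le> K * \<tau> ^ (card J - 1) / real (card V)"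
    define N where "N = real (card V)"
    have N: "N > 0" using V by (simp add: N_def card_gt_0_iff)
    define cap where "cap j = K * \<tau> ^ j / N" for j :: nat
    define D where "D j = K * \<tau> ^ (j - 1) / N" for j :: nat
    interpret sc: scan V cap "\<eta> / (4 * N)" w s1
      using V w by unfold_locales (auto simp: s1_def)
    obtain vs where vs: "set vs = V" "distinct vs" using finite_distinct_list[OF V(1)] by blast
    define u where "u T = sc.scan_weight T (\<lambda>_. 0) vs" for T
    define B where "B T = sc.scan_big T (\<lambda>_. 0) vs" for T
    have z: "weighted_on V s1 (\<lambda>_. 0)" by (simp add: weighted_on_def)
    have z0: "wdeg V (\<lambda>_. 0) J = 0" for J by (simp add: wdeg_def)
    have Dpos: "0 \<le> D j" for j using Suc.prems \<tau> N by (simp add: D_def)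
    have cappos: "0 < cap j" for j using Suc.prems \<tau> N by (simp add: cap_def)
    have wD: "wdeg V w J \<le> D (card J)" if "J \<noteq> {}" for J
    proof (cases "J \<subseteq> V")
      case True
      then show ?thesis using K that by (simp add: D_def N_def)
    next
      case False
      then have e: "{e. e \<subseteq> V \<and> J \<subseteq> e} = {}" by auto
      have "wdeg V w J = 0" unfolding wdeg_def by (subst e) simp
      then show ?thesis using Dpos by simp
    qed
    have u_on: "weighted_on V s1 (u T)" for T unfolding u_def by (rule sc.scan_weight_on[OF z])
    have u_nonneg: "0 \<le> wdeg V (u T) J" for T J
      using u_on by (auto simp: wdeg_def weighted_on_def sum_nonneg)
    have udeg: "wdeg V (u T) J \<le> 2 * K * \<tau> ^ card J / N" if "J \<noteq> {}" "J \<subseteq> V" for T J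
    proof -
      have "finite J" using that V finite_subset by blast
      have "wdeg V (u T) J \<le> cap (card J) + D (Suc (card J))"
        unfolding u_def using wD Dpos that \<open>finite J\<close> cappos[of "card J"]
        by (intro sc.scan_weight_deg) (auto simp: z0 intro: add_nonneg_nonneg less_imp_le)
      then show ?thesis by (simp add: cap_def D_def)
    qed
    \<comment> \<open>The vertex degrees already bound the total, since every support set has
      \<open>s1 \<ge> 1\<close> elements.\<close>
    have utot: "wdeg V (u T) {} \<le> 2 * K * \<tau>" for T
    proof -
      have "wdeg V (u T) {} \<le> real s1 * wdeg V (u T) {}"
        using u_nonneg[of T "{}"] by (simp add: s1_def algebra_simps)
      also have "\<dots> = (\<Sum>v\<in>V. wdeg V (u T) {v})" using wdeg_sum_singletons[OF V(1) u_on] by simp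
      also have "\<dots> \<le> (\<Sum>v\<in>V. 2 * K * \<tau> / N)"
        using udeg[where J = "{v}" and T = T for v] by (intro sum_mono) simp
      also have "\<dots> = 2 * K * \<tau>" using N by (simp add: N_def)
      finally show ?thesis .
    qed
    have BT: "card (B T \<inter> T) \<le> A1 * \<tau> * N" for T
    proof -
      have "\<eta> / (4 * N) * card (B T \<inter> T) \<le> wdeg V (u T) {}"
        unfolding B_def u_def using sc.scan_big_card[OF vs(2), of T "\<lambda>_. 0"] Suc.prems N by (simp add: z0)
      also have "\<dots> \<le> 2 * K * \<tau>" by (rule utot)
      finally show ?thesis using Suc.prems N by (simp add: A1_def field_simps)
    qed
    have BV: "B T \<subseteq> V" for T unfolding B_def using sc.scan_big_subset vs by blast
    have big: "card (B T - T) \<ge> \<delta>1 * N" if "wdeg V (u T) {} / \<tau> < \<eta>'" for T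
    proof -
      have "wdeg V w {} \<le> card (B T) * (K / N) + card V * (\<eta> / (4 * N)) + (1 / \<tau>) * 2 ^ s1 * wdeg V (u T) {}"
        unfolding B_def u_def
      proof (rule sc.total_le_scan[OF vs(1) _ _ _ _ z])
        show "wdeg V w {v} \<le> K / N" for v using wD[of "{v}"] by (simp add: D_def)
        show "wdeg V w J \<le> 1 / \<tau> * cap (card J)" if "J \<noteq> {}" "J \<subseteq> V" for J
        proof -
          have "card J > 0" using that V by (meson card_gt_0_iff finite_subset)
          then have "\<tau> ^ card J = \<tau> * \<tau> ^ (card J - 1)" by (simp add: power_eq_if)
          then show ?thesis using wD[OF that(1)] \<tau> by (simp add: D_def cap_def)
        qed
      qed (use Suc.prems N \<tau> in auto)
      also have "(1 / \<tau>) * 2 ^ s1 * wdeg V (u T) {} \<le> 2 ^ s1 * \<eta>'"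
        using mult_left_mono[OF less_imp_le[OF that], of "2 ^ s1"] by (simp add: mult.commute)
      also have "2 ^ s1 * \<eta>' = \<eta> / 4" by (simp add: \<eta>'_def)
      also have "card V * (\<eta> / (4 * N)) = \<eta> / 4" using N by (simp add: N_def)
      finally have "\<eta> / 2 \<le> card (B T) * (K / N)" using \<eta> by linarith
      then have *: "card (B T) \<ge> 2 * \<delta>1 * N" using N Suc.prems by (simp add: \<delta>1_def field_simps)
      have finB: "finite (B T)" using BV V finite_subset by blast
      have "card (B T) = card (B T - T) + card (B T \<inter> T)"
        using finB card_Int_Diff[of "B T" T] by simp
      moreover have "A1 * \<tau> * N \<le> \<delta>1 * N"
      proof -
        have "\<tau> \<le> \<delta>1 / A1" using \<tau> by (simp add: \<tau>0_def)
        then have "A1 * \<tau> \<le> \<delta>1" using pos1 by (simp add: field_simps)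
        then show ?thesis using N by simp
      qed
      ultimately show ?thesis using * BT[of T] by (simp add: algebra_simps)
    qed
    define P where "P T F \<longleftrightarrow> finite F \<and> real (card F) \<le> (N + 1) powr (A' * \<tau> * N) \<and>
      (\<forall>C\<in>F. C \<subseteq> V \<and> real (card C) \<le> (1 - \<delta>) * N) \<and>
      (\<forall>I. I \<subseteq> V \<and> independent_of (u T) I \<and> B T \<inter> I = T \<longrightarrow> (\<exists>C\<in>F. I \<subseteq> C))" for T F
    have "\<exists>F. P T F" for T
    proof (cases "wdeg V (u T) {} / \<tau> < \<eta>'")
      case True
      have sub: "B T - T \<subseteq> V" using BV[of T] by auto
      then have "card (V - (B T - T)) = card V - card (B T - T)" "card (B T - T) \<le> card V"
        using V card_Diff_subset[OF finite_subset[OF sub V(1)] sub] card_mono[OF V(1) sub] by auto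
      then have "real (card (V - (B T - T))) \<le> (1 - \<delta>1) * N"
        using big[OF True] by (simp add: of_nat_diff N_def algebra_simps)
      also have "\<dots> \<le> (1 - \<delta>) * N" using N by (simp add: \<delta>_def)
      finally have "P T {V - (B T - T)}"
        using N \<tau> pos' by (auto simp: P_def intro!: ge_one_powr_ge_zero)
      then show ?thesis by blast
    next
      case False
      define u' where "u' = (\<lambda>e. u T e / \<tau>)"
      have u': "wdeg V u' J = wdeg V (u T) J / \<tau>" for J
        by (simp add: u'_def wdeg_def sum_divide_distrib)
      have "weighted_on V s1 u'" using u_on[of T] \<tau> by (auto simp: weighted_on_def u'_def)
      moreover have "wdeg V u' J \<le> (2 * K) * \<tau> ^ (card J - 1) / real (card V)" if "J \<noteq> {}" "J \<subseteq> V" for J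
      proof -
        have "card J > 0" using that V by (meson card_gt_0_iff finite_subset)
        then have "\<tau> ^ card J = \<tau> * \<tau> ^ (card J - 1)" by (simp add: power_eq_if)
        then show ?thesis using udeg[OF that, of T] \<tau> by (simp add: u' N_def field_simps)
      qed
      ultimately have "\<exists>CC. finite CC \<and> real (card CC) \<le> (real (card V) + 1) powr (A' * \<tau> * real (card V)) \<and>
          (\<forall>C\<in>CC. C \<subseteq> V \<and> real (card C) \<le> (1 - \<delta>') * real (card V)) \<and>
          (\<forall>I. I \<subseteq> V \<and> independent_of u' I \<longrightarrow> (\<exists>C\<in>CC. I \<subseteq> C))"
        using IH[rule_format, of V u' \<tau>] V \<tau> False by (simp add: u' \<tau>0_def)
      then obtain CC where CC: "finite CC" "real (card CC) \<le> (N + 1) powr (A' * \<tau> * N)"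
          "\<forall>C\<in>CC. C \<subseteq> V \<and> real (card C) \<le> (1 - \<delta>') * N"
          "\<forall>I. I \<subseteq> V \<and> independent_of u' I \<longrightarrow> (\<exists>C\<in>CC. I \<subseteq> C)"
        by (auto simp: N_def)
      have "(1 - \<delta>') * N \<le> (1 - \<delta>) * N" using N by (simp add: \<delta>_def)
      moreover have "independent_of u' I \<longleftrightarrow> independent_of (u T) I" for I
        using \<tau> by (simp add: independent_of_def u'_def)
      ultimately have "P T CC" using CC unfolding P_def by (meson order_trans)
      then show ?thesis by blast
    qed
    then obtain F where F: "P T (F T)" for T by metis
    define TT where "TT = {T. T \<subseteq> V \<and> real (card T) \<le> A1 * \<tau> * N}"
    have TT: "finite TT" using V by (simp add: TT_def)
    define CC where "CC = (\<Union>T\<in>TT. F T)"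
    show "\<exists>CC. finite CC \<and> real (card CC) \<le> (real (card V) + 1) powr ((A1 + A') * \<tau> * real (card V)) \<and>
      (\<forall>C\<in>CC. C \<subseteq> V \<and> real (card C) \<le> (1 - \<delta>) * real (card V)) \<and>
      (\<forall>I. I \<subseteq> V \<and> independent_of w I \<longrightarrow> (\<exists>C\<in>CC. I \<subseteq> C))"
    proof (intro exI[of _ CC] conjI allI impI)
      show "finite CC" using TT F by (auto simp: CC_def P_def)
      have "real (card CC) \<le> (\<Sum>T\<in>TT. real (card (F T)))"
        unfolding CC_def using card_UN_le[OF TT, of F] by (metis of_nat_le_iff of_nat_sum)
      also have "\<dots> \<le> (\<Sum>T\<in>TT. (N + 1) powr (A' * \<tau> * N))"
        using F by (intro sum_mono) (auto simp: P_def)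
      also have "\<dots> \<le> (N + 1) powr (A1 * \<tau> * N) * (N + 1) powr (A' * \<tau> * N)"
        using card_small_subsets_powr[OF V(1), of "A1 * \<tau> * N"] pos1 \<tau> N
        by (simp add: TT_def N_def)
      also have "\<dots> = (N + 1) powr ((A1 + A') * \<tau> * N)"
        by (simp add: powr_add[symmetric] algebra_simps)
      finally show "real (card CC) \<le> (real (card V) + 1) powr ((A1 + A') * \<tau> * real (card V))" by (simp add: N_def)
      show "\<forall>C\<in>CC. C \<subseteq> V \<and> real (card C) \<le> (1 - \<delta>) * real (card V)"
        using F by (auto simp: CC_def P_def N_def)
      fix I assume I: "I \<subseteq> V \<and> independent_of w I"
      \<comment> \<open>Scanning with \<open>T\<close> instead of \<open>I\<close> gives the same
        weight, so the family \<open>F T\<close>, computed without knowledge of \<open>I\<close>,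
        belongs to a weight in which \<open>I\<close> is independent.\<close>
      define T where "T = B I \<inter> I"
      have "u T = u I \<and> B T = B I"
        unfolding u_def B_def by (rule sc.scan_cong) (auto simp: T_def B_def)
      moreover have "independent_of (u I) I"
        unfolding independent_of_def
      proof (intro allI impI notI)
        fix e assume "u I e \<noteq> 0" "e \<subseteq> I"
        then obtain v where "v \<in> I" "w (insert v e) \<noteq> 0"
          unfolding u_def using sc.scan_weight_supp[of I "\<lambda>_. 0" vs e] by auto
        then show False using I \<open>e \<subseteq> I\<close> by (auto simp: independent_of_def)
      qed
      moreover have "T \<in> TT" using BT[of I] I by (auto simp: TT_def T_def)
      ultimately show "\<exists>C\<in>CC. I \<subseteq> C"
        using F[of T] I unfolding P_def CC_def T_def by (metis UN_I)
    qed
  qed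
qed

section \<open>Spread random embeddings of hypertrees\<close>

text \<open>
  A random copy of \<open>H\<close> in \<open>G\<close> such that a prescribed edge of \<open>G\<close> is hit with probability at most
  \<open>\<alpha>\<close>, and every further prescribed edge costs another factor \<open>\<beta>\<close>.
\<close>

definition spread_copies ::
    "'a set set \<Rightarrow> 'b set set \<Rightarrow> real \<Rightarrow> real \<Rightarrow> ('a \<Rightarrow> 'b) pmf \<Rightarrow> bool" where
  "spread_copies H G \<alpha> \<beta> \<mu> \<longleftrightarrow>
     (\<forall>f\<in>set_pmf \<mu>. inj_on f (\<Union>H) \<and> (\<forall>E\<in>H. f ` E \<in> G)) \<and>
     (\<forall>H' \<gamma>. H' \<subseteq> H \<and> H' \<noteq> {} \<longrightarrow>
        measure_pmf.prob \<mu> {f. \<forall>E\<in>H'. f ` E = \<gamma> E} \<le> \<alpha> * \<beta> ^ (card H' - 1))"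

lemma spread_copiesD:
  assumes "spread_copies H G \<alpha> \<beta> \<mu>"
  shows "f \<in> set_pmf \<mu> \<Longrightarrow> inj_on f (\<Union>H)" "f \<in> set_pmf \<mu> \<Longrightarrow> E \<in> H \<Longrightarrow> f ` E \<in> G"
    "H' \<subseteq> H \<Longrightarrow> H' \<noteq> {} \<Longrightarrow>
      measure_pmf.prob \<mu> {f. \<forall>E\<in>H'. f ` E = \<gamma> E} \<le> \<alpha> * \<beta> ^ (card H' - 1)"
  using assms by (auto simp: spread_copies_def)

text \<open>Averages a conditional bound that depends on the outcome only through finitely many
  events. One event suffices when earlier edges are prescribed; the marginal of a newly placed edge
  needs one event per possible image of its intersection with the old part.\<close>

lemma prob_bind_pmf_le:
  fixes c :: "'i \<Rightarrow> real"
  assumes "finite I"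
    and "\<And>f. f \<in> set_pmf \<mu> \<Longrightarrow> measure_pmf.prob (K f) X \<le> (\<Sum>i\<in>I. c i * indicator (S i) f)"
  shows "measure_pmf.prob (bind_pmf \<mu> K) X \<le> (\<Sum>i\<in>I. c i * measure_pmf.prob \<mu> (S i))"
proof -
  have "measure_pmf.prob (bind_pmf \<mu> K) X = measure_pmf.expectation \<mu> (\<lambda>f. measure_pmf.prob (K f) X)"
    unfolding measure_pmf_bind
    by (subst measure_pmf.measure_bind[where N = "count_space UNIV"]) (auto simp: measure_pmf_in_subprob_algebra)
  also have "\<dots> \<le> measure_pmf.expectation \<mu> (\<lambda>f. \<Sum>i\<in>I. c i * indicator (S i) f)"
  proof (rule integral_mono_AE)
    show "integrable (measure_pmf \<mu>) (\<lambda>f. measure_pmf.prob (K f) X)"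
      by (rule measure_pmf.integrable_const_bound[where B = 1]) auto
    show "AE f in measure_pmf \<mu>. measure_pmf.prob (K f) X \<le> (\<Sum>i\<in>I. c i * indicator (S i) f)"
      using assms(2) by (auto simp: AE_measure_pmf_iff)
  qed (auto intro!: Bochner_Integration.integrable_sum integrable_mult_right
        measure_pmf.integrable_const_bound[where B = 1])
  also have "\<dots> = (\<Sum>i\<in>I. c i * measure_pmf.prob \<mu> (S i))"
    by (subst Bochner_Integration.integral_sum)
       (auto intro!: integrable_mult_right measure_pmf.integrable_const_bound[where B = 1])
  finally show ?thesis .
qed

lemma prob_pmf_le_sum:
  assumes "finite I" "\<And>f. f \<in> set_pmf \<mu> \<Longrightarrow> f \<in> X \<Longrightarrow> \<exists>i\<in>I. f \<in> S i"
  shows "measure_pmf.prob \<mu> X \<le> (\<Sum>i\<in>I. measure_pmf.prob \<mu> (S i))"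
proof -
  have "measure_pmf.prob \<mu> X = measure_pmf.prob \<mu> (X \<inter> set_pmf \<mu>)"
    by (simp add: measure_Int_set_pmf)
  also have "\<dots> \<le> measure_pmf.prob \<mu> (\<Union>i\<in>I. S i)"
    using assms(2) by (intro measure_pmf.finite_measure_mono) auto
  also have "\<dots> \<le> (\<Sum>i\<in>I. measure_pmf.prob \<mu> (S i))"
    using assms(1) by (intro measure_pmf.finite_measure_subadditive_finite) auto
  finally show ?thesis .
qed

lemma ex_bij_betw_respecting:
  assumes "finite P" "finite Q" "card P = card Q" "card (P \<inter> S) = card (Q \<inter> T)"
  shows "\<exists>h. bij_betw h P Q \<and> (\<forall>v\<in>P. h v \<in> T \<longleftrightarrow> v \<in> S)"
proof -
  have "card (P - S) = card (Q - T)"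
    using assms by (simp add: card_Diff_subset_Int)
  then obtain h1 h2 where h: "bij_betw h1 (P \<inter> S) (Q \<inter> T)" "bij_betw h2 (P - S) (Q - T)"
    using assms finite_same_card_bij by (metis finite_Diff finite_Int)
  define h where "h v = (if v \<in> S then h1 v else h2 v)" for v
  have "bij_betw h (P \<inter> S) (Q \<inter> T)" "bij_betw h (P - S) (Q - T)"
    using h by (subst bij_betw_cong[where g = h1], auto simp: h_def)
      (use h in \<open>subst bij_betw_cong[where g = h2], auto simp: h_def\<close>)
  then have "bij_betw h ((P \<inter> S) \<union> (P - S)) ((Q \<inter> T) \<union> (Q - T))"
    by (rule bij_betw_combine) auto
  moreover have "h v \<in> T \<longleftrightarrow> v \<in> S" if "v \<in> P" for v
    using h that by (auto simp: h_def bij_betw_def)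
  ultimately show ?thesis by (metis Int_Diff_Un)
qed

lemma inj_on_image_edges:
  assumes "inj_on f (\<Union>H)"
  shows "inj_on ((`) f) H"
  using assms by (intro inj_onI) (meson Union_upper inj_on_image_eq_iff)

text \<open>Each of the at most \<open>q\<close> forbidden vertices outside \<open>A\<close> spoils
  at most a fraction \<open>1 / (2 * q)\<close> of the sets through \<open>A\<close>, so at least
  half of them survive.\<close>

lemma card_avoiding_edges:
  assumes "finite GG" "finite Y" "card Y \<le> q"
    and "\<And>y. y \<in> Y \<Longrightarrow> y \<notin> A \<Longrightarrow> 2 * q * card {g\<in>GG. insert y A \<subseteq> g} \<le> card {g\<in>GG. A \<subseteq> g}"
  shows "card {g\<in>GG. A \<subseteq> g} \<le> 2 * card {g\<in>GG. A \<subseteq> g \<and> (g - A) \<inter> Y = {}}"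
proof (cases "q = 0")
  case True
  then have "Y = {}" using assms by simp
  then show ?thesis by simp
next
  case False
  let ?d = "card {g\<in>GG. A \<subseteq> g}"
  let ?N = "{g\<in>GG. A \<subseteq> g \<and> (g - A) \<inter> Y = {}}"
  let ?B = "{g\<in>GG. A \<subseteq> g \<and> (g - A) \<inter> Y \<noteq> {}}"
  have "?B \<subseteq> (\<Union>y\<in>Y - A. {g\<in>GG. insert y A \<subseteq> g})" by auto
  then have "card ?B \<le> card (\<Union>y\<in>Y - A. {g\<in>GG. insert y A \<subseteq> g})"
    using assms by (intro card_mono) auto
  also have "\<dots> \<le> (\<Sum>y\<in>Y - A. card {g\<in>GG. insert y A \<subseteq> g})"
    using assms by (intro card_UN_le) auto
  finally have "2 * q * card ?B \<le> (\<Sum>y\<in>Y - A. 2 * q * card {g\<in>GG. insert y A \<subseteq> g})"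
    by (simp add: sum_distrib_left[symmetric])
  also have "\<dots> \<le> (\<Sum>y\<in>Y - A. ?d)" using assms(4) by (intro sum_mono) auto
  also have "\<dots> \<le> q * ?d"
    using assms(2,3) card_mono[of Y "Y - A"] by (simp add: mult_le_mono1 order_trans)
  finally have "2 * card ?B \<le> ?d" using False by simp
  moreover have "?d = card ?N + card ?B"
    using assms(1) by (subst card_Un_disjoint[symmetric]) (auto intro!: arg_cong[of _ _ card])
  ultimately show ?thesis by simp
qed


text \<open>The tree is built edge by edge: the new edge is uniform among the members of
  \<open>GG\<close> that contain the image of the intersection and otherwise avoid the image so far.
  By \<open>deg_insert\<close> these are at least half of all members through that image, and the 2
  in \<open>deg\<close> pays for this loss, so a prescribed new edge costs at most
  \<open>\<beta>\<close> given the rest. The sets \<open>M\<close> and \<open>MH\<close> keep all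
  intersections inside the part of each edge where the degree conditions are assumed.\<close>

lemma spread_embedding:
  fixes GG :: "'b set set" and H :: "'a set set" and \<beta> :: real
  assumes H: "hypertree H"
    and GG: "finite GG" "GG \<noteq> {}" "\<And>e. e \<in> GG \<Longrightarrow> finite e \<and> card e = r \<and> card (e \<inter> M) = m"
    and HE: "\<And>E. E \<in> H \<Longrightarrow> finite E \<and> card E = r \<and> card (E \<inter> MH) = m"
    and HI: "\<And>E F. E \<in> H \<Longrightarrow> F \<in> H \<Longrightarrow> E \<noteq> F \<Longrightarrow> E \<inter> F \<subseteq> MH \<and> card (E \<inter> F) \<le> l"
    and q: "card (\<Union>H) \<le> q"
    and deg: "\<And>e A. e \<in> GG \<Longrightarrow> A \<subseteq> e \<inter> M \<Longrightarrow> card A \<le> l \<Longrightarrow> 2 \<le> \<beta> * card {g\<in>GG. A \<subseteq> g}"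
    and deg_insert: "\<And>e A y. e \<in> GG \<Longrightarrow> A \<subseteq> e \<inter> M \<Longrightarrow> card A \<le> l \<Longrightarrow> y \<notin> A \<Longrightarrow>
      2 * q * card {g\<in>GG. insert y A \<subseteq> g} \<le> card {g\<in>GG. A \<subseteq> g}"
  shows "\<exists>\<mu>. spread_copies H GG ((2 ^ (r + 1)) ^ card H / card GG) \<beta> \<mu> \<and>
    (\<forall>f\<in>set_pmf \<mu>. \<forall>v\<in>\<Union>H. f v \<in> M \<longleftrightarrow> v \<in> MH)"
  using H HE HI q
proof (induction rule: hypertree.induct)
  case (single E)
  have "\<exists>h. bij_betw h E e \<and> (\<forall>v\<in>E. h v \<in> M \<longleftrightarrow> v \<in> MH)" if "e \<in> GG" for e
    using single.prems(1)[of E] GG(3)[OF that] by (intro ex_bij_betw_respecting) auto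
  then obtain h where h: "\<And>e. e \<in> GG \<Longrightarrow> bij_betw (h e) E e"
      "\<And>e v. e \<in> GG \<Longrightarrow> v \<in> E \<Longrightarrow> h e v \<in> M \<longleftrightarrow> v \<in> MH" by metis
  define \<mu> where "\<mu> = map_pmf h (pmf_of_set GG)"
  have "measure_pmf.prob \<mu> {f. \<forall>E\<in>H'. f ` E = \<gamma> E} \<le> (2 ^ (r + 1)) ^ card {E} / card GG * \<beta> ^ (card H' - 1)"
    if "H' \<subseteq> {E}" "H' \<noteq> {}" for H' \<gamma>
  proof -
    have H': "H' = {E}" using that by auto
    have "measure_pmf.prob \<mu> {f. \<forall>E\<in>H'. f ` E = \<gamma> E} = measure_pmf.prob (pmf_of_set GG) {e. h e ` E = \<gamma> E}"
      by (simp add: \<mu>_def H' vimage_def)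
    also have "\<dots> = card (GG \<inter> {e. h e ` E = \<gamma> E}) / card GG"
      using GG by (simp add: measure_pmf_of_set)
    also have "card (GG \<inter> {e. h e ` E = \<gamma> E}) \<le> card {\<gamma> E}"
      using h by (intro card_mono) (auto simp: bij_betw_def)
    finally have "measure_pmf.prob \<mu> {f. \<forall>E\<in>H'. f ` E = \<gamma> E} \<le> 1 / card GG"
      by (simp add: divide_right_mono)
    also have "\<dots> \<le> 2 ^ (r + 1) / card GG"
      by (intro divide_right_mono one_le_power) auto
    finally show ?thesis by (simp add: H')
  qed
  then show ?case
    using h GG by (intro exI[of _ \<mu>]) (auto simp: spread_copies_def \<mu>_def bij_betw_def)
next
  case (extend H E F)
  define K where "K = E \<inter> F"
  define \<alpha> where "\<alpha> = (2 ^ (r + 1)) ^ card H / card GG"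
  have finH: "finite H" using extend.hyps(1) by (induction rule: hypertree.induct) auto
  have finE: "finite E'" if "E' \<in> insert E H" for E' using extend.prems(1) that by blast
  have finU: "finite (\<Union>H)" using finH finE by auto
  have "\<Union>H \<subseteq> \<Union>(insert E H)" "finite (\<Union>(insert E H))" using finU finE by auto
  then have q: "card (\<Union>H) \<le> q" using extend.prems(3) card_mono by (meson le_trans)
  have "\<exists>\<mu>. spread_copies H GG \<alpha> \<beta> \<mu> \<and> (\<forall>f\<in>set_pmf \<mu>. \<forall>v\<in>\<Union>H. f v \<in> M \<longleftrightarrow> v \<in> MH)"
    unfolding \<alpha>_def using extend.prems q by (intro extend.IH) auto
  then obtain \<mu> where sp: "spread_copies H GG \<alpha> \<beta> \<mu>"
    and mm: "\<And>f v. f \<in> set_pmf \<mu> \<Longrightarrow> v \<in> \<Union>H \<Longrightarrow> f v \<in> M \<longleftrightarrow> v \<in> MH" by blast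
  have inj: "inj_on f (\<Union>H)" and im: "\<And>E'. E' \<in> H \<Longrightarrow> f ` E' \<in> GG" if "f \<in> set_pmf \<mu>" for f
    using sp that by (auto simp: spread_copies_def)
  have EF: "E \<noteq> F" using extend.hyps by auto
  have KU: "E \<inter> \<Union>H = K" using extend.hyps by (simp add: K_def)
  have K: "K \<subseteq> MH" "card K \<le> l" "K \<subseteq> F" "K \<subseteq> E" "K \<subseteq> \<Union>H" "finite K"
    using extend.prems(2)[of E F] extend.hyps(3) EF finE[of E] by (auto simp: K_def)
  define d where "d A = card {g\<in>GG. A \<subseteq> g}" for A
  define N where "N f = {g\<in>GG. f ` K \<subseteq> g \<and> (g - f ` K) \<inter> f ` \<Union>H = {}}" for f
  have A: "f ` K \<subseteq> f ` F \<inter> M" "card (f ` K) = card K" "f ` F \<in> GG" if "f \<in> set_pmf \<mu>" for f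
  proof -
    have "f v \<in> M" if "v \<in> K" for v
      using mm[OF \<open>f \<in> set_pmf \<mu>\<close>, of v] K(1,5) that by blast
    then show "f ` K \<subseteq> f ` F \<inter> M" using K(3) by auto
  qed (use im[OF that extend.hyps(3)] inj_on_subset[OF inj[OF that] K(5)] in \<open>auto simp: card_image\<close>)
  have dN: "d (f ` K) \<le> 2 * card (N f)" if "f \<in> set_pmf \<mu>" for f
    unfolding d_def N_def
  proof (rule card_avoiding_edges[OF GG(1)])
    show "finite (f ` \<Union>H)" using finU by simp
    show "card (f ` \<Union>H) \<le> q" using card_image_le[OF finU, of f] q by simp
    show "2 * q * card {g\<in>GG. insert y (f ` K) \<subseteq> g} \<le> card {g\<in>GG. f ` K \<subseteq> g}" if "y \<notin> f ` K" for y
      using deg_insert[of "f ` F" "f ` K" y] A[OF \<open>f \<in> set_pmf \<mu>\<close>] K(2) that by auto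
  qed
  have d2: "2 \<le> \<beta> * d (f ` K)" if "f \<in> set_pmf \<mu>" for f
    using deg[of "f ` F" "f ` K"] A[OF that] K(2) by (auto simp: d_def)
  have dpos: "0 < d (f ` K)" if "f \<in> set_pmf \<mu>" for f
    using d2[OF that] by (cases "d (f ` K) = 0") auto
  have \<beta>: "0 < \<beta>"
  proof -
    obtain f where "f \<in> set_pmf \<mu>" using set_pmf_not_empty by fastforce
    from d2[OF this] dpos[OF this] show ?thesis
      by (smt (verit) mult_nonpos_nonneg of_nat_0_le_iff)
  qed
  have finN: "finite (N f)" for f using GG by (simp add: N_def)
  have Npos: "N f \<noteq> {}" "0 < card (N f)" if "f \<in> set_pmf \<mu>" for f
    using dN[OF that] dpos[OF that] finN by (auto simp: card_gt_0_iff)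
  have "\<exists>f'. (\<forall>v\<in>\<Union>H. f' v = f v) \<and> inj_on f' (\<Union>(insert E H)) \<and> f' ` E = g \<and>
      (\<forall>v\<in>\<Union>(insert E H). f' v \<in> M \<longleftrightarrow> v \<in> MH)" if f: "f \<in> set_pmf \<mu>" and g: "g \<in> N f" for f g
  proof -
    have gG: "finite g" "card g = r" "card (g \<inter> M) = m" using g GG(3) by (auto simp: N_def)
    have EE: "finite E" "card E = r" "card (E \<inter> MH) = m" using extend.prems(1) by auto
    have fK: "f ` K \<subseteq> g" "f ` K \<subseteq> M" "card (f ` K) = card K" "finite (f ` K)"
      using g A[OF f] K by (auto simp: N_def)
    have "card (E - K) = card (g - f ` K)"
      using gG EE K fK by (simp add: card_Diff_subset)
    moreover have "card ((E - K) \<inter> MH) = card ((g - f ` K) \<inter> M)"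
    proof -
      have "(E - K) \<inter> MH = (E \<inter> MH) - K" "(g - f ` K) \<inter> M = (g \<inter> M) - f ` K" by auto
      moreover have "K \<subseteq> E \<inter> MH" "f ` K \<subseteq> g \<inter> M" using K fK by auto
      ultimately show ?thesis using gG EE K fK by (simp add: card_Diff_subset)
    qed
    ultimately obtain h where h: "bij_betw h (E - K) (g - f ` K)" "\<forall>v\<in>E - K. h v \<in> M \<longleftrightarrow> v \<in> MH"
      using ex_bij_betw_respecting[of "E - K" "g - f ` K" MH M] gG EE by auto
    define f' where "f' v = (if v \<in> \<Union>H then f v else h v)" for v
    have U: "\<Union>(insert E H) = \<Union>H \<union> (E - K)" using KU by auto
    have dis: "v \<notin> \<Union>H" if "v \<in> E - K" for v using that KU by auto
    have f'U: "f' v = f v" if "v \<in> \<Union>H" for v using that unfolding f'_def by (rule if_P)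
    have f'E: "f' v = h v" if "v \<in> E - K" for v using dis[OF that] unfolding f'_def by (rule if_not_P)
    have imE: "f' ` (E - K) = g - f ` K"
      using h(1) f'E by (metis bij_betw_imp_surj_on image_cong)
    have imU: "f' ` \<Union>H = f ` \<Union>H" using f'U by (metis image_cong)
    have "inj_on f' (\<Union>H \<union> (E - K))"
      unfolding inj_on_Un
    proof (intro conjI)
      show "inj_on f' (\<Union>H)" using inj[OF f] f'U by (metis inj_on_cong)
      show "inj_on f' (E - K)" using h(1) f'E by (metis bij_betw_imp_inj_on inj_on_cong)
      show "f' ` (\<Union>H - (E - K)) \<inter> f' ` (E - K - \<Union>H) = {}"
      proof -
        have "f' ` (\<Union>H - (E - K)) \<subseteq> f ` \<Union>H" unfolding imU[symmetric] by (rule image_mono) (rule Diff_subset)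
        moreover have "f' ` (E - K - \<Union>H) \<subseteq> g - f ` K" unfolding imE[symmetric] by (rule image_mono) (rule Diff_subset)
        moreover have "(g - f ` K) \<inter> f ` \<Union>H = {}" using g unfolding N_def by (elim CollectE conjE)
        ultimately show ?thesis by (smt (verit, best) disjoint_iff subsetD)
      qed
    qed
    moreover have "f' ` E = g"
    proof -
      have "E = K \<union> (E - K)" using K by auto
      then have "f' ` E = f' ` K \<union> f' ` (E - K)" by (metis image_Un)
      also have "f' ` K = f ` K" using f'U K(5) by (metis image_cong subsetD)
      finally show ?thesis using imE fK by auto
    qed
    moreover have "f' v \<in> M \<longleftrightarrow> v \<in> MH" if "v \<in> \<Union>(insert E H)" for v
    proof (cases "v \<in> \<Union>H")
      case True
      then show ?thesis using f'U[OF True] mm[OF f True] by simp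
    next
      case False
      then have v: "v \<in> E - K" using that unfolding U by (rule_tac UnE) auto
      then show ?thesis using f'E[OF v] h(2) by simp
    qed
    ultimately show ?thesis using f'U unfolding U by (intro exI[of _ f'] conjI ballI) simp_all
  qed
  then obtain ext where ext: "\<And>f g. f \<in> set_pmf \<mu> \<Longrightarrow> g \<in> N f \<Longrightarrow>
      (\<forall>v\<in>\<Union>H. ext f g v = f v) \<and> inj_on (ext f g) (\<Union>(insert E H)) \<and> ext f g ` E = g \<and>
      (\<forall>v\<in>\<Union>(insert E H). ext f g v \<in> M \<longleftrightarrow> v \<in> MH)" by metis
  define step where "step f = map_pmf (ext f) (pmf_of_set (N f))" for f
  define \<nu> where "\<nu> = bind_pmf \<mu> step"
  define \<alpha>' where "\<alpha>' = (2 ^ (r + 1)) ^ card (insert E H) / card GG"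
  have setstep: "set_pmf (step f) = ext f ` N f" if "f \<in> set_pmf \<mu>" for f
    using Npos[OF that] finN by (simp add: step_def set_pmf_of_set)
  have extim: "ext f g ` E' = f ` E'" if "f \<in> set_pmf \<mu>" "g \<in> N f" "E' \<in> H" for f g E'
    using ext[OF that(1,2)] that(3) by (intro image_cong) auto
  have stepim: "f' ` E' = f ` E'" if "f \<in> set_pmf \<mu>" "f' \<in> set_pmf (step f)" "E' \<in> H" for f f' E'
    using that(2) extim[OF that(1) _ that(3)] unfolding setstep[OF that(1)] by (elim imageE) simp
  have pE: "measure_pmf.prob (step f) {f'. f' ` E = G} \<le> (if G \<in> N f then 1 / card (N f) else 0)"
    if f: "f \<in> set_pmf \<mu>" for f G
  proof -
    have "measure_pmf.prob (step f) {f'. f' ` E = G} = measure_pmf.prob (pmf_of_set (N f)) {g. ext f g ` E = G}"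
      by (simp add: step_def vimage_def)
    also have "\<dots> = card (N f \<inter> {g. ext f g ` E = G}) / card (N f)"
      using Npos[OF f] finN by (simp add: measure_pmf_of_set)
    also have "N f \<inter> {g. ext f g ` E = G} = (if G \<in> N f then {G} else {})"
      using ext[OF f] by auto
    finally show ?thesis by auto
  qed
  have \<alpha>_le: "\<alpha> \<le> \<alpha>'" "2 ^ (r + 1) * \<alpha> \<le> \<alpha>'" and \<alpha>_nonneg: "0 \<le> \<alpha>"
  proof -
    have c: "card (insert E H) = Suc (card H)" using finH extend.hyps by simp
    show *: "2 ^ (r + 1) * \<alpha> \<le> \<alpha>'" unfolding \<alpha>_def \<alpha>'_def c by simp
    show "0 \<le> \<alpha>" by (simp add: \<alpha>_def)
    then have "1 * \<alpha> \<le> 2 ^ (r + 1) * \<alpha>" by (intro mult_right_mono one_le_power) auto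
    then show "\<alpha> \<le> \<alpha>'" using * by simp
  qed
  have spH: "measure_pmf.prob \<mu> {f. \<forall>E\<in>H'. f ` E = \<gamma> E} \<le> \<alpha> * \<beta> ^ (card H' - 1)"
    if "H' \<subseteq> H" "H' \<noteq> {}" for H' \<gamma> using sp that by (auto simp: spread_copies_def)
  have bound: "measure_pmf.prob \<nu> {f. \<forall>E\<in>H'. f ` E = \<gamma> E} \<le> \<alpha>' * \<beta> ^ (card H' - 1)"
    if H': "H' \<subseteq> insert E H" "H' \<noteq> {}" for H' \<gamma>
  proof (cases "E \<in> H'")
    case False
    then have sub: "H' \<subseteq> H" using H' by auto
    have "measure_pmf.prob \<nu> {f. \<forall>E\<in>H'. f ` E = \<gamma> E} \<le>
        (\<Sum>i\<in>{()}. 1 * measure_pmf.prob \<mu> {f. \<forall>E\<in>H'. f ` E = \<gamma> E})"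
      unfolding \<nu>_def
    proof (rule prob_bind_pmf_le)
      fix f assume f: "f \<in> set_pmf \<mu>"
      show "measure_pmf.prob (step f) {f. \<forall>E\<in>H'. f ` E = \<gamma> E}
          \<le> (\<Sum>i\<in>{()}. 1 * indicator {f. \<forall>E\<in>H'. f ` E = \<gamma> E} f)"
      proof (cases "\<forall>E\<in>H'. f ` E = \<gamma> E")
        case False
        then obtain E' where E': "E' \<in> H'" "f ` E' \<noteq> \<gamma> E'" by blast
        then have "{f. \<forall>E\<in>H'. f ` E = \<gamma> E} \<inter> set_pmf (step f) = {}"
          using stepim[OF f _ subsetD[OF sub E'(1)]] by (simp add: disjoint_iff) metis
        then have "measure_pmf.prob (step f) {f. \<forall>E\<in>H'. f ` E = \<gamma> E} = 0"
          by (simp add: measure_pmf_zero_iff Int_commute)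
        then show ?thesis by simp
      qed simp
    qed simp
    also have "\<dots> \<le> \<alpha> * \<beta> ^ (card H' - 1)" using spH[OF sub H'(2)] by simp
    also have "\<dots> \<le> \<alpha>' * \<beta> ^ (card H' - 1)" using \<alpha>_le \<beta> by (intro mult_right_mono) auto
    finally show ?thesis .
  next
    case True
    define H'' where "H'' = H' - {E}"
    have H'': "H'' \<subseteq> H" "H' = insert E H''" "E \<notin> H''" using H' True by (auto simp: H''_def)
    have finH'': "finite H''" using H'' finH finite_subset by blast
    have stepE: "measure_pmf.prob (step f) {f. \<forall>E\<in>H'. f ` E = \<gamma> E} \<le>
        measure_pmf.prob (step f) {f'. f' ` E = \<gamma> E}" for f
      using True by (intro measure_pmf.finite_measure_mono) auto
    show ?thesis
    proof (cases "H'' = {}")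
      case False
      have "measure_pmf.prob \<nu> {f. \<forall>E\<in>H'. f ` E = \<gamma> E} \<le>
          (\<Sum>i\<in>{()}. \<beta> * measure_pmf.prob \<mu> {f. \<forall>E\<in>H''. f ` E = \<gamma> E})"
        unfolding \<nu>_def
      proof (rule prob_bind_pmf_le)
        fix f assume f: "f \<in> set_pmf \<mu>"
        show "measure_pmf.prob (step f) {f. \<forall>E\<in>H'. f ` E = \<gamma> E}
            \<le> (\<Sum>i\<in>{()}. \<beta> * indicator {f. \<forall>E\<in>H''. f ` E = \<gamma> E} f)"
        proof (cases "\<forall>E\<in>H''. f ` E = \<gamma> E")
          case False
          then obtain E' where E': "E' \<in> H''" "f ` E' \<noteq> \<gamma> E'" by blast
          then have "{f. \<forall>E\<in>H'. f ` E = \<gamma> E} \<inter> set_pmf (step f) = {}"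
            using stepim[OF f _ subsetD[OF H''(1) E'(1)]] H''(2) by (simp add: disjoint_iff) metis
          then have "measure_pmf.prob (step f) {f. \<forall>E\<in>H'. f ` E = \<gamma> E} = 0"
            by (simp add: measure_pmf_zero_iff Int_commute)
          then show ?thesis using \<beta> by simp
        next
          case True
          have "measure_pmf.prob (step f) {f. \<forall>E\<in>H'. f ` E = \<gamma> E} \<le> 1 / card (N f)"
            using stepE[of f] pE[OF f, of "\<gamma> E"] by (smt (verit) of_nat_0_le_iff zero_le_divide_1_iff)
          \<comment> \<open>Worst case over the position of the intersection; affordable here
            because another prescribed edge already contributes the \<open>\<alpha>\<close>.\<close>
          also have "\<dots> \<le> \<beta>"
          proof -
            have "2 \<le> \<beta> * (2 * card (N f))"
              using d2[OF f] mult_left_mono[of "real (d (f ` K))" "2 * card (N f)" \<beta>] dN[OF f] \<beta> by linarith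
            then show ?thesis using Npos(2)[OF f] by (simp add: field_simps)
          qed
          finally show ?thesis using True by simp
        qed
      qed simp
      also have "\<dots> \<le> \<beta> * (\<alpha> * \<beta> ^ (card H'' - 1))"
        using spH[OF H''(1) False] \<beta> by simp
      also have "\<dots> = \<alpha> * \<beta> ^ (card H' - 1)"
      proof -
        have "card H'' > 0" using False finH'' by (simp add: card_gt_0_iff)
        then have "\<beta> ^ card H'' = \<beta> * \<beta> ^ (card H'' - 1)" by (simp add: power_eq_if)
        moreover have "card H' - 1 = card H''" using H'' finH'' by simp
        ultimately show ?thesis by simp
      qed
      also have "\<dots> \<le> \<alpha>' * \<beta> ^ (card H' - 1)" using \<alpha>_le \<beta> by (intro mult_right_mono) auto
      finally show ?thesis .
    next
      \<comment> \<open>With only the new edge prescribed, a worst-case bound would give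
        \<open>\<beta>\<close> where \<open>\<alpha>'\<close> is needed. Summing over the possible
        images \<open>A\<close> of \<open>K\<close> instead, the choice probability
        \<open>2 / d A\<close> cancels against the \<open>d A\<close> possible images of
        \<open>F\<close> through \<open>A\<close>, each of probability at most
        \<open>\<alpha>\<close>. There are at most \<open>2 ^ r\<close> sets \<open>A\<close>, hence
        a factor \<open>2 ^ (r + 1)\<close> per edge of the tree.\<close>
      case empty: True
      define G where "G = \<gamma> E"
      have H'E: "H' = {E}" using H'' empty by simp
      \<comment> \<open>Guarded because \<open>\<gamma>\<close> is arbitrary: a set outside
        \<open>GG\<close> may be infinite, and it is hit with probability 0.\<close>
      define I where "I = (if G \<in> GG then Pow G else {})"
      have finI: "finite I" using GG(3) by (auto simp: I_def)
      have "measure_pmf.prob \<nu> {f. \<forall>E\<in>H'. f ` E = \<gamma> E} \<le>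
          (\<Sum>A\<in>I. 2 / d A * measure_pmf.prob \<mu> {f. f ` K = A})"
        unfolding \<nu>_def
      proof (rule prob_bind_pmf_le[OF finI])
        fix f assume f: "f \<in> set_pmf \<mu>"
        have nonneg: "0 \<le> (\<Sum>A\<in>I. 2 / d A * indicator {f. f ` K = A} f)" by (intro sum_nonneg) auto
        show "measure_pmf.prob (step f) {f. \<forall>E\<in>H'. f ` E = \<gamma> E}
            \<le> (\<Sum>A\<in>I. 2 / d A * indicator {f. f ` K = A} f)"
        proof (cases "G \<in> N f")
          case True
          then have I: "f ` K \<in> I" by (auto simp: N_def I_def)
          have "measure_pmf.prob (step f) {f. \<forall>E\<in>H'. f ` E = \<gamma> E} \<le> 1 / card (N f)"
            using stepE[of f] pE[OF f, of G] True by (simp add: G_def)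
          also have "\<dots> \<le> 2 / d (f ` K)"
            using dN[OF f] dpos[OF f] Npos(2)[OF f] by (simp add: field_simps)
          also have "\<dots> = 2 / d (f ` K) * indicator {f'. f' ` K = f ` K} f" by simp
          also have "\<dots> \<le> (\<Sum>A\<in>I. 2 / d A * indicator {f. f ` K = A} f)"
            using I finI by (intro member_le_sum[where f = "\<lambda>A. 2 / d A * indicator {f. f ` K = A} f"]) auto
          finally show ?thesis .
        next
          case False
          then show ?thesis using stepE[of f] pE[OF f, of G] nonneg by (simp add: G_def)
        qed
      qed
      also have "\<dots> \<le> (\<Sum>A\<in>I. 2 * \<alpha>)"
      proof (rule sum_mono)
        fix A assume "A \<in> I"
        have "measure_pmf.prob \<mu> {f. f ` K = A} \<le> (\<Sum>h | h \<in> GG \<and> A \<subseteq> h. measure_pmf.prob \<mu> {f. f ` F = h})"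
        proof (rule prob_pmf_le_sum)
          fix f assume "f \<in> set_pmf \<mu>" "f \<in> {f. f ` K = A}"
          then show "\<exists>h\<in>{h \<in> GG. A \<subseteq> h}. f \<in> {f. f ` F = h}" using im extend.hyps(3) K(3) by auto
        qed (use GG in simp)
        also have "\<dots> \<le> (\<Sum>h | h \<in> GG \<and> A \<subseteq> h. \<alpha>)"
          using spH[of "{F}" "\<lambda>_. h" for h] extend.hyps(3) by (intro sum_mono) simp
        also have "\<dots> = d A * \<alpha>" by (simp add: d_def)
        finally have "2 / d A * measure_pmf.prob \<mu> {f. f ` K = A} \<le> 2 / d A * (d A * \<alpha>)"
          by (intro mult_left_mono) auto
        also have "\<dots> \<le> 2 * \<alpha>" using \<alpha>_nonneg by (cases "d A = 0") auto
        finally show "2 / d A * measure_pmf.prob \<mu> {f. f ` K = A} \<le> 2 * \<alpha>" .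
      qed
      also have "\<dots> = card I * (2 * \<alpha>)" by simp
      also have "\<dots> \<le> 2 ^ r * (2 * \<alpha>)"
        using GG(3)[of G] \<alpha>_nonneg by (intro mult_right_mono) (auto simp: I_def card_Pow)
      also have "\<dots> \<le> \<alpha>'" using \<alpha>_le(2) by simp
      finally show ?thesis by (simp add: H'E)
    qed
  qed
  have "spread_copies (insert E H) GG \<alpha>' \<beta> \<nu>"
    unfolding spread_copies_def
  proof (intro conjI ballI allI impI)
    fix f' assume "f' \<in> set_pmf \<nu>"
    then obtain f g where fg: "f \<in> set_pmf \<mu>" "g \<in> N f" "f' = ext f g"
      by (auto simp: \<nu>_def setstep)
    then show "inj_on f' (\<Union>(insert E H))" using ext by blast
    fix E' assume "E' \<in> insert E H"
    then show "f' ` E' \<in> GG"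
      using ext[OF fg(1,2)] extim[OF fg(1,2), of E'] im[OF fg(1), of E'] fg(2,3) by (auto simp: N_def)
  qed (use bound in auto)
  moreover have "f' v \<in> M \<longleftrightarrow> v \<in> MH" if "f' \<in> set_pmf \<nu>" "v \<in> \<Union>(insert E H)" for f' v
  proof -
    from that obtain f g where fg: "f \<in> set_pmf \<mu>" "g \<in> N f" "f' = ext f g"
      by (auto simp: \<nu>_def setstep)
    then show ?thesis using ext[OF fg(1,2)] that(2) by auto
  qed
  ultimately show ?case unfolding \<alpha>'_def by blast
qed

section \<open>Cleaning a family to a prescribed minimum degree\<close>

abbreviation codeg :: "'b set set \<Rightarrow> 'b set \<Rightarrow> nat" where
  "codeg G A \<equiv> card {g\<in>G. A \<subseteq> g}"

lemma spread_copies_mono: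
  assumes "spread_copies H G \<alpha> \<beta> \<mu>" "G \<subseteq> G'" "\<alpha> \<le> \<alpha>'" "\<beta> \<le> \<beta>'" "0 \<le> \<alpha>" "0 \<le> \<beta>"
  shows "spread_copies H G' \<alpha>' \<beta>' \<mu>"
  unfolding spread_copies_def
proof (intro conjI allI impI ballI)
  fix H' \<gamma> assume "H' \<subseteq> H \<and> H' \<noteq> {}"
  then have "measure_pmf.prob \<mu> {f. \<forall>E\<in>H'. f ` E = \<gamma> E} \<le> \<alpha> * \<beta> ^ (card H' - 1)"
    using assms(1) by (auto simp: spread_copies_def)
  also have "\<dots> \<le> \<alpha>' * \<beta>' ^ (card H' - 1)"
    using assms by (intro mult_mono power_mono) auto
  finally show "measure_pmf.prob \<mu> {f. \<forall>E\<in>H'. f ` E = \<gamma> E} \<le> \<alpha>' * \<beta>' ^ (card H' - 1)" .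
qed (use assms(1,2) in \<open>auto simp: spread_copies_def\<close>)

text \<open>A subfamily maximising its size minus the total threshold of the test sets it still covers
  cannot be improved by deleting all members through a test set of low degree.\<close>
lemma clean_family:
  fixes thr :: "'b set \<Rightarrow> real"
  assumes "finite G" "finite AA" "\<And>A. 0 \<le> thr A"
  shows "\<exists>G'\<subseteq>G. real (card G) - sum thr AA \<le> real (card G') \<and>
    (\<forall>e\<in>G'. \<forall>A\<in>AA. A \<subseteq> e \<longrightarrow> thr A \<le> real (codeg G' A))"
proof -
  define cov where "cov S = {A\<in>AA. \<exists>e\<in>S. A \<subseteq> e}" for S
  define \<phi> where "\<phi> S = real (card S) - sum thr (cov S)" for S
  have fin: "finite (\<phi> ` Pow G)" "\<phi> ` Pow G \<noteq> {}" using assms by auto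
  have "Max (\<phi> ` Pow G) \<in> \<phi> ` Pow G" using fin by (rule Max_in)
  then obtain S where S: "S \<subseteq> G" "\<phi> S = Max (\<phi> ` Pow G)" by auto
  have max: "\<phi> S' \<le> \<phi> S" if "S' \<subseteq> G" for S' using S(2) fin that by auto
  have fS: "finite S" using S assms finite_subset by blast
  have fc: "finite (cov T)" for T using assms by (simp add: cov_def)
  have "real (card G) - sum thr AA \<le> \<phi> G"
    using assms by (auto simp: \<phi>_def cov_def intro!: sum_mono2)
  also have "\<dots> \<le> \<phi> S" using max by simp
  also have "\<dots> \<le> card S" using assms by (simp add: \<phi>_def sum_nonneg)
  finally have *: "real (card G) - sum thr AA \<le> real (card S)" .
  have "thr A \<le> real (codeg S A)" if "e \<in> S" "A \<in> AA" "A \<subseteq> e" for e A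
  proof (rule ccontr)
    assume low: "\<not> thr A \<le> real (codeg S A)"
    define S' where "S' = {g\<in>S. \<not> A \<subseteq> g}"
    have "card S = card S' + codeg S A"
      using fS by (subst card_Un_disjoint[symmetric]) (auto simp: S'_def intro!: arg_cong[of _ _ card])
    moreover have "sum thr (cov S') + thr A \<le> sum thr (cov S)"
    proof -
      have "A \<notin> cov S'" "insert A (cov S') \<subseteq> cov S" using that by (auto simp: cov_def S'_def)
      then show ?thesis
        using sum_mono2[of "cov S" "insert A (cov S')" thr] fc assms(3) by (simp add: add.commute)
    qed
    ultimately have "\<phi> S < \<phi> S'" using low by (simp add: \<phi>_def)
    moreover have "S' \<subseteq> G" using S by (auto simp: S'_def)
    ultimately show False using max[of S'] by simp
  qed
  then show ?thesis using S(1) * by blast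
qed

lemma binomial_le_power: "real (n choose r) \<le> real n ^ r"
proof (cases "r \<le> n")
  case True
  then have "n choose r \<le> n ^ r" by (rule binomial_le_pow)
  then show ?thesis by (metis of_nat_le_iff of_nat_power)
qed (simp add: binomial_eq_0)

text \<open>There are at most \<open>n ^ a\<close> sets of size \<open>a\<close>, so with thresholds
  proportional to \<open>n ^ (d - a)\<close> every size from 0 to \<open>l\<close> costs at most
  \<open>c * n ^ d\<close>.\<close>

lemma sum_thresholds_le:
  assumes "l \<le> d" "0 \<le> c"
  shows "(\<Sum>A | A \<subseteq> {1..n} \<and> A \<subseteq> M \<and> card A \<le> l. c * real n ^ (d - card A)) \<le> (real l + 1) * c * real n ^ d"
proof -
  define S where "S = {A. A \<subseteq> {1..n} \<and> card A \<le> l}"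
  have fS: "finite S" by (simp add: S_def)
  have "(\<Sum>A | A \<subseteq> {1..n} \<and> A \<subseteq> M \<and> card A \<le> l. c * real n ^ (d - card A)) \<le>
      (\<Sum>A\<in>S. c * real n ^ (d - card A))"
    using assms fS by (intro sum_mono2) (auto simp: S_def)
  also have "\<dots> = (\<Sum>a\<le>l. \<Sum>A | A \<in> S \<and> card A = a. c * real n ^ (d - card A))"
    using fS by (subst sum.group[where g = card]) (auto simp: S_def)
  also have "\<dots> \<le> (\<Sum>a\<le>l. c * real n ^ d)"
  proof (rule sum_mono)
    fix a assume a: "a \<in> {..l}"
    have "{A. A \<in> S \<and> card A = a} = {A. A \<subseteq> {1..n} \<and> card A = a}" using a by (auto simp: S_def)
    then have "(\<Sum>A | A \<in> S \<and> card A = a. c * real n ^ (d - card A)) = real (n choose a) * (c * real n ^ (d - a))"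
      using n_subsets[of "{1..n}" a] by (simp cong: conj_cong)
    also have "\<dots> \<le> real n ^ a * (c * real n ^ (d - a))"
      using assms binomial_le_power by (intro mult_right_mono) auto
    also have "\<dots> = c * real n ^ d" using a assms by (simp add: power_add[symmetric])
    finally show "(\<Sum>A | A \<in> S \<and> card A = a. c * real n ^ (d - card A)) \<le> c * real n ^ d" .
  qed
  also have "\<dots> = (real l + 1) * c * real n ^ d" by simp
  finally show ?thesis .
qed

lemma card_supersets_le:
  assumes "\<And>g. g \<in> G \<Longrightarrow> g \<subseteq> {1..n} \<and> card g = r" "finite B"
  shows "real (codeg G B) \<le> real n ^ (r - card B)"
proof -
  have "inj_on (\<lambda>g. g - B) {g\<in>G. B \<subseteq> g}" by (auto simp: inj_on_def)
  then have "codeg G B = card ((\<lambda>g. g - B) ` {g\<in>G. B \<subseteq> g})" by (simp add: card_image)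
  also have "\<dots> \<le> card {s. s \<subseteq> {1..n} \<and> card s = r - card B}"
    using assms by (intro card_mono) (auto simp: card_Diff_subset)
  also have "\<dots> = n choose (r - card B)" using n_subsets[of "{1..n}"] by simp
  finally show ?thesis using binomial_le_power[of n "r - card B"] by linarith
qed

text \<open>Cleaning lifts every surviving small set inside \<open>M\<close> to its threshold, while
  degrees of extended sets can only fall; hence \<open>spr\<close>, assumed for the original
  \<open>G\<close>, yields the ratio that the embedding needs. The 2 in the size hypothesis leaves
  half of the required size after all thresholds are paid. The exponent \<open>d\<close> is the
  order of the size of \<open>G\<close>: equal to \<open>r\<close> for dense families and to
  \<open>r - 1\<close> for light ones.\<close>

lemma clean_spread:
  fixes H :: "'a set set" and c :: real
  assumes H: "hypertree H" "\<And>E. E \<in> H \<Longrightarrow> finite E \<and> card E = r \<and> card (E \<inter> MH) = m"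
      "\<And>E F. E \<in> H \<Longrightarrow> F \<in> H \<Longrightarrow> E \<noteq> F \<Longrightarrow> E \<inter> F \<subseteq> MH \<and> card (E \<inter> F) \<le> l"
      "card (\<Union>H) \<le> q"
    and G: "\<And>e. e \<in> G \<Longrightarrow> e \<subseteq> {1..n} \<and> card e = r \<and> card (e \<inter> M) = m"
    and c: "0 < c" "1 \<le> n" "l \<le> d" "2 * (real l + 1) * c * real n ^ d \<le> card G"
    and spr: "\<And>e A y. e \<in> G \<Longrightarrow> A \<subseteq> e \<inter> M \<Longrightarrow> card A \<le> l \<Longrightarrow> y \<in> e \<Longrightarrow> y \<notin> A \<Longrightarrow>
        2 * real q * real (codeg G (insert y A)) \<le> c * real n ^ (d - card A)"
  shows "\<exists>\<mu>. spread_copies H G ((2 ^ (r + 1)) ^ card H / ((real l + 1) * c * real n ^ d)) (2 / (c * real n ^ (d - l))) \<mu>"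
proof -
  have finG: "finite G" using G by (intro finite_subset[of G "Pow {1..n}"]) auto
  define AA where "AA = {A. A \<subseteq> {1..n} \<and> A \<subseteq> M \<and> card A \<le> l}"
  have "finite AA" by (simp add: AA_def)
  from clean_family[OF finG this, of "\<lambda>A. c * real n ^ (d - card A)"] c
  obtain G' where G': "G' \<subseteq> G" "real (card G) - (\<Sum>A\<in>AA. c * real n ^ (d - card A)) \<le> real (card G')"
    and deg: "\<And>e A. e \<in> G' \<Longrightarrow> A \<in> AA \<Longrightarrow> A \<subseteq> e \<Longrightarrow> c * real n ^ (d - card A) \<le> real (codeg G' A)" by auto
  have finG': "finite G'" using G' finG finite_subset by blast
  have G'_card: "(real l + 1) * c * real n ^ d \<le> card G'"
    using G'(2) sum_thresholds_le[OF c(3) less_imp_le[OF c(1)], of n M] c(4) unfolding AA_def by linarith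
  have pos: "0 < (real l + 1) * c * real n ^ d" using c by simp
  then have ne: "G' \<noteq> {}" using G'_card by auto
  have inAA: "A \<in> AA" if "e \<in> G'" "A \<subseteq> e \<inter> M" "card A \<le> l" for e A
    using that G[of e] G'(1) unfolding AA_def by blast
  have "\<exists>\<mu>. spread_copies H G' ((2 ^ (r + 1)) ^ card H / card G') (2 / (c * real n ^ (d - l))) \<mu> \<and>
    (\<forall>f\<in>set_pmf \<mu>. \<forall>v\<in>\<Union>H. f v \<in> M \<longleftrightarrow> v \<in> MH)"
  proof (rule spread_embedding[OF H(1) finG' ne _ H(2) H(3) H(4)])
    show "finite e \<and> card e = r \<and> card (e \<inter> M) = m" if "e \<in> G'" for e
      using G G' that finite_subset[of e "{1..n}"] by auto
    fix e A assume eA: "e \<in> G'" "A \<subseteq> e \<inter> M" "card A \<le> l"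
    have A: "c * real n ^ (d - card A) \<le> real (codeg G' A)"
      using deg[OF eA(1) inAA[OF eA]] eA by auto
    have "c * real n ^ (d - l) \<le> c * real n ^ (d - card A)"
      using eA c by (intro mult_left_mono power_increasing) auto
    then have "c * real n ^ (d - l) \<le> real (codeg G' A)" using A by linarith
    then show "2 \<le> 2 / (c * real n ^ (d - l)) * real (codeg G' A)"
      using c by (simp add: field_simps)
    fix y assume y: "y \<notin> A"
    \<comment> \<open>Here \<open>y\<close> is arbitrary, whereas \<open>spr\<close> wants it in an
      edge of \<open>G\<close>; if no member of \<open>G'\<close> contains
      \<open>insert y A\<close>, the left side is 0.\<close>
    show "2 * q * codeg G' (insert y A) \<le> codeg G' A"
    proof (cases "{g\<in>G'. insert y A \<subseteq> g} = {}")
      case True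
      then have "codeg G' (insert y A) = 0" by (metis card.empty)
      then show ?thesis by simp
    next
      case False
      then obtain g where g: "g \<in> G'" "insert y A \<subseteq> g" by auto
      have "real (codeg G' (insert y A)) \<le> real (codeg G (insert y A))"
        using finG G'(1) by (intro of_nat_mono card_mono) auto
      then have "2 * real q * real (codeg G' (insert y A)) \<le> 2 * real q * real (codeg G (insert y A))"
        by (intro mult_left_mono) auto
      also have "\<dots> \<le> c * real n ^ (d - card A)"
        using g eA y G' by (intro spr[of g]) auto
      also note A
      finally have "real (2 * q * codeg G' (insert y A)) \<le> real (codeg G' A)" by simp
      then show ?thesis by (simp only: of_nat_le_iff)
    qed
  qed
  then obtain \<mu> where "spread_copies H G' ((2 ^ (r + 1)) ^ card H / card G') (2 / (c * real n ^ (d - l))) \<mu>" by blast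
  then have "spread_copies H G ((2 ^ (r + 1)) ^ card H / ((real l + 1) * c * real n ^ d)) (2 / (c * real n ^ (d - l))) \<mu>"
    using G'(1) G'_card pos c ne finG' by (elim spread_copies_mono) (auto intro!: divide_left_mono mult_pos_pos simp: card_gt_0_iff)
  then show ?thesis by blast
qed

text \<open>At positive density the trivial bound on the degree of an extended set is already
  smaller by a factor of order \<open>n\<close> than the threshold of \<open>A\<close>, so
  \<open>M\<close> can be everything. It serves for the links of high-degree vertices.\<close>

lemma dense_spread:
  fixes H :: "'a set set" and \<epsilon> :: real
  assumes H: "hypertree H" "uniform r H" "overlapping l H" and "l < r" "0 < \<epsilon>"
  shows "\<exists>C n0. 0 < C \<and> (\<forall>n\<ge>n0. \<forall>G\<subseteq>k_subsets r n. \<epsilon> * real n ^ r \<le> card G \<longrightarrow>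
    (\<exists>\<mu>. spread_copies H G (C / real n ^ r) (C / real n ^ (r - l)) \<mu>))"
proof -
  define c where "c = \<epsilon> / (2 * (real l + 1))"
  define q where "q = card (\<Union>H)"
  have c: "0 < c" using assms by (simp add: c_def)
  have "real l + 1 > 0" by simp
  then have c\<epsilon>: "2 * (real l + 1) * c = \<epsilon>" by (simp add: c_def)
  define C where "C = max ((2 ^ (r + 1)) ^ card H / ((real l + 1) * c)) (2 / c)"
  have C0: "0 < C" using c by (simp add: C_def less_max_iff_disj)
  show ?thesis
  proof (intro exI[of _ C] exI[of _ "nat \<lceil>2 * real q / c\<rceil> + 1"] conjI C0 allI impI)
    fix n G assume n: "nat \<lceil>2 * real q / c\<rceil> + 1 \<le> n" and G: "G \<subseteq> k_subsets r n" and
      dense: "\<epsilon> * real n ^ r \<le> card G"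
    have n1: "1 \<le> n" using n by simp
    have "2 * real q / c \<le> real n" using n by linarith
    then have nq: "2 * real q \<le> c * real n" using c by (simp add: field_simps)
    have "\<exists>\<mu>. spread_copies H G ((2 ^ (r + 1)) ^ card H / ((real l + 1) * c * real n ^ r)) (2 / (c * real n ^ (r - l))) \<mu>"
    proof (rule clean_spread[where MH = UNIV and M = UNIV and m = r and q = q])
      show "2 * (real l + 1) * c * real n ^ r \<le> card G" unfolding c\<epsilon> by (rule dense)
      fix e A y assume eA: "e \<in> G" "A \<subseteq> e \<inter> UNIV" "card A \<le> l" "y \<in> e" "y \<notin> A"
      have "e \<subseteq> {1..n}" using eA G by (auto simp: k_subsets_def)
      then have fin: "finite A" using eA finite_subset[of A "{1..n}"] by auto
      have "real (codeg G (insert y A)) \<le> real n ^ (r - card (insert y A))"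
        using G fin by (intro card_supersets_le) (auto simp: k_subsets_def)
      also have "\<dots> = real n ^ (r - Suc (card A))" using fin eA by simp
      finally have "(2 * real q) * real (codeg G (insert y A)) \<le> (c * real n) * real n ^ (r - Suc (card A))"
        using c by (intro mult_mono[OF nq]) auto
      also have "(c * real n) * real n ^ (r - Suc (card A)) = c * real n ^ (r - card A)"
      proof -
        have "r - card A = Suc (r - Suc (card A))" using eA assms by simp
        then show ?thesis by simp
      qed
      finally show "2 * real q * real (codeg G (insert y A)) \<le> c * real n ^ (r - card A)" .
    qed (use H G c n1 assms in \<open>auto simp: uniform_def overlapping_def k_subsets_def q_def\<close>)
    then obtain \<mu> where "spread_copies H G ((2 ^ (r + 1)) ^ card H / ((real l + 1) * c * real n ^ r)) (2 / (c * real n ^ (r - l))) \<mu>" ..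
    moreover have "(2 ^ (r + 1)) ^ card H / ((real l + 1) * c * real n ^ r) \<le> C / real n ^ r"
      unfolding divide_divide_eq_left[symmetric] by (intro divide_right_mono) (auto simp: C_def)
    moreover have "2 / (c * real n ^ (r - l)) \<le> C / real n ^ (r - l)"
      unfolding divide_divide_eq_left[symmetric] by (intro divide_right_mono) (auto simp: C_def)
    ultimately have "spread_copies H G (C / real n ^ r) (C / real n ^ (r - l)) \<mu>"
      using c n1 by (elim spread_copies_mono) auto
    then show "\<exists>\<mu>. spread_copies H G (C / real n ^ r) (C / real n ^ (r - l)) \<mu>" ..
  qed
qed

section \<open>Balanced supersaturation\<close>

lemma sum_codeg_le:
  assumes G: "finite G" "\<And>g. g \<in> G \<Longrightarrow> finite g \<and> card g = k"
    and S: "finite S" "\<And>A. A \<in> S \<Longrightarrow> A0 \<subseteq> A"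
  shows "(\<Sum>A\<in>S. codeg G A) \<le> 2 ^ k * codeg G A0"
proof -
  have "(\<Sum>A\<in>S. codeg G A) = (\<Sum>A\<in>S. \<Sum>g | g \<in> G \<and> A \<subseteq> g. 1)" by simp
  also have "\<dots> = (\<Sum>g\<in>G. \<Sum>A | A \<in> S \<and> A \<subseteq> g. 1)"
    using G S by (intro sum.swap_restrict) auto
  also have "\<dots> = (\<Sum>g\<in>G. card {A. A \<in> S \<and> A \<subseteq> g})" by simp
  also have "\<dots> = (\<Sum>g | g \<in> G \<and> A0 \<subseteq> g. card {A. A \<in> S \<and> A \<subseteq> g})"
  proof (intro sum.mono_neutral_right)
    show "\<forall>g\<in>G - {g. g \<in> G \<and> A0 \<subseteq> g}. card {A. A \<in> S \<and> A \<subseteq> g} = 0"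
    proof
      fix g assume "g \<in> G - {g. g \<in> G \<and> A0 \<subseteq> g}"
      then have "{A. A \<in> S \<and> A \<subseteq> g} = {}" using S(2) by blast
      then show "card {A. A \<in> S \<and> A \<subseteq> g} = 0" by (metis card.empty)
    qed
  qed (use G in auto)
  also have "\<dots> \<le> (\<Sum>g | g \<in> G \<and> A0 \<subseteq> g. 2 ^ k)"
  proof (rule sum_mono)
    fix g assume "g \<in> {g. g \<in> G \<and> A0 \<subseteq> g}"
    then have g: "finite g" "card g = k" using G by auto
    have "card {A. A \<in> S \<and> A \<subseteq> g} \<le> card (Pow g)" using g by (intro card_mono) auto
    then show "card {A. A \<in> S \<and> A \<subseteq> g} \<le> 2 ^ k" using g by (simp add: card_Pow)
  qed
  finally show ?thesis by (simp add: mult.commute)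
qed

text \<open>An edge counts for at most \<open>2 ^ k\<close> members of \<open>S\<close>, and only
  edges through \<open>A0\<close> count. So a set of small degree has few supersets of large degree;
  with \<open>A0\<close> empty, few sets have large degree at all.\<close>

lemma card_mult_threshold_le:
  assumes G: "finite G" "\<And>g. g \<in> G \<Longrightarrow> finite g \<and> card g = k"
    and S: "finite S" "\<And>A. A \<in> S \<Longrightarrow> A0 \<subseteq> A" "\<And>A. A \<in> S \<Longrightarrow> t \<le> real (codeg G A)"
  shows "real (card S) * t \<le> 2 ^ k * real (codeg G A0)"
proof -
  have "real (card S) * t = (\<Sum>A\<in>S. t)" by simp
  also have "\<dots> \<le> (\<Sum>A\<in>S. real (codeg G A))" using S(3) by (intro sum_mono) auto
  also have "\<dots> = real (\<Sum>A\<in>S. codeg G A)" by simp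
  also have "\<dots> \<le> real (2 ^ k * codeg G A0)"
    using sum_codeg_le[OF G S(1,2)] by (simp only: of_nat_le_iff)
  finally show ?thesis by simp
qed

text \<open>\<open>D\<close> is the degree of the intersection, \<open>sO\<close> and
  \<open>sB\<close> the numbers of its dense supersets of the two kinds, and \<open>N\<close>,
  \<open>nq\<close>, \<open>nb\<close>, \<open>na\<close> are powers of n. The product of the two
  counts is quadratic in \<open>D\<close>; sparseness of the intersection trades one
  \<open>D\<close> for \<open>\<eta>\<close>, and the resulting linear bound can be summed over all
  intersections.\<close>

lemma codeg_product_bound:
  fixes sO sB t \<rho> N nq nb na D W \<eta> :: real
  assumes "sO * (t * (N / nq)) \<le> W * D" "sB * (\<rho> * (N / nb)) \<le> W * D" "D * na \<le> \<eta> * \<rho> * t * N"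
    and pos: "0 < t" "0 < \<rho>" "0 < N" "0 < nq" "0 < nb" "0 < na" "0 \<le> D" "0 \<le> W" "0 \<le> sO" "0 \<le> sB"
  shows "sO * sB * (N * na / (nq * nb)) \<le> W * W * \<eta> * D"
proof -
  have "(sO * (t * (N / nq))) * (sB * (\<rho> * (N / nb))) \<le> (W * D) * (W * D)"
    using pos by (intro mult_mono[OF assms(1,2)]) auto
  then have "(sO * sB * (N / (nq * nb))) * (t * \<rho> * N) \<le> (W * D) * (W * D)"
    by (simp add: algebra_simps)
  then have "(sO * sB * (N / (nq * nb))) \<le> (W * D) * (W * D) / (t * \<rho> * N)"
    using pos by (simp add: pos_le_divide_eq)
  then have "(sO * sB * (N / (nq * nb))) * na \<le> (W * D) * (W * D) / (t * \<rho> * N) * na"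
    using pos by (intro mult_right_mono) auto
  also have "\<dots> = W * W * D * (D * na) / (t * \<rho> * N)" by (simp add: algebra_simps)
  also have "\<dots> \<le> W * W * D * (\<eta> * \<rho> * t * N) / (t * \<rho> * N)"
    using assms by (intro divide_right_mono mult_left_mono) auto
  also have "\<dots> = W * W * \<eta> * D" using pos by (simp add: field_simps)
  finally show ?thesis by (simp add: algebra_simps)
qed

text \<open>For a fixed intersection \<open>A\<close>, the pairs of dense supersets and the edges
  through their union number at most \<open>4 ^ k * \<eta>\<close> times the degree of
  \<open>A\<close>. Summing the degrees over all \<open>A\<close> costs another
  \<open>2 ^ k\<close>.\<close>

lemma card_exceptional_triple_le:
  fixes \<rho> \<eta> t :: real and k n a b q :: nat
  assumes G: "G \<subseteq> k_subsets k n" and n: "1 \<le> n"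
    and abq: "b \<le> k" "q \<le> k" "a \<le> k" and pos: "0 < t" "0 < \<rho>" "0 < \<eta>"
  shows "real (card {e\<in>G. \<exists>O1 B. O1 \<subseteq> e \<and> B \<subseteq> e \<and> card O1 = q \<and> card B = b \<and> card (O1 \<inter> B) = a \<and>
      t * real n ^ (k - q) \<le> real (codeg G O1) \<and> \<rho> * real n ^ (k - b) \<le> real (codeg G B) \<and>
      real (codeg G (O1 \<inter> B)) \<le> \<eta> * \<rho> * t * real n ^ (k - a)}) \<le> 8 ^ k * \<eta> * card G"
    (is "real (card ?E) \<le> _")
proof -
  have finG: "finite G" using G finite_subset[of G "Pow {1..n}"] by (auto simp: k_subsets_def)
  have Gk: "finite g \<and> card g = k" if "g \<in> G" for g
    using G that finite_subset[of g "{1..n}"] by (auto simp: k_subsets_def)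
  define SA where "SA = {A. A \<subseteq> {1..n} \<and> card A = a \<and> real (codeg G A) \<le> \<eta> * \<rho> * t * real n ^ (k - a)}"
  define SO where "SO A = {P. P \<subseteq> {1..n} \<and> A \<subseteq> P \<and> card P = q \<and> t * real n ^ (k - q) \<le> real (codeg G P)}" for A
  define SB where "SB A = {B. B \<subseteq> {1..n} \<and> A \<subseteq> B \<and> card B = b \<and> \<rho> * real n ^ (k - b) \<le> real (codeg G B)}" for A
  have fin: "finite SA" "finite (SO A)" "finite (SB A)" for A by (auto simp: SA_def SO_def SB_def)
  \<comment> \<open>This stands for \<open>n ^ (k - (q + b - a))\<close>, the trivial bound on the
    number of edges through \<open>P \<union> B\<close>, as a quotient that avoids truncated
    subtraction.\<close>
  define X where "X = real n ^ k * real n ^ a / (real n ^ q * real n ^ b)"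
  have npos: "0 < real n ^ j" for j using n by simp
  have nsub: "real n ^ (k - j) = real n ^ k / real n ^ j" if "j \<le> k" for j
    using that n by (simp add: power_diff)
  define T where "T A P B = {e\<in>G. P \<union> B \<subseteq> e \<and> P \<inter> B = A}" for A P B :: "nat set"
  have T_le: "real (card (T A P B)) \<le> X" if "A \<in> SA" "P \<in> SO A" "B \<in> SB A" for A P B
  proof (cases "T A P B = {}")
    case True
    then show ?thesis using npos by (simp add: X_def)
  next
    case False
    then obtain e where e: "e \<in> G" "P \<union> B \<subseteq> e" "P \<inter> B = A" by (auto simp: T_def)
    have fPB: "finite P" "finite B" using that finite_subset[of _ "{1..n}"] by (auto simp: SO_def SB_def)
    have "card (P \<union> B) + a = q + b"
      using card_Un_Int[OF fPB] that e by (simp add: SA_def SO_def SB_def)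
    moreover have le: "card (P \<union> B) \<le> k" using e Gk[OF e(1)] card_mono by metis
    moreover have "X = real n ^ k * real n ^ a / real n ^ (q + b)" by (simp add: X_def power_add)
    ultimately have "X = real n ^ k * real n ^ a / (real n ^ card (P \<union> B) * real n ^ a)"
      by (metis power_add)
    then have "real n ^ (k - card (P \<union> B)) = X"
      unfolding nsub[OF le] using n by simp
    moreover have "real (codeg G (P \<union> B)) \<le> real n ^ (k - card (P \<union> B))"
      using G fPB by (intro card_supersets_le) (auto simp: k_subsets_def)
    moreover have "card (T A P B) \<le> codeg G (P \<union> B)"
      using finG by (intro card_mono) (auto simp: T_def)
    ultimately show ?thesis by linarith
  qed
  have sub: "?E \<subseteq> (\<Union>A\<in>SA. \<Union>P\<in>SO A. \<Union>B\<in>SB A. T A P B)"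
  proof
    fix e assume "e \<in> ?E"
    then obtain P B where e: "e \<in> G" "P \<subseteq> e" "B \<subseteq> e" "card P = q" "card B = b" "card (P \<inter> B) = a"
      "t * real n ^ (k - q) \<le> real (codeg G P)" "\<rho> * real n ^ (k - b) \<le> real (codeg G B)"
      "real (codeg G (P \<inter> B)) \<le> \<eta> * \<rho> * t * real n ^ (k - a)" by blast
    have "e \<subseteq> {1..n}" using e(1) G by (auto simp: k_subsets_def)
    then have "P \<inter> B \<in> SA" "P \<in> SO (P \<inter> B)" "B \<in> SB (P \<inter> B)" "e \<in> T (P \<inter> B) P B"
      using e by (auto simp: SA_def SO_def SB_def T_def)
    then show "e \<in> (\<Union>A\<in>SA. \<Union>P\<in>SO A. \<Union>B\<in>SB A. T A P B)" by blast
  qed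
  have finT: "finite (T A P B)" for A P B using finG by (simp add: T_def)
  have "card ?E \<le> card (\<Union>A\<in>SA. \<Union>P\<in>SO A. \<Union>B\<in>SB A. T A P B)"
    using sub fin finT by (intro card_mono) auto
  also have "\<dots> \<le> (\<Sum>A\<in>SA. \<Sum>P\<in>SO A. \<Sum>B\<in>SB A. card (T A P B))"
    by (intro order_trans[OF card_UN_le] sum_mono fin order.refl)
  finally have "real (card ?E) \<le> real (\<Sum>A\<in>SA. \<Sum>P\<in>SO A. \<Sum>B\<in>SB A. card (T A P B))"
    by (simp only: of_nat_le_iff)
  also have "\<dots> = (\<Sum>A\<in>SA. \<Sum>P\<in>SO A. \<Sum>B\<in>SB A. real (card (T A P B)))" by simp
  also have "\<dots> \<le> (\<Sum>A\<in>SA. \<Sum>P\<in>SO A. \<Sum>B\<in>SB A. X)"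
    by (intro sum_mono T_le)
  also have "\<dots> = (\<Sum>A\<in>SA. real (card (SO A)) * real (card (SB A)) * X)" by (simp add: mult.assoc)
  also have "\<dots> \<le> (\<Sum>A\<in>SA. 2 ^ k * 2 ^ k * \<eta> * real (codeg G A))"
  proof (rule sum_mono)
    fix A assume A: "A \<in> SA"
    show "real (card (SO A)) * real (card (SB A)) * X \<le> 2 ^ k * 2 ^ k * \<eta> * real (codeg G A)"
      unfolding X_def
    proof (rule codeg_product_bound)
      show "real (card (SO A)) * (t * (real n ^ k / real n ^ q)) \<le> 2 ^ k * real (codeg G A)"
        using card_mult_threshold_le[OF finG Gk fin(2)[of A], where ?A0.0 = A and t = "t * real n ^ (k - q)"]
        by (auto simp: SO_def nsub abq)
      show "real (card (SB A)) * (\<rho> * (real n ^ k / real n ^ b)) \<le> 2 ^ k * real (codeg G A)"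
        using card_mult_threshold_le[OF finG Gk fin(3)[of A], where ?A0.0 = A and t = "\<rho> * real n ^ (k - b)"]
        by (auto simp: SB_def nsub abq)
      show "real (codeg G A) * real n ^ a \<le> \<eta> * \<rho> * t * real n ^ k"
        using A npos[of a] by (simp add: SA_def nsub abq pos_le_divide_eq)
    qed (use npos pos in auto)
  qed
  also have "\<dots> = 2 ^ k * 2 ^ k * \<eta> * real (\<Sum>A\<in>SA. codeg G A)"
    by (simp add: sum_distrib_left)
  also have "\<dots> \<le> 2 ^ k * 2 ^ k * \<eta> * real (2 ^ k * codeg G {})"
    using sum_codeg_le[OF finG Gk fin(1), where ?A0.0 = "{}"] pos
    by (intro mult_left_mono) (simp_all only: of_nat_le_iff, auto)
  also have "\<dots> = 8 ^ k * \<eta> * card G"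
    by (simp add: power_mult_distrib[symmetric] mult_ac)
  finally show ?thesis .
qed

text \<open>
  Call \<open>P\<close> dense if its degree exceeds \<open>(\<eta>\<rho>)\<^bsup>k-|P|\<^esup> n\<^bsup>k-|P|\<^esup>\<close>.  Since a sparse set has few dense
  supersets, few edges contain two dense sets with a sparse intersection.  Hence in a typical edge a
  dense set of minimal size is contained in every \<open>B\<close> of density at least \<open>\<rho>\<close>.
\<close>

lemma card_exceptional_le:
  fixes \<rho> \<eta> :: real and k n :: nat
  assumes G: "G \<subseteq> k_subsets k n" and n: "1 \<le> n"
    and pos: "0 < \<rho>" "\<rho> \<le> 1" "0 < \<eta>" "\<eta> \<le> 1"
  shows "real (card {e\<in>G. \<exists>O1 B. O1 \<subseteq> e \<and> B \<subseteq> e \<and> \<not> O1 \<subseteq> B \<and>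
      (\<eta> * \<rho>) ^ (k - card O1) * real n ^ (k - card O1) \<le> real (codeg G O1) \<and>
      \<rho> * real n ^ (k - card B) \<le> real (codeg G B) \<and>
      real (codeg G (O1 \<inter> B)) < (\<eta> * \<rho>) ^ (k - card (O1 \<inter> B)) * real n ^ (k - card (O1 \<inter> B))})
    \<le> (k + 1) ^ 3 * 8 ^ k * \<eta> * card G"
    (is "real (card ?E) \<le> _")
proof -
  have finG: "finite G" using G finite_subset[of G "Pow {1..n}"] by (auto simp: k_subsets_def)
  define E3 where "E3 = (\<lambda>(a, b, q). {e\<in>G. \<exists>O1 B. O1 \<subseteq> e \<and> B \<subseteq> e \<and> card O1 = q \<and> card B = b \<and> card (O1 \<inter> B) = a \<and>
      (\<eta> * \<rho>) ^ (k - q) * real n ^ (k - q) \<le> real (codeg G O1) \<and> \<rho> * real n ^ (k - b) \<le> real (codeg G B) \<and>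
      real (codeg G (O1 \<inter> B)) \<le> \<eta> * \<rho> * (\<eta> * \<rho>) ^ (k - q) * real n ^ (k - a)})"
  define S where "S = {..k} \<times> {..k} \<times> {..k}"
  have finS: "finite S" by (simp add: S_def)
  have cardS: "card S = (k + 1) ^ 3" by (simp add: S_def card_cartesian_product power3_eq_cube)
  have le1: "\<eta> * \<rho> \<le> 1" "0 \<le> \<eta> * \<rho>" using pos by (auto simp: mult_le_one)
  have sub: "?E \<subseteq> (\<Union>x\<in>S. E3 x)"
  proof
    fix e assume "e \<in> ?E"
    then obtain P B where e: "e \<in> G" "P \<subseteq> e" "B \<subseteq> e" "\<not> P \<subseteq> B"
      "(\<eta> * \<rho>) ^ (k - card P) * real n ^ (k - card P) \<le> real (codeg G P)"
      "\<rho> * real n ^ (k - card B) \<le> real (codeg G B)"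
      "real (codeg G (P \<inter> B)) < (\<eta> * \<rho>) ^ (k - card (P \<inter> B)) * real n ^ (k - card (P \<inter> B))" by blast
    have fe: "finite e" "card e = k"
      using e(1) G finite_subset[of e "{1..n}"] by (auto simp: k_subsets_def)
    have fP: "finite P" using e(2) fe finite_subset by blast
    have "P \<inter> B \<subset> P" using e(4) by auto
    then have lt: "card (P \<inter> B) < card P" using fP psubset_card_mono by blast
    have cP: "card P \<le> k" "card B \<le> k" using card_mono[OF fe(1)] e(2,3) fe(2) by auto
    \<comment> \<open>The reason for thresholds decreasing geometrically with the codimension:
      passing to the strictly smaller set \<open>P \<inter> B\<close> gains at least one factor
      \<open>\<eta> * \<rho>\<close>, the gap required for a sparse intersection.\<close>
    have "(\<eta> * \<rho>) ^ (k - card (P \<inter> B)) \<le> (\<eta> * \<rho>) ^ Suc (k - card P)"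
      using lt cP le1 by (intro power_decreasing) auto
    then have "(\<eta> * \<rho>) ^ (k - card (P \<inter> B)) * real n ^ (k - card (P \<inter> B)) \<le>
        (\<eta> * \<rho> * (\<eta> * \<rho>) ^ (k - card P)) * real n ^ (k - card (P \<inter> B))"
      by (intro mult_right_mono) auto
    then have "real (codeg G (P \<inter> B)) \<le> (\<eta> * \<rho> * (\<eta> * \<rho>) ^ (k - card P)) * real n ^ (k - card (P \<inter> B))"
      using e(7) by linarith
    then have "e \<in> E3 (card (P \<inter> B), card B, card P)"
      unfolding E3_def prod.case using e by blast
    moreover have "(card (P \<inter> B), card B, card P) \<in> S" using cP lt by (simp add: S_def)
    ultimately show "e \<in> (\<Union>x\<in>S. E3 x)" by blast
  qed
  have finE: "finite (E3 x)" for x using finG by (simp add: E3_def case_prod_unfold)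
  have "card ?E \<le> card (\<Union>x\<in>S. E3 x)" using sub finS finE by (intro card_mono) auto
  also have "\<dots> \<le> (\<Sum>x\<in>S. card (E3 x))" by (rule card_UN_le[OF finS])
  finally have "real (card ?E) \<le> real (\<Sum>x\<in>S. card (E3 x))" by (simp only: of_nat_le_iff)
  also have "\<dots> = (\<Sum>x\<in>S. real (card (E3 x)))" by (rule of_nat_sum)
  also have "\<dots> \<le> (\<Sum>x\<in>S. 8 ^ k * \<eta> * card G)"
  proof (rule sum_mono)
    fix x assume "x \<in> S"
    then obtain a b q where x: "x = (a, b, q)" "a \<le> k" "b \<le> k" "q \<le> k" by (auto simp: S_def)
    show "real (card (E3 x)) \<le> 8 ^ k * \<eta> * card G"
      unfolding E3_def x(1) prod.case
      by (rule card_exceptional_triple_le[OF G n x(3) x(4) x(2)]) (use pos in auto)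
  qed
  also have "\<dots> = (k + 1) ^ 3 * 8 ^ k * \<eta> * card G" by (simp add: cardS)
  finally show ?thesis .
qed

text \<open>A uniformly random \<open>M\<close> has the prescribed trace on an edge with probability
  \<open>2 ^ - k\<close>, so some \<open>M\<close> achieves the average. This turns pairs chosen
  separately for each edge into the single set \<open>M\<close> required by the embedding.\<close>

lemma ex_splitting_set:
  fixes BB :: "nat set set"
  assumes BB: "finite BB" "\<And>e. e \<in> BB \<Longrightarrow> e \<subseteq> {1..n} \<and> card e = k"
  shows "\<exists>M\<subseteq>{1..n}. card BB \<le> 2 ^ k * card {e\<in>BB. e \<inter> M = e - pr e}"
proof (cases "BB = {}")
  case False
  then obtain e0 where "e0 \<in> BB" by auto
  then have kn: "k \<le> n" using BB(2)[of e0] card_mono[of "{1..n}" e0] by auto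
  show ?thesis
  proof (rule ccontr)
    assume "\<not> ?thesis"
    then have lt: "2 ^ k * card {e\<in>BB. e \<inter> M = e - pr e} < card BB" if "M \<in> Pow {1..n}" for M
      using that by (auto simp: not_le)
    have "2 ^ k * (\<Sum>e\<in>BB. card {M\<in>Pow {1..n}. e \<inter> M = e - pr e}) =
        2 ^ k * (\<Sum>e\<in>BB. \<Sum>M | M \<in> Pow {1..n} \<and> e \<inter> M = e - pr e. 1)" by simp
    also have "\<dots> = 2 ^ k * (\<Sum>M\<in>Pow {1..n}. \<Sum>e | e \<in> BB \<and> e \<inter> M = e - pr e. 1)"
      using BB(1) by (subst sum.swap_restrict) auto
    also have "\<dots> = (\<Sum>M\<in>Pow {1..n}. 2 ^ k * card {e\<in>BB. e \<inter> M = e - pr e})"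
      by (simp add: sum_distrib_left)
    also have "\<dots> < (\<Sum>M\<in>Pow {1..n}. card BB)"
      by (rule sum_strict_mono) (use lt in auto)
    also have "\<dots> = 2 ^ n * card BB" by (simp add: card_Pow)
    finally have upper: "2 ^ k * (\<Sum>e\<in>BB. card {M\<in>Pow {1..n}. e \<inter> M = e - pr e}) < 2 ^ n * card BB" .
    have "2 ^ (n - k) \<le> card {M\<in>Pow {1..n}. e \<inter> M = e - pr e}" if e: "e \<in> BB" for e
    proof -
      have es: "e \<subseteq> {1..n}" "card e = k" using BB(2)[OF e] by auto
      have "card ({1..n} - e) = n - k" using es by (subst card_Diff_subset) (auto intro: finite_subset)
      then have "2 ^ (n - k) = card (Pow ({1..n} - e))" by (simp add: card_Pow)
      also have "\<dots> = card ((\<lambda>X. X \<union> (e - pr e)) ` Pow ({1..n} - e))"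
        by (rule card_image[symmetric]) (auto simp: inj_on_def)
      also have "\<dots> \<le> card {M\<in>Pow {1..n}. e \<inter> M = e - pr e}"
      proof (rule card_mono)
        show "(\<lambda>X. X \<union> (e - pr e)) ` Pow ({1..n} - e) \<subseteq> {M\<in>Pow {1..n}. e \<inter> M = e - pr e}"
          using es(1) by blast
      qed simp
      finally show ?thesis .
    qed
    then have "(\<Sum>e\<in>BB. 2 ^ (n - k)) \<le> (\<Sum>e\<in>BB. card {M\<in>Pow {1..n}. e \<inter> M = e - pr e})"
      by (rule sum_mono)
    then have "2 ^ k * (2 ^ (n - k) * card BB) \<le> 2 ^ k * (\<Sum>e\<in>BB. card {M\<in>Pow {1..n}. e \<inter> M = e - pr e})"
      by (simp add: mult.commute)
    moreover have "2 ^ k * (2 ^ (n - k) * card BB) = 2 ^ n * card BB"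
      using kn by (simp add: mult.assoc[symmetric] power_add[symmetric])
    ultimately show False using upper by linarith
  qed
qed auto

text \<open>A smallest dense subset \<open>P\<close> of the edge has at least two vertices, because
  by \<open>low\<close> neither the empty set nor a single vertex is dense. If some \<open>B\<close>
  of density at least \<open>\<rho>\<close> did not contain \<open>P\<close>, then
  \<open>P \<inter> B\<close> would be a smaller dense set; so any two vertices of \<open>P\<close>
  serve.\<close>

lemma ex_light_pair:
  fixes \<theta> :: "nat \<Rightarrow> real"
  assumes e: "e \<in> G" "finite e" "card e = k"
    and \<theta>: "\<theta> k \<le> 1" "finite G"
    and generic: "\<And>P B. P \<subseteq> e \<Longrightarrow> B \<subseteq> e \<Longrightarrow> \<not> P \<subseteq> B \<Longrightarrow>
      \<theta> (card P) * real n ^ (k - card P) \<le> real (codeg G P) \<Longrightarrow>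
      \<rho> * real n ^ (k - card B) \<le> real (codeg G B) \<Longrightarrow>
      \<theta> (card (P \<inter> B)) * real n ^ (k - card (P \<inter> B)) \<le> real (codeg G (P \<inter> B))"
    and low: "real (card G) < \<theta> 0 * real n ^ k" "\<And>v. real (codeg G {v}) < \<theta> 1 * real n ^ (k - 1)"
  shows "\<exists>u v. u \<in> e \<and> v \<in> e \<and> u \<noteq> v \<and>
    (\<forall>B\<subseteq>e. \<not> {u, v} \<subseteq> B \<longrightarrow> real (codeg G B) < \<rho> * real n ^ (k - card B))"
proof -
  define dense where "dense P \<longleftrightarrow> P \<subseteq> e \<and> \<theta> (card P) * real n ^ (k - card P) \<le> real (codeg G P)" for P
  have "1 \<le> codeg G e" using e \<theta>(2) by (simp add: Suc_le_eq card_gt_0_iff) blast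
  \<comment> \<open>A smallest dense set exists because the edge itself is dense: its degree is at
    least 1 and \<open>\<theta> k \<le> 1\<close>.\<close>
  then have "dense e" using e \<theta> by (simp add: dense_def)
  define q where "q = (LEAST q. \<exists>P. dense P \<and> card P = q)"
  have "\<exists>P. dense P \<and> card P = q"
    unfolding q_def by (rule LeastI_ex) (use \<open>dense e\<close> in blast)
  then obtain P where P: "dense P" "card P = q" by blast
  have least: "q \<le> card P'" if "dense P'" for P'
    unfolding q_def by (rule Least_le) (use that in blast)
  have finP: "finite P" using P(1) e finite_subset by (auto simp: dense_def)
  have "card P \<noteq> 0"
  proof
    assume "card P = 0"
    then have "P = {}" using finP by simp
    then show False using P(1) low(1) by (simp add: dense_def)
  qed
  moreover have "card P \<noteq> 1"
  proof
    assume "card P = 1"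
    then obtain v where "P = {v}" by (auto simp: card_1_singleton_iff)
    then show False using P(1) low(2)[of v] by (simp add: dense_def)
  qed
  ultimately have "2 \<le> card P" by linarith
  then obtain u v where uv: "u \<in> P" "v \<in> P" "u \<noteq> v"
    using finP by (metis card_2_iff' obtain_subset_with_card_n subsetD)
  have "real (codeg G B) < \<rho> * real n ^ (k - card B)" if B: "B \<subseteq> e" "\<not> {u, v} \<subseteq> B" for B
  proof (rule ccontr)
    assume "\<not> ?thesis"
    moreover have nP: "\<not> P \<subseteq> B" using uv B by auto
    ultimately have "dense (P \<inter> B)" using generic[of P B] P(1) B by (auto simp: dense_def)
    moreover have "card (P \<inter> B) < card P" using nP finP by (intro psubset_card_mono) auto
    ultimately show False using least P(2) by fastforce
  qed
  then show ?thesis using uv P(1) by (intro exI[of _ u] exI[of _ v]) (auto simp: dense_def)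
qed

text \<open>With order \<open>n ^ (k - 1)\<close> edges, the threshold of \<open>A\<close> has order
  \<open>n ^ (k - 1 - card A)\<close>, the same order as the trivial bound on the degree of
  \<open>insert y A\<close>. The missing constant factor comes from the light pair: \<open>A\<close>
  avoids both of its vertices, so \<open>insert y A\<close> misses at least one and has density
  below \<open>\<rho>\<close>.\<close>

lemma light_spread:
  fixes H :: "'a set set" and \<epsilon> C0 :: real
  assumes H: "hypertree H" "\<And>E. E \<in> H \<Longrightarrow> finite E \<and> card E = k \<and> card (E \<inter> MH) = k - 2"
      "\<And>E F. E \<in> H \<Longrightarrow> F \<in> H \<Longrightarrow> E \<noteq> F \<Longrightarrow> E \<inter> F \<subseteq> MH \<and> card (E \<inter> F) \<le> l"
    and k: "2 \<le> k" "l \<le> k - 1" and pos: "0 < \<epsilon>"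
  shows "\<exists>C n0 \<theta>. 0 < C \<and> 0 < \<theta> \<and> (\<forall>n\<ge>n0. \<forall>G\<subseteq>k_subsets k n. \<epsilon> * real n ^ (k - 1) \<le> card G \<longrightarrow>
    card G \<le> C0 * real n ^ (k - 1) \<longrightarrow> (\<forall>v. codeg G {v} < \<theta> * real n ^ (k - 1)) \<longrightarrow>
    (\<exists>\<mu>. spread_copies H G (C / real n ^ (k - 1)) (C / real n ^ (k - 1 - l)) \<mu>))"
proof -
  \<comment> \<open>Exceptional edges cost a factor 2 and the splitting set a factor
    \<open>2 ^ k\<close>; what is left is exactly \<open>2 * (real l + 1) * c\<close>.\<close>
  define c where "c = \<epsilon> / (2 ^ (k + 2) * (real l + 1))"
  define q where "q = card (\<Union>H)"
  have c: "0 < c" using pos by (simp add: c_def)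
  have "2 * L * (\<epsilon> / (2 ^ (k + 2) * L)) = \<epsilon> / 2 ^ (k + 1)" if "L > 0" for L :: real
    using that by (simp add: field_simps)
  from this[of "real l + 1"] have c\<epsilon>: "2 * (real l + 1) * c = \<epsilon> / 2 ^ (k + 1)" by (simp add: c_def)
  define \<rho> where "\<rho> = min 1 (c / (2 * real q + 1))"
  have \<rho>: "0 < \<rho>" "\<rho> \<le> 1" using c by (auto simp: \<rho>_def)
  have q\<rho>: "2 * real q * \<rho> \<le> c"
  proof -
    have "2 * real q * \<rho> \<le> (2 * real q + 1) * (c / (2 * real q + 1))"
      using c \<rho> by (intro mult_mono) (auto simp: \<rho>_def)
    also have "\<dots> = c" by (simp add: add_nonneg_eq_0_iff)
    finally show ?thesis .
  qed
  define \<eta> :: real where "\<eta> = 1 / (2 * real ((k + 1) ^ 3 * 8 ^ k))"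
  have Z: "real ((k + 1) ^ 3 * 8 ^ k) \<ge> 1"
  proof -
    have "(k + 1) ^ 3 * 8 ^ k \<ge> (1::nat)" by simp
    then show ?thesis by (metis of_nat_1 of_nat_le_iff)
  qed
  have \<eta>: "0 < \<eta>" "\<eta> \<le> 1" "real ((k + 1) ^ 3 * 8 ^ k) * \<eta> = 1 / 2"
  proof -
    have "0 < 1 / (2 * x) \<and> 1 / (2 * x) \<le> 1 \<and> x * (1 / (2 * x)) = 1 / 2" if "x \<ge> 1" for x :: real
      using that by (simp add: field_simps)
    from this[OF Z, folded \<eta>_def]
    show "0 < \<eta>" "\<eta> \<le> 1" "real ((k + 1) ^ 3 * 8 ^ k) * \<eta> = 1 / 2" by blast+
  qed
  \<comment> \<open>The value at 1 becomes the bound on vertex degrees in the statement; the value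
    at 0 determines how large \<open>n\<close> must be for the empty set to be sparse, given
    \<open>card G \<le> C0 * n ^ (k - 1)\<close>.\<close>
  define \<theta> where "\<theta> j = (\<eta> * \<rho>) ^ (k - j)" for j
  have \<theta>pos: "0 < \<theta> j" for j using \<eta> \<rho> by (simp add: \<theta>_def)
  define C where "C = max ((2 ^ (k + 1)) ^ card H / ((real l + 1) * c)) (2 / c)"
  have Cpos: "0 < C" using c by (simp add: C_def less_max_iff_disj)
  have main: "\<exists>\<mu>. spread_copies H G (C / real n ^ (k - 1)) (C / real n ^ (k - 1 - l)) \<mu>"
    if n: "nat \<lceil>C0 / \<theta> 0\<rceil> + 1 \<le> n" and G: "G \<subseteq> k_subsets k n" and
      large: "\<epsilon> * real n ^ (k - 1) \<le> card G" and small: "card G \<le> C0 * real n ^ (k - 1)" and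
      vdeg: "\<And>v. codeg G {v} < \<theta> 1 * real n ^ (k - 1)" for n G
  proof -
    have n1: "1 \<le> n" using n by simp
    have finG: "finite G" using G finite_subset[of G "Pow {1..n}"] by (auto simp: k_subsets_def)
    have Gk: "g \<subseteq> {1..n} \<and> finite g \<and> card g = k" if "g \<in> G" for g
      using G that finite_subset[of g "{1..n}"] by (auto simp: k_subsets_def)
    define Exc where "Exc = {e\<in>G. \<exists>O1 B. O1 \<subseteq> e \<and> B \<subseteq> e \<and> \<not> O1 \<subseteq> B \<and>
      (\<eta> * \<rho>) ^ (k - card O1) * real n ^ (k - card O1) \<le> real (codeg G O1) \<and>
      \<rho> * real n ^ (k - card B) \<le> real (codeg G B) \<and>
      real (codeg G (O1 \<inter> B)) < (\<eta> * \<rho>) ^ (k - card (O1 \<inter> B)) * real n ^ (k - card (O1 \<inter> B))}"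
    have "real (card Exc) \<le> real ((k + 1) ^ 3 * 8 ^ k) * \<eta> * card G"
      unfolding Exc_def by (rule card_exceptional_le[OF G n1 \<rho> \<eta>(1,2)])
    then have Exc: "real (card Exc) \<le> card G / 2" unfolding \<eta>(3) by simp
    have "real (card (G - Exc)) = real (card G) - real (card Exc)"
      using finG by (subst card_Diff_subset) (auto simp: Exc_def of_nat_diff card_mono)
    then have good: "real (card (G - Exc)) \<ge> \<epsilon> / 2 * real n ^ (k - 1)" using Exc large by simp
    have low0: "real (card G) < \<theta> 0 * real n ^ k"
    proof -
      have "C0 / \<theta> 0 < real n" using n by linarith
      then have "C0 < \<theta> 0 * real n" using \<theta>pos[of 0] by (simp add: field_simps)
      then have "C0 * real n ^ (k - 1) < (\<theta> 0 * real n) * real n ^ (k - 1)"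
        using n1 by (intro mult_strict_right_mono) auto
      also have "\<dots> = \<theta> 0 * real n ^ k" using k by (simp add: power_eq_if)
      finally show ?thesis using small by linarith
    qed
    define light where "light e u v \<longleftrightarrow> u \<in> e \<and> v \<in> e \<and> u \<noteq> v \<and>
      (\<forall>B\<subseteq>e. \<not> {u, v} \<subseteq> B \<longrightarrow> real (codeg G B) < \<rho> * real n ^ (k - card B))" for e u v
    have "\<exists>u v. light e u v" if e: "e \<in> G - Exc" for e
      unfolding light_def
    proof (rule ex_light_pair[where \<theta> = \<theta>])
      fix P B assume PB: "P \<subseteq> e" "B \<subseteq> e" "\<not> P \<subseteq> B"
        "\<theta> (card P) * real n ^ (k - card P) \<le> real (codeg G P)"
        "\<rho> * real n ^ (k - card B) \<le> real (codeg G B)"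
      show "\<theta> (card (P \<inter> B)) * real n ^ (k - card (P \<inter> B)) \<le> real (codeg G (P \<inter> B))"
      proof (rule ccontr)
        assume "\<not> ?thesis"
        then have "e \<in> Exc" unfolding Exc_def using PB e unfolding \<theta>_def not_le by blast
        then show False using e by simp
      qed
    qed (use e Gk vdeg low0 finG in \<open>auto simp: \<theta>_def\<close>)
    then obtain u v where "\<And>e. e \<in> G - Exc \<Longrightarrow> light e (u e) (v e)" by metis
    note uv = this[unfolded light_def]
    obtain M where M: "M \<subseteq> {1..n}" "card (G - Exc) \<le> 2 ^ k * card {e\<in>G - Exc. e \<inter> M = e - {u e, v e}}"
      using ex_splitting_set[of "G - Exc" n k "\<lambda>e. {u e, v e}"] finG Gk by blast
    define G' where "G' = {e\<in>G - Exc. e \<inter> M = e - {u e, v e}}"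
    have "\<exists>\<mu>. spread_copies H G' ((2 ^ (k + 1)) ^ card H / ((real l + 1) * c * real n ^ (k - 1)))
        (2 / (c * real n ^ (k - 1 - l))) \<mu>"
    proof (rule clean_spread[OF H(1) H(2) H(3), where M = M and q = q])
      have "real (card (G - Exc)) \<le> 2 ^ k * real (card G')"
        using M(2) unfolding G'_def[symmetric] by (metis of_nat_le_iff of_nat_mult of_nat_numeral of_nat_power)
      then have "\<epsilon> / 2 * real n ^ (k - 1) \<le> 2 ^ k * real (card G')" using good by linarith
      then have "\<epsilon> / 2 ^ (k + 1) * real n ^ (k - 1) \<le> real (card G')" by (simp add: field_simps)
      then show "2 * (real l + 1) * c * real n ^ (k - 1) \<le> real (card G')" unfolding c\<epsilon> .
      fix e assume e: "e \<in> G'"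
      then have eG: "e \<in> G - Exc" "e \<inter> M = e - {u e, v e}" by (auto simp: G'_def)
      have "card (e - {u e, v e}) = k - 2"
        using uv[OF eG(1)] Gk[of e] eG(1) by (subst card_Diff_subset) auto
      then show "e \<subseteq> {1..n} \<and> card e = k \<and> card (e \<inter> M) = k - 2" using eG Gk[of e] by auto
      fix A y assume A: "A \<subseteq> e \<inter> M" "card A \<le> l" "y \<in> e" "y \<notin> A"
      have finA: "finite A" using A(1) Gk[of e] eG(1) finite_subset by blast
      have "\<not> {u e, v e} \<subseteq> insert y A" using A eG(2) uv[OF eG(1)] by auto
      then have "real (codeg G (insert y A)) < \<rho> * real n ^ (k - card (insert y A))"
        using uv[OF eG(1)] A by (metis Int_subset_iff insert_subset)
      moreover have "codeg G' (insert y A) \<le> codeg G (insert y A)"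
        using finG by (intro card_mono) (auto simp: G'_def)
      ultimately have "real (codeg G' (insert y A)) \<le> \<rho> * real n ^ (k - 1 - card A)"
        using finA A by simp
      then have "2 * real q * real (codeg G' (insert y A)) \<le> 2 * real q * (\<rho> * real n ^ (k - 1 - card A))"
        by (intro mult_left_mono) auto
      also have "\<dots> = (2 * real q * \<rho>) * real n ^ (k - 1 - card A)" by simp
      also have "\<dots> \<le> c * real n ^ (k - 1 - card A)" using q\<rho> by (intro mult_right_mono) auto
      finally show "2 * real q * real (codeg G' (insert y A)) \<le> c * real n ^ (k - 1 - card A)" .
    qed (use c n1 k in \<open>auto simp: q_def\<close>)
    then obtain \<mu> where "spread_copies H G' ((2 ^ (k + 1)) ^ card H / ((real l + 1) * c * real n ^ (k - 1)))
        (2 / (c * real n ^ (k - 1 - l))) \<mu>" ..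
    moreover have "(2 ^ (k + 1)) ^ card H / ((real l + 1) * c * real n ^ (k - 1)) \<le> C / real n ^ (k - 1)"
      unfolding divide_divide_eq_left[symmetric] by (intro divide_right_mono) (auto simp: C_def)
    moreover have "2 / (c * real n ^ (k - 1 - l)) \<le> C / real n ^ (k - 1 - l)"
      unfolding divide_divide_eq_left[symmetric] by (intro divide_right_mono) (auto simp: C_def)
    moreover have "G' \<subseteq> G" by (auto simp: G'_def)
    ultimately have "spread_copies H G (C / real n ^ (k - 1)) (C / real n ^ (k - 1 - l)) \<mu>"
      using c n1 by (elim spread_copies_mono) auto
    then show ?thesis ..
  qed
  show ?thesis
  proof (rule exI[of _ C], rule exI[of _ "nat \<lceil>C0 / \<theta> 0\<rceil> + 1"], rule exI[of _ "\<theta> 1"],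
      intro conjI allI impI Cpos \<theta>pos)
    fix n G assume "nat \<lceil>C0 / \<theta> 0\<rceil> + 1 \<le> n" "G \<subseteq> k_subsets k n" "\<epsilon> * real n ^ (k - 1) \<le> card G"
      "card G \<le> C0 * real n ^ (k - 1)" "\<forall>v. codeg G {v} < \<theta> 1 * real n ^ (k - 1)"
    then show "\<exists>\<mu>. spread_copies H G (C / real n ^ (k - 1)) (C / real n ^ (k - 1 - l)) \<mu>"
      by (intro main[of n G]) simp_all
  qed
qed

section \<open>Private vertices, cross-cuts and cones over a common link\<close>

lemma hypertree_finite: "hypertree H \<Longrightarrow> finite H" "hypertree H \<Longrightarrow> H \<noteq> {}"
  by (induction rule: hypertree.induct) auto

text \<open>The intersection condition survives the removal of \<open>S\<close> from all edges;
  injectivity ensures that a new edge stays new.\<close>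

lemma hypertree_Diff:
  assumes "hypertree H" "inj_on (\<lambda>E. E - S) H"
  shows "hypertree ((\<lambda>E. E - S) ` H)"
  using assms
proof (induction rule: hypertree.induct)
  case (single E)
  show ?case by (simp add: hypertree.single)
next
  case (extend H E F)
  have "hypertree ((\<lambda>E. E - S) ` H)" using extend by (auto intro: inj_on_subset)
  moreover have "E - S \<notin> (\<lambda>E. E - S) ` H" using extend.hyps(2) extend.prems
    by (auto simp: inj_on_def)
  moreover have "F - S \<in> (\<lambda>E. E - S) ` H" using extend.hyps by simp
  moreover have "(E - S) \<inter> \<Union>((\<lambda>E. E - S) ` H) = (E - S) \<inter> (F - S)"
    using extend.hyps(4) by blast
  ultimately have "hypertree (insert (E - S) ((\<lambda>E. E - S) ` H))" by (rule hypertree.extend)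
  then show ?case by simp
qed

lemma hdegree_1_unique:
  assumes "hdegree H v = 1" "E \<in> H" "F \<in> H" "v \<in> E" "v \<in> F"
  shows "E = F"
proof -
  obtain E0 where "{E \<in> H. v \<in> E} = {E0}"
    using assms(1) by (auto simp: hdegree_def card_1_singleton_iff)
  then show ?thesis using assms by blast
qed

lemma two_contractible_pairs:
  assumes "two_contractible H"
  shows "\<exists>pr. \<forall>E\<in>H. pr E \<subseteq> E \<and> card (pr E) = 2 \<and> (\<forall>F\<in>H. F \<noteq> E \<longrightarrow> pr E \<inter> F = {})"
proof -
  have "\<exists>P. P \<subseteq> E \<and> card P = 2 \<and> (\<forall>F\<in>H. F \<noteq> E \<longrightarrow> P \<inter> F = {})" if E: "E \<in> H" for E
  proof -
    have "2 \<le> card {v \<in> E. hdegree H v = 1}" using assms E by (simp add: two_contractible_def)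
    then obtain P where P: "P \<subseteq> {v \<in> E. hdegree H v = 1}" "card P = 2"
      using obtain_subset_with_card_n by metis
    moreover have "P \<inter> F = {}" if "F \<in> H" "F \<noteq> E" for F
      using P(1) hdegree_1_unique[of H _ E F] E that by blast
    ultimately show ?thesis by blast
  qed
  then show ?thesis by metis
qed

text \<open>One private vertex from every edge forms a cross-cut, so the minimum ranges over a
  nonempty finite family; only then does \<open>Min\<close> have its intended meaning.\<close>

lemma cross_cut_min:
  assumes "finite H" "\<And>E. E \<in> H \<Longrightarrow> finite E" "two_contractible H"
  shows "\<exists>S. cross_cut H S \<and> card S = cross_cut_number H"
    and "\<And>S. cross_cut H S \<Longrightarrow> cross_cut_number H \<le> card S"
proof -
  have "{S. cross_cut H S} \<subseteq> Pow (\<Union>H)" by (auto simp: cross_cut_def)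
  then have fin: "finite {S. cross_cut H S}" by (rule finite_subset) (use assms in auto)
  obtain pr where "\<forall>E\<in>H. pr E \<subseteq> E \<and> card (pr E) = 2 \<and> (\<forall>F\<in>H. F \<noteq> E \<longrightarrow> pr E \<inter> F = {})"
    using two_contractible_pairs[OF assms(3)] ..
  note pr = bspec[OF this]
  have "\<exists>s. s \<in> pr E" if "E \<in> H" for E using pr[OF that] by (auto simp: card_2_iff)
  then obtain s where s: "\<And>E. E \<in> H \<Longrightarrow> s E \<in> pr E" by metis
  have "s ` H \<inter> E = {s E}" if E: "E \<in> H" for E
  proof -
    have "s F \<notin> E" if "F \<in> H" "F \<noteq> E" for F using pr[OF that(1)] s[OF that(1)] E that(2) by blast
    moreover have "s E \<in> E" using pr[OF E] s[OF E] by blast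
    ultimately show ?thesis using E by blast
  qed
  moreover have "s ` H \<subseteq> \<Union>H" using pr s by blast
  ultimately have "cross_cut H (s ` H)" by (simp add: cross_cut_def)
  then have ne: "{S. cross_cut H S} \<noteq> {}" by blast
  have "cross_cut_number H \<in> card ` {S. cross_cut H S}"
    unfolding cross_cut_number_def using fin ne by (intro Min_in) auto
  then show "\<exists>S. cross_cut H S \<and> card S = cross_cut_number H" by auto
  show "cross_cut_number H \<le> card S" if "cross_cut H S" for S
    unfolding cross_cut_number_def using fin that by (intro Min_le) auto
qed

text \<open>\<open>T\<close> is fixed and the members of \<open>L\<close> avoid it, so deleting
  \<open>T\<close> from the image of \<open>E\<close> recovers the image of \<open>E - S\<close>.
  Every prescription for \<open>H\<close> thereby becomes one for the link, at no loss in
  \<open>\<alpha>\<close> or \<open>\<beta>\<close>.\<close>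

lemma cone_spread:
  assumes sp: "spread_copies ((\<lambda>E. E - S) ` H) L \<alpha> \<beta> \<mu>" and inj: "inj_on (\<lambda>E. E - S) H"
    and S: "\<And>E. E \<in> H \<Longrightarrow> \<exists>s. E \<inter> S = {s}" and h: "bij_betw h S T"
    and LG: "\<And>D x. D \<in> L \<Longrightarrow> x \<in> T \<Longrightarrow> insert x D \<in> G" "\<And>D. D \<in> L \<Longrightarrow> D \<inter> T = {}"
  shows "spread_copies H G \<alpha> \<beta> (map_pmf (\<lambda>f v. if v \<in> S then h v else f v) \<mu>)"
proof -
  define g where "g f v = (if v \<in> S then h v else f v)" for f v
  have fL: "f ` (E - S) \<in> L" if "f \<in> set_pmf \<mu>" "E \<in> H" for f E
    using sp that by (auto simp: spread_copies_def)
  have gE: "g f ` (E - S) = f ` (E - S)" for f E by (intro image_cong) (auto simp: g_def)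
  have gS: "g f ` X = h ` X" if "X \<subseteq> S" for f X using that by (intro image_cong) (auto simp: g_def)
  have hT: "h ` S = T" using h by (simp add: bij_betw_def)
  have img: "\<exists>x\<in>T. g f ` E = insert x (f ` (E - S))" if E: "E \<in> H" for f E
  proof -
    obtain s where s: "E \<inter> S = {s}" using S[OF E] by blast
    then have "E = insert s (E - S)" by auto
    then have "g f ` E = insert (g f s) (g f ` (E - S))" by (metis image_insert)
    moreover have "g f s = h s" "h s \<in> T" using s hT by (auto simp: g_def)
    ultimately show ?thesis using gE by metis
  qed
  have imgT: "g f ` E - T = f ` (E - S)" if "f \<in> set_pmf \<mu>" "E \<in> H" for f E
  proof -
    from img[OF that(2), of f] obtain x where "x \<in> T" "g f ` E = insert x (f ` (E - S))" by blast
    then show ?thesis using LG(2)[OF fL[OF that]] by (simp only:) blast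
  qed
  have "inj_on (g f) (\<Union>H)" if f: "f \<in> set_pmf \<mu>" for f
  proof -
    have "inj_on f (\<Union>((\<lambda>E. E - S) ` H))" using sp f by (auto simp: spread_copies_def)
    moreover have U: "\<Union>((\<lambda>E. E - S) ` H) = \<Union>H - S" by auto
    ultimately have i: "inj_on (g f) (\<Union>H - S)" by (auto simp: inj_on_def g_def)
    have "inj_on (g f) S" using h by (auto simp: bij_betw_def inj_on_def g_def)
    moreover have "g f ` (\<Union>H - S) \<inter> g f ` S = {}"
    proof -
      have "g f v \<notin> T" if v: "v \<in> \<Union>H - S" for v
      proof -
        obtain E where E: "E \<in> H" "v \<in> E - S" using v by auto
        then have "g f v \<in> f ` (E - S)" using gE[of f E] by blast
        then show ?thesis using LG(2)[OF fL[OF f E(1)]] by blast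
      qed
      then show ?thesis using gS[of S f] hT by blast
    qed
    ultimately have "inj_on (g f) ((\<Union>H - S) \<union> S)" using i by (subst inj_on_Un) blast
    then show ?thesis by (rule inj_on_subset) auto
  qed
  moreover have "g f ` E \<in> G" if "f \<in> set_pmf \<mu>" "E \<in> H" for f E
    using img[OF that(2), of f] LG(1) fL[OF that] by auto
  moreover have "measure_pmf.prob (map_pmf g \<mu>) {f. \<forall>E\<in>H'. f ` E = \<gamma> E} \<le> \<alpha> * \<beta> ^ (card H' - 1)"
    if H': "H' \<subseteq> H" "H' \<noteq> {}" for H' \<gamma>
  proof -
    \<comment> \<open>Prescriptions for the link are indexed by the sets \<open>E - S\<close>;
      injectivity allows \<open>E\<close> to be recovered from the index.\<close>
    define \<gamma>' where "\<gamma>' W = \<gamma> (inv_into H (\<lambda>E. E - S) W) - T" for W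
    have \<gamma>': "\<gamma>' (E - S) = \<gamma> E - T" if "E \<in> H" for E
      using inv_into_f_f[OF inj that] by (simp add: \<gamma>'_def)
    have "measure_pmf.prob (map_pmf g \<mu>) {f. \<forall>E\<in>H'. f ` E = \<gamma> E} =
        measure_pmf.prob \<mu> {f. \<forall>E\<in>H'. g f ` E = \<gamma> E}" by (simp add: vimage_def)
    also have "\<dots> \<le> (\<Sum>i\<in>{()}. measure_pmf.prob \<mu> {f. \<forall>W\<in>(\<lambda>E. E - S) ` H'. f ` W = \<gamma>' W})"
    proof (rule prob_pmf_le_sum)
      fix f assume f: "f \<in> set_pmf \<mu>" "f \<in> {f. \<forall>E\<in>H'. g f ` E = \<gamma> E}"
      have "f ` (E - S) = \<gamma>' (E - S)" if "E \<in> H'" for E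
      proof -
        have "E \<in> H" using that H' by auto
        then show ?thesis using f(2) that imgT[OF f(1)] \<gamma>' by fastforce
      qed
      then show "\<exists>i\<in>{()}. f \<in> {f. \<forall>W\<in>(\<lambda>E. E - S) ` H'. f ` W = \<gamma>' W}" by simp
    qed simp
    also have "\<dots> \<le> \<alpha> * \<beta> ^ (card ((\<lambda>E. E - S) ` H') - 1)"
    proof -
      have "(\<lambda>E. E - S) ` H' \<subseteq> (\<lambda>E. E - S) ` H" "(\<lambda>E. E - S) ` H' \<noteq> {}" using H' by auto
      from spread_copiesD(3)[OF sp this, of \<gamma>'] show ?thesis by simp
    qed
    also have "card ((\<lambda>E. E - S) ` H') = card H'"
      using inj H' by (intro card_image) (auto intro: inj_on_subset)
    finally show ?thesis .
  qed
  ultimately have "spread_copies H G \<alpha> \<beta> (map_pmf g \<mu>)"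
    unfolding spread_copies_def by (intro conjI ballI allI impI) auto
  then show ?thesis unfolding g_def .
qed

text \<open>\<open>G\<close> is counted by the (k-1)-sets \<open>D\<close> outside \<open>X\<close>,
  each with at most \<open>x0\<close> extensions in \<open>X\<close>. If all had fewer than
  \<open>\<sigma>\<close> extensions there would be at most \<open>(\<sigma> - 1)\<close> times the
  binomial many edges; the surplus \<open>\<delta>\<close> forces many \<open>D\<close> with
  \<open>\<sigma>\<close> extensions, and there are at most \<open>2 ^ x0\<close> candidates for the
  set of extensions.\<close>

lemma ex_dense_common_link:
  fixes \<delta> :: real
  assumes G: "G \<subseteq> k_subsets k n" "\<And>e. e \<in> G \<Longrightarrow> card (e \<inter> X) = 1"
    and X: "finite X" "card X \<le> x0" "1 \<le> x0" and \<sigma>: "1 \<le> \<sigma>" and \<delta>: "0 < \<delta>"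
    and n: "0 < n choose (k - 1)"
    and large: "(real \<sigma> - 1 + \<delta>) * real (n choose (k - 1)) \<le> card G"
  shows "\<exists>T L. T \<subseteq> X \<and> card T = \<sigma> \<and> L \<subseteq> k_subsets (k - 1) n \<and> (\<forall>D\<in>L. D \<inter> X = {}) \<and>
    (\<forall>D\<in>L. \<forall>x\<in>T. insert x D \<in> G) \<and> \<delta> * real (n choose (k - 1)) / (real x0 * 2 ^ x0) \<le> card L"
proof -
  define b where "b = real (n choose (k - 1))"
  have b: "0 < b" using n by (simp add: b_def)
  define DD where "DD = {D \<in> k_subsets (k - 1) n. D \<inter> X = {}}"
  define N where "N D = {x \<in> X. insert x D \<in> G}" for D
  define Z where "Z = {D \<in> DD. \<sigma> \<le> card (N D)}"
  have finK: "finite (k_subsets (k - 1) n)" "card (k_subsets (k - 1) n) = n choose (k - 1)"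
    using n_subsets[of "{1..n}" "k - 1"] by (auto simp: k_subsets_def)
  have finD: "finite DD" and cardD: "real (card DD) \<le> b"
    using finK card_mono[of "k_subsets (k - 1) n" DD] by (auto simp: DD_def b_def)
  have finZ: "finite Z" and ZD: "Z \<subseteq> DD" using finD by (auto simp: Z_def)
  have finN: "finite (N D)" and cardN: "card (N D) \<le> x0" for D
    using X card_mono[of X "N D"] by (auto simp: N_def)
  have "G \<subseteq> (\<Union>D\<in>DD. (\<lambda>x. insert x D) ` N D)"
  proof
    fix e assume e: "e \<in> G"
    obtain x where x: "e \<inter> X = {x}" using G(2)[OF e] by (auto simp: card_1_singleton_iff)
    have es: "e \<subseteq> {1..n}" "card e = k" using e G(1) by (auto simp: k_subsets_def)
    have "finite e" using es finite_subset by auto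
    then have "card (e - {x}) = k - 1" using x es by (subst card_Diff_singleton) auto
    moreover have "(e - {x}) \<inter> X = {}" using x by blast
    ultimately have "e - {x} \<in> DD" using es by (auto simp: DD_def k_subsets_def)
    moreover have "insert x (e - {x}) = e" "x \<in> X" using x by auto
    ultimately show "e \<in> (\<Union>D\<in>DD. (\<lambda>x. insert x D) ` N D)"
      using e by (auto simp: N_def intro!: bexI[of _ "e - {x}"] image_eqI[of _ _ x])
  qed
  then have "card G \<le> card (\<Union>D\<in>DD. (\<lambda>x. insert x D) ` N D)"
    using finD finN by (intro card_mono) auto
  also have "\<dots> \<le> (\<Sum>D\<in>DD. card ((\<lambda>x. insert x D) ` N D))" by (rule card_UN_le[OF finD])
  also have "\<dots> \<le> (\<Sum>D\<in>DD. card (N D))" using finN by (intro sum_mono card_image_le)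
  finally have "real (card G) \<le> (\<Sum>D\<in>DD. real (card (N D)))"
    by (simp only: of_nat_sum[symmetric] of_nat_le_iff)
  also have "\<dots> \<le> (\<Sum>D\<in>DD. (real \<sigma> - 1) + (if D \<in> Z then real x0 else 0))"
  proof (rule sum_mono)
    fix D assume "D \<in> DD"
    then have "D \<notin> Z \<Longrightarrow> card (N D) \<le> \<sigma> - 1" by (auto simp: Z_def)
    then show "real (card (N D)) \<le> (real \<sigma> - 1) + (if D \<in> Z then real x0 else 0)"
      using cardN[of D] \<sigma> by (cases "D \<in> Z") (auto simp: of_nat_diff)
  qed
  also have "\<dots> = (real \<sigma> - 1) * card DD + real x0 * card Z"
    using finD ZD by (simp add: sum.distrib sum.If_cases Int_absorb1 mult.commute)
  also have "\<dots> \<le> (real \<sigma> - 1) * b + real x0 * card Z"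
    using cardD \<sigma> by (intro add_right_mono mult_left_mono) auto
  finally have Zl: "\<delta> * b \<le> real x0 * card Z"
    using large by (simp add: b_def algebra_simps)
  have "\<exists>T. T \<subseteq> N D \<and> card T = \<sigma>" if "D \<in> Z" for D
    using that obtain_subset_with_card_n[of \<sigma> "N D"] by (auto simp: Z_def)
  then obtain T where T: "\<And>D. D \<in> Z \<Longrightarrow> T D \<subseteq> N D \<and> card (T D) = \<sigma>" by metis
  have TX: "T D \<in> Pow X" if "D \<in> Z" for D using T[OF that] by (auto simp: N_def)
  have "\<exists>T0\<in>Pow X. real (card Z) \<le> 2 ^ x0 * real (card {D\<in>Z. T D = T0})"
  proof (rule ccontr)
    assume "\<not> ?thesis"
    then have lt: "2 ^ x0 * real (card {D\<in>Z. T D = T0}) < card Z" if "T0 \<in> Pow X" for T0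
      using that by (auto simp: not_le)
    have "Z \<subseteq> (\<Union>T0\<in>Pow X. {D\<in>Z. T D = T0})" using TX by blast
    then have "card Z \<le> card (\<Union>T0\<in>Pow X. {D\<in>Z. T D = T0})"
      using X finZ by (intro card_mono) auto
    also have "\<dots> \<le> (\<Sum>T0\<in>Pow X. card {D\<in>Z. T D = T0})" using X by (intro card_UN_le) auto
    finally have "2 ^ x0 * real (card Z) \<le> (\<Sum>T0\<in>Pow X. 2 ^ x0 * real (card {D\<in>Z. T D = T0}))"
      unfolding sum_distrib_left[symmetric] of_nat_sum[symmetric] by (intro mult_left_mono) (simp_all only: of_nat_le_iff, simp)
    also have "\<dots> < (\<Sum>T0\<in>Pow X. real (card Z))"
      by (rule sum_strict_mono) (use lt X in auto)
    also have "\<dots> = 2 ^ card X * real (card Z)" using X by (simp add: card_Pow)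
    also have "\<dots> \<le> 2 ^ x0 * real (card Z)" using X by (intro mult_right_mono power_increasing) auto
    finally show False by simp
  qed
  then obtain T0 where T0: "T0 \<subseteq> X" "real (card Z) \<le> 2 ^ x0 * real (card {D\<in>Z. T D = T0})" by blast
  define L where "L = {D\<in>Z. T D = T0}"
  have "\<delta> * b \<le> real x0 * (2 ^ x0 * real (card L))"
    unfolding L_def by (rule order_trans[OF Zl mult_left_mono[OF T0(2)]]) simp
  then have Lc: "\<delta> * b / (real x0 * 2 ^ x0) \<le> card L" using X(3) by (simp add: field_simps)
  moreover have "0 < \<delta> * b / (real x0 * 2 ^ x0)" using \<delta> b X(3) by simp
  ultimately have "L \<noteq> {}" by (metis card.empty not_le of_nat_0)
  then have "card T0 = \<sigma>" using T by (auto simp: L_def)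
  moreover have "\<forall>D\<in>L. \<forall>x\<in>T0. insert x D \<in> G" using T by (auto simp: L_def N_def)
  moreover have "L \<subseteq> k_subsets (k - 1) n" "\<forall>D\<in>L. D \<inter> X = {}" using ZD by (auto simp: L_def DD_def)
  ultimately show ?thesis using T0(1) Lc unfolding b_def by blast
qed

section \<open>Supersaturation at the threshold\<close>

lemma binomial_ge_power:
  assumes "1 \<le> r" "r \<le> n"
  shows "real n ^ r / real r ^ r \<le> real (n choose r)"
  using binomial_ge_n_over_k_pow_k[of r n, where 'a = real] assms by (simp add: power_divide)

text \<open>The upper bound on \<open>card G\<close> keeps the number of high-degree vertices
  bounded and makes the empty set sparse. It is no loss for the containers, where larger graphs are
  sampled down to this size.\<close>

lemma supersaturation:
  fixes H :: "'a set set" and \<epsilon> C0 :: real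
  assumes k: "2 \<le> k" "l \<le> k - 2" and H: "k_tree k H" "two_contractible H" "overlapping l H"
    and \<epsilon>: "0 < \<epsilon>" and C0: "0 < C0"
  shows "\<exists>C n0. 0 < C \<and> (\<forall>n\<ge>n0. \<forall>G\<subseteq>k_subsets k n.
    (real (cross_cut_number H) - 1 + \<epsilon>) * real (n choose (k - 1)) \<le> card G \<longrightarrow>
    card G \<le> C0 * real n ^ (k - 1) \<longrightarrow>
    (\<exists>\<mu>. spread_copies H G (C / real n ^ (k - 1)) (C / real n ^ (k - 1 - l)) \<mu>))"
proof -
  define \<sigma> where "\<sigma> = cross_cut_number H"
  have ht: "hypertree H" and finH: "finite H" and HE: "\<And>E. E \<in> H \<Longrightarrow> finite E \<and> card E = k"
    using H hypertree_finite by (auto simp: k_tree_def uniform_def)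
  have Hne: "H \<noteq> {}" using hypertree_finite(2)[OF ht] .
  obtain pr where "\<forall>E\<in>H. pr E \<subseteq> E \<and> card (pr E) = 2 \<and> (\<forall>F\<in>H. F \<noteq> E \<longrightarrow> pr E \<inter> F = {})"
    using two_contractible_pairs[OF H(2)] ..
  note pr = bspec[OF this]
  obtain S where S: "cross_cut H S" "card S = \<sigma>"
    using cross_cut_min(1)[OF finH _ H(2)] HE unfolding \<sigma>_def by blast
  have S1: "card (S \<inter> E) = 1" if "E \<in> H" for E using S(1) that by (auto simp: cross_cut_def)
  have finS: "finite S" using S(1) finH HE by (auto simp: cross_cut_def intro: finite_subset)
  have \<sigma>: "1 \<le> \<sigma>"
  proof -
    obtain E where "E \<in> H" using Hne by blast
    then have "S \<noteq> {}" using S1 by fastforce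
    then have "0 < card S" using finS by (simp add: card_gt_0_iff)
    then show ?thesis using S(2) by simp
  qed
  \<comment> \<open>The complement of all private pairs: each edge has exactly two vertices outside,
    to be placed on a light pair, and intersections of distinct edges lie inside.\<close>
  define MH where "MH = - (\<Union>E\<in>H. pr E)"
  have EMH: "E \<inter> MH = E - pr E" if E: "E \<in> H" for E
  proof -
    have "v \<notin> pr F" if "v \<in> E - pr E" "F \<in> H" for v F
      using pr[OF that(2)] E that(1) by (cases "F = E") auto
    then show ?thesis using E by (auto simp: MH_def)
  qed
  have cMH: "finite E \<and> card E = k \<and> card (E \<inter> MH) = k - 2" if E: "E \<in> H" for E
  proof -
    have "finite (pr E)" using pr[OF E] HE[OF E] finite_subset by blast
    then have "card (E - pr E) = k - 2" using pr[OF E] HE[OF E] by (simp add: card_Diff_subset)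
    then show ?thesis using EMH[OF E] HE[OF E] by simp
  qed
  have IMH: "E \<inter> F \<subseteq> MH \<and> card (E \<inter> F) \<le> l" if "E \<in> H" "F \<in> H" "E \<noteq> F" for E F
  proof -
    have "v \<notin> pr E'" if "v \<in> E \<inter> F" "E' \<in> H" for v E'
      using pr[OF that(2)] that(1) \<open>E \<in> H\<close> \<open>F \<in> H\<close> \<open>E \<noteq> F\<close> by (cases "E' = E") auto
    then show ?thesis using H(3) that by (auto simp: MH_def overlapping_def)
  qed
  \<comment> \<open>A cross-cut meets an edge in one vertex and cannot contain both private ones;
    the remaining private vertex separates \<open>E - S\<close> from every other
    \<open>F - S\<close>.\<close>
  have injW: "inj_on (\<lambda>E. E - S) H"
  proof (rule inj_onI, rule ccontr)
    fix E F assume EF: "E \<in> H" "F \<in> H" "E - S = F - S" "E \<noteq> F"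
    have "\<not> pr E \<subseteq> S"
    proof
      assume "pr E \<subseteq> S"
      then have "card (pr E) \<le> card (S \<inter> E)" using pr[OF EF(1)] finS by (intro card_mono) auto
      then show False using S1[OF EF(1)] pr[OF EF(1)] by simp
    qed
    then obtain v where "v \<in> pr E" "v \<notin> S" by blast
    moreover have "pr E \<subseteq> E" "pr E \<inter> F = {}" using pr[OF EF(1)] EF by auto
    ultimately show False using EF(3) by blast
  qed
  define HW where "HW = (\<lambda>E. E - S) ` H"
  have HW: "hypertree HW" unfolding HW_def by (rule hypertree_Diff[OF ht injW])
  have uW: "uniform (k - 1) HW"
    unfolding uniform_def HW_def
  proof (intro ballI)
    fix W assume "W \<in> (\<lambda>E. E - S) ` H"
    then obtain E where E: "E \<in> H" "W = E - S" by blast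
    have "card W = card E - card (E \<inter> S)" using E HE[OF E(1)] by (simp add: card_Diff_subset_Int)
    then show "finite W \<and> card W = k - 1" using E HE[OF E(1)] S1[OF E(1)] by (simp add: Int_commute)
  qed
  have oW: "overlapping l HW"
    unfolding overlapping_def HW_def
  proof (intro ballI impI)
    fix W W' assume "W \<in> (\<lambda>E. E - S) ` H" "W' \<in> (\<lambda>E. E - S) ` H" "W \<noteq> W'"
    then obtain E F where EF: "E \<in> H" "F \<in> H" "W = E - S" "W' = F - S" "E \<noteq> F" by blast
    have "card (W \<inter> W') \<le> card (E \<inter> F)" using EF HE by (intro card_mono) auto
    also have "\<dots> \<le> l" using IMH EF by blast
    finally show "card (W \<inter> W') \<le> l" .
  qed
  define \<kappa> where "\<kappa> = 1 / real (k - 1) ^ (k - 1)"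
  have \<kappa>: "0 < \<kappa>" using k by (simp add: \<kappa>_def)
  have bin: "\<kappa> * real n ^ (k - 1) \<le> real (n choose (k - 1))" if "k \<le> n" for n
    using binomial_ge_power[of "k - 1" n] k that by (simp add: \<kappa>_def)
  have "\<exists>C n0 \<theta>. 0 < C \<and> 0 < \<theta> \<and> (\<forall>n\<ge>n0. \<forall>G\<subseteq>k_subsets k n. (\<epsilon> / 2 * \<kappa>) * real n ^ (k - 1) \<le> card G \<longrightarrow>
    card G \<le> C0 * real n ^ (k - 1) \<longrightarrow> (\<forall>v. codeg G {v} < \<theta> * real n ^ (k - 1)) \<longrightarrow>
    (\<exists>\<mu>. spread_copies H G (C / real n ^ (k - 1)) (C / real n ^ (k - 1 - l)) \<mu>))"
    by (rule light_spread[OF ht cMH IMH]) (use k \<epsilon> \<kappa> in auto)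
  then obtain C1 n1 \<theta> where *: "0 < C1 \<and> 0 < \<theta> \<and> (\<forall>n\<ge>n1. \<forall>G\<subseteq>k_subsets k n.
    (\<epsilon> / 2 * \<kappa>) * real n ^ (k - 1) \<le> card G \<longrightarrow>
    card G \<le> C0 * real n ^ (k - 1) \<longrightarrow> (\<forall>v. codeg G {v} < \<theta> * real n ^ (k - 1)) \<longrightarrow>
    (\<exists>\<mu>. spread_copies H G (C1 / real n ^ (k - 1)) (C1 / real n ^ (k - 1 - l)) \<mu>))"
    by (elim exE) (rule that)
  have C1: "0 < C1" "0 < \<theta>" using * by simp_all
  note light = *[THEN conjunct2, THEN conjunct2, rule_format]
  \<comment> \<open>Bounds the number of vertices of degree at least
    \<open>\<theta> * n ^ (k - 1)\<close>, whose degrees add up to at most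
    \<open>2 ^ k * card G\<close>.\<close>
  define x0 where "x0 = nat \<lceil>2 ^ k * C0 / \<theta>\<rceil> + 1"
  have x0: "1 \<le> x0" "2 ^ k * C0 / \<theta> \<le> real x0" unfolding x0_def by linarith+
  define \<epsilon>2 where "\<epsilon>2 = \<epsilon> / 4 * \<kappa> / (real x0 * 2 ^ x0)"
  have \<epsilon>2: "0 < \<epsilon>2" using \<epsilon> \<kappa> x0 by (simp add: \<epsilon>2_def)
  have "l < k - 1" using k by simp
  from dense_spread[OF HW uW oW this \<epsilon>2]
  obtain C2 n2 where *: "0 < C2 \<and> (\<forall>n\<ge>n2. \<forall>G\<subseteq>k_subsets (k - 1) n.
    \<epsilon>2 * real n ^ (k - 1) \<le> card G \<longrightarrow>
    (\<exists>\<mu>. spread_copies HW G (C2 / real n ^ (k - 1)) (C2 / real n ^ (k - 1 - l)) \<mu>))"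
    by (elim exE) (rule that)
  have C2: "0 < C2" using * by simp
  note dense = *[THEN conjunct2, rule_format]
  define n3 where "n3 = nat \<lceil>real (x0 * x0) / (\<epsilon> / 4 * \<kappa>)\<rceil> + k"
  define C where "C = max C1 C2"
  have Cpos: "0 < C" using C1 by (simp add: C_def)
  have main: "\<exists>\<mu>. spread_copies H G (C / real n ^ (k - 1)) (C / real n ^ (k - 1 - l)) \<mu>"
    if n: "max (max n1 n2) n3 \<le> n" and G: "G \<subseteq> k_subsets k n"
      and large: "(real \<sigma> - 1 + \<epsilon>) * real (n choose (k - 1)) \<le> card G"
      and small: "card G \<le> C0 * real n ^ (k - 1)" for n G
  proof -
    have nn: "n1 \<le> n" "n2 \<le> n" "k \<le> n" "1 \<le> n" "real (x0 * x0) / (\<epsilon> / 4 * \<kappa>) \<le> real n"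
      using n k unfolding n3_def by (auto, linarith)
    define b where "b = real (n choose (k - 1))"
    have b: "0 < n choose (k - 1)" "\<kappa> * real n ^ (k - 1) \<le> b" using nn bin by (auto simp: b_def)
    have npos: "0 < real n ^ j" for j using nn by simp
    have finG: "finite G" using G finite_subset[of G "Pow {1..n}"] by (auto simp: k_subsets_def)
    have Gk: "g \<subseteq> {1..n} \<and> finite g \<and> card g = k" if "g \<in> G" for g
      using G that finite_subset[of g "{1..n}"] by (auto simp: k_subsets_def)
    define X where "X = {v \<in> {1..n}. \<theta> * real n ^ (k - 1) \<le> codeg G {v}}"
    have finX: "finite X" by (simp add: X_def)
    have cardX: "card X \<le> x0"
    proof -
      have "real (card ((\<lambda>v. {v}) ` X)) * (\<theta> * real n ^ (k - 1)) \<le> 2 ^ k * real (codeg G {})"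
        by (rule card_mult_threshold_le[OF finG]) (use Gk finX in \<open>auto simp: X_def\<close>)
      then have "real (card X) * (\<theta> * real n ^ (k - 1)) \<le> 2 ^ k * real (card G)"
        by (simp add: card_image)
      also have "\<dots> \<le> 2 ^ k * (C0 * real n ^ (k - 1))" using small by simp
      finally have "(real (card X) * \<theta>) * real n ^ (k - 1) \<le> (2 ^ k * C0) * real n ^ (k - 1)"
        by (simp add: mult.assoc)
      then have "real (card X) * \<theta> \<le> 2 ^ k * C0" using npos by (meson mult_right_le_imp_le)
      then have "real (card X) \<le> 2 ^ k * C0 / \<theta>" using C1 by (simp add: field_simps)
      then show ?thesis using x0 by linarith
    qed
    define G1 where "G1 = {e\<in>G. e \<inter> X = {}}"
    define G2 where "G2 = {e\<in>G. 2 \<le> card (e \<inter> X)}"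
    define G3 where "G3 = {e\<in>G. card (e \<inter> X) = 1}"
    have sub: "G1 \<subseteq> G" "G2 \<subseteq> G" "G3 \<subseteq> G" by (auto simp: G1_def G2_def G3_def)
    have C_ge: "C1 / real n ^ j \<le> C / real n ^ j" "C2 / real n ^ j \<le> C / real n ^ j" for j
      using npos by (auto simp: C_def intro!: divide_right_mono)
    show ?thesis
    proof (cases "\<epsilon> / 2 * b \<le> card G1")
      case True
      have "\<epsilon> / 2 * (\<kappa> * real n ^ (k - 1)) \<le> \<epsilon> / 2 * b" using b \<epsilon> by (intro mult_left_mono) auto
      then have l1: "(\<epsilon> / 2 * \<kappa>) * real n ^ (k - 1) \<le> card G1" using True by (simp add: mult.assoc)
      have "card G1 \<le> card G" using finG sub by (intro card_mono)
      then have l2: "card G1 \<le> C0 * real n ^ (k - 1)" using small by linarith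
      have l3: "codeg G1 {v} < \<theta> * real n ^ (k - 1)" for v
      proof (cases "v \<in> {1..n} - X")
        case True
        have "codeg G1 {v} \<le> codeg G {v}" using finG sub by (intro card_mono) auto
        moreover have "codeg G {v} < \<theta> * real n ^ (k - 1)" using True by (auto simp: X_def)
        ultimately show ?thesis by linarith
      next
        case False
        then have "v \<notin> g" if "g \<in> G1" for g using Gk[of g] that unfolding G1_def by blast
        then have "{g\<in>G1. {v} \<subseteq> g} = {}" by blast
        then have "codeg G1 {v} = 0" by (metis card.empty)
        then show ?thesis using mult_pos_pos[OF C1(2) npos[of "k - 1"]] by linarith
      qed
      obtain \<mu> where "spread_copies H G1 (C1 / real n ^ (k - 1)) (C1 / real n ^ (k - 1 - l)) \<mu>"
        using light[OF nn(1) order_trans[OF sub(1) G] l1 l2 l3] ..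
      then have "spread_copies H G (C / real n ^ (k - 1)) (C / real n ^ (k - 1 - l)) \<mu>"
        using C_ge sub C1 npos by (elim spread_copies_mono) (auto intro: less_imp_le)
      then show ?thesis ..
    next
      case False
      have "card G \<le> card G1 + card G2 + card G3"
      proof -
        have "G \<subseteq> G1 \<union> G2 \<union> G3"
        proof
          fix e assume e: "e \<in> G"
          show "e \<in> G1 \<union> G2 \<union> G3"
          proof (cases "card (e \<inter> X) = 0")
            case True
            then have "e \<inter> X = {}" using finX by simp
            then show ?thesis using e by (simp add: G1_def)
          next
            case False
            then show ?thesis using e by (auto simp: G2_def G3_def)
          qed
        qed
        then have "card G \<le> card (G1 \<union> G2 \<union> G3)" using finG sub by (intro card_mono) (auto intro: finite_subset)
        also have "\<dots> \<le> card (G1 \<union> G2) + card G3" by (rule card_Un_le)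
        also have "\<dots> \<le> card G1 + card G2 + card G3" by (simp add: card_Un_le)
        finally show ?thesis .
      qed
      moreover have "real (card G2) \<le> \<epsilon> / 4 * b"
      proof -
        define PP where "PP = {(u, v). u \<in> X \<and> v \<in> X \<and> u \<noteq> v}"
        have PP: "finite PP" "card PP \<le> x0 * x0"
        proof -
          have s: "PP \<subseteq> X \<times> X" by (auto simp: PP_def)
          then show "finite PP" using finX finite_subset by blast
          have "card PP \<le> card X * card X" using card_mono[OF _ s] finX by (simp add: card_cartesian_product)
          also have "\<dots> \<le> x0 * x0" using cardX by (intro mult_le_mono)
          finally show "card PP \<le> x0 * x0" .
        qed
        have "G2 \<subseteq> (\<Union>p\<in>PP. {g\<in>G. {fst p, snd p} \<subseteq> g})"
        proof
          fix e assume e: "e \<in> G2"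
          then have e2: "e \<in> G" "2 \<le> card (e \<inter> X)" by (auto simp: G2_def)
          from obtain_subset_with_card_n[OF e2(2)] obtain P where P: "P \<subseteq> e \<inter> X" "card P = 2" by metis
          from P(2) obtain u v where uv: "P = {u, v}" "u \<noteq> v" by (meson card_2_iff)
          have "(u, v) \<in> PP" using P(1) uv by (simp add: PP_def)
          moreover have "e \<in> {g\<in>G. {fst (u, v), snd (u, v)} \<subseteq> g}" using P(1) uv e2(1) by simp
          ultimately show "e \<in> (\<Union>p\<in>PP. {g\<in>G. {fst p, snd p} \<subseteq> g})" by (rule UN_I)
        qed
        then have "card G2 \<le> card (\<Union>p\<in>PP. {g\<in>G. {fst p, snd p} \<subseteq> g})"
          using PP finG by (intro card_mono) auto
        also have "\<dots> \<le> (\<Sum>p\<in>PP. codeg G {fst p, snd p})" by (rule card_UN_le[OF PP(1)])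
        finally have "real (card G2) \<le> (\<Sum>p\<in>PP. real (codeg G {fst p, snd p}))"
          by (simp only: of_nat_sum[symmetric] of_nat_le_iff)
        also have "\<dots> \<le> (\<Sum>p\<in>PP. real n ^ (k - 2))"
        proof (rule sum_mono)
          fix p assume "p \<in> PP"
          then have "card {fst p, snd p} = 2" by (auto simp: PP_def)
          then show "real (codeg G {fst p, snd p}) \<le> real n ^ (k - 2)"
            using card_supersets_le[of G n k "{fst p, snd p}"] Gk by auto
        qed
        also have "\<dots> = real (card PP) * real n ^ (k - 2)" by simp
        also have "\<dots> \<le> real (x0 * x0) * real n ^ (k - 2)"
          using PP(2) by (intro mult_right_mono) (auto simp del: of_nat_mult)
        also have "\<dots> \<le> (\<epsilon> / 4 * \<kappa> * real n) * real n ^ (k - 2)"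
        proof (rule mult_right_mono)
          have "0 < \<epsilon> / 4 * \<kappa>" using \<epsilon> \<kappa> by simp
          then show "real (x0 * x0) \<le> \<epsilon> / 4 * \<kappa> * real n"
            using nn(5) by (simp only: pos_divide_le_eq mult.commute)
        qed simp
        also have "\<dots> = \<epsilon> / 4 * (\<kappa> * real n ^ (k - 1))"
        proof -
          have "k - 1 = Suc (k - 2)" using k by simp
          then show ?thesis by simp
        qed
        also have "\<dots> \<le> \<epsilon> / 4 * b" using b \<epsilon> by (intro mult_left_mono) auto
        finally show ?thesis .
      qed
      \<comment> \<open>The surplus \<open>\<epsilon>\<close> is spent as
        \<open>\<epsilon> / 2\<close> on edges avoiding \<open>X\<close> and
        \<open>\<epsilon> / 4\<close> on edges with two vertices in \<open>X\<close>, of which there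
        are only order \<open>n ^ (k - 2)\<close>.\<close>
      ultimately have "(real \<sigma> - 1 + \<epsilon> / 4) * b \<le> card G3"
      proof -
        assume "card G \<le> card G1 + card G2 + card G3" and G2: "real (card G2) \<le> \<epsilon> / 4 * b"
        then have "real (card G) \<le> real (card G1) + real (card G2) + real (card G3)" by linarith
        moreover have "(real \<sigma> - 1 + \<epsilon> / 4) * b = (real \<sigma> - 1 + \<epsilon>) * b - 3 / 4 * (\<epsilon> * b)"
          by (simp add: algebra_simps)
        ultimately show ?thesis using False large G2 unfolding b_def[symmetric] by linarith
      qed
      moreover have "G3 \<subseteq> k_subsets k n" "\<And>e. e \<in> G3 \<Longrightarrow> card (e \<inter> X) = 1" using sub G by (auto simp: G3_def)
      moreover have "0 < \<epsilon> / 4" using \<epsilon> by simp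
      ultimately obtain T L where TL: "T \<subseteq> X" "card T = \<sigma>" "L \<subseteq> k_subsets (k - 1) n" "\<forall>D\<in>L. D \<inter> X = {}"
          "\<forall>D\<in>L. \<forall>x\<in>T. insert x D \<in> G3" "\<epsilon> / 4 * b / (real x0 * 2 ^ x0) \<le> card L"
        unfolding b_def using ex_dense_common_link[OF _ _ finX cardX x0(1) \<sigma> _ b(1), of G3 "\<epsilon> / 4"] by metis
      have "\<epsilon>2 * real n ^ (k - 1) = \<epsilon> / 4 * (\<kappa> * real n ^ (k - 1)) / (real x0 * 2 ^ x0)" by (simp add: \<epsilon>2_def)
      also have "\<dots> \<le> \<epsilon> / 4 * b / (real x0 * 2 ^ x0)"
        using b \<epsilon> by (intro divide_right_mono mult_left_mono) auto
      finally have "\<epsilon>2 * real n ^ (k - 1) \<le> card L" using TL(6) by linarith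
      from dense[OF nn(2) TL(3) this] obtain \<mu> where
        \<mu>: "spread_copies HW L (C2 / real n ^ (k - 1)) (C2 / real n ^ (k - 1 - l)) \<mu>" ..
      have "finite T" using TL(1) finX finite_subset by blast
      moreover have "card S = card T" using S(2) TL(2) by simp
      ultimately obtain h where h: "bij_betw h S T" using finite_same_card_bij[OF finS] by meson
      have "spread_copies H G (C2 / real n ^ (k - 1)) (C2 / real n ^ (k - 1 - l))
          (map_pmf (\<lambda>f v. if v \<in> S then h v else f v) \<mu>)"
      proof (rule cone_spread[OF \<mu>[unfolded HW_def] injW _ h])
        show "\<exists>s. E \<inter> S = {s}" if "E \<in> H" for E
          using S1[OF that] by (simp add: card_1_singleton_iff Int_commute)
        show "insert x D \<in> G" if "D \<in> L" "x \<in> T" for D x using TL(5) that sub(3) by blast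
        show "D \<inter> T = {}" if "D \<in> L" for D using TL(1,4) that by blast
      qed
      then have "spread_copies H G (C / real n ^ (k - 1)) (C / real n ^ (k - 1 - l))
          (map_pmf (\<lambda>f v. if v \<in> S then h v else f v) \<mu>)"
        using C_ge C2 npos by (elim spread_copies_mono) (auto intro: less_imp_le)
      then show ?thesis ..
    qed
  qed
  show ?thesis
  proof (rule exI[of _ C], rule exI[of _ "max (max n1 n2) n3"], intro conjI allI impI Cpos)
    fix n G assume "max (max n1 n2) n3 \<le> n" "G \<subseteq> k_subsets k n"
      "(real (cross_cut_number H) - 1 + \<epsilon>) * real (n choose (k - 1)) \<le> card G"
      "card G \<le> C0 * real n ^ (k - 1)"
    then show "\<exists>\<mu>. spread_copies H G (C / real n ^ (k - 1)) (C / real n ^ (k - 1 - l)) \<mu>"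
      by (intro main) (simp_all add: \<sigma>_def)
  qed
qed

section \<open>Containers for graphs without a copy of the tree\<close>

text \<open>A ratio of binomials is at most \<open>(s / N) ^ j\<close>, here cleared of
  denominators: each further element contributes a factor
  \<open>(s - j) / (N - j) \<le> s / N\<close>.\<close>

lemma binomial_sample_le:
  assumes "s \<le> N" "j \<le> s"
  shows "N ^ j * ((N - j) choose (s - j)) \<le> s ^ j * (N choose s)"
  using assms(2)
proof (induction j)
  case (Suc j)
  have pos: "0 < N - j" "0 < s - j" using Suc.prems assms(1) by auto
  have "(N - j) * ((N - Suc j) choose (s - Suc j)) = (s - j) * ((N - j) choose (s - j))"
    using times_binomial_minus1_eq[OF pos(2), of "N - j"] by (simp add: Suc_diff_Suc)
  then have "(N - j) * (N * ((N - Suc j) choose (s - Suc j))) = N * (s - j) * ((N - j) choose (s - j))"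
    by (simp add: mult.left_commute mult.assoc)
  also have "\<dots> \<le> s * (N - j) * ((N - j) choose (s - j))"
  proof (rule mult_le_mono1)
    have "s * j \<le> N * j" using assms(1) by simp
    then show "N * (s - j) \<le> s * (N - j)"
      by (simp add: diff_mult_distrib2 mult.commute diff_le_mono2)
  qed
  finally have "(N - j) * (N * ((N - Suc j) choose (s - Suc j))) \<le> (N - j) * (s * ((N - j) choose (s - j)))"
    by (simp add: mult_ac)
  then have "N * ((N - Suc j) choose (s - Suc j)) \<le> s * ((N - j) choose (s - j))"
    using pos(1) by simp
  then have "N ^ Suc j * ((N - Suc j) choose (s - Suc j)) \<le> N ^ j * (s * ((N - j) choose (s - j)))"
    by (simp add: mult.assoc mult.left_commute)
  also have "\<dots> \<le> s * (s ^ j * (N choose s))" using Suc by (simp add: mult.left_commute)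
  finally show ?case by (simp add: mult.assoc)
qed simp

lemma prob_random_subset_le:
  assumes G: "finite G" "s \<le> card G" "0 < card G" and Q: "Q \<subseteq> G"
  shows "measure_pmf.prob (pmf_of_set {R. R \<subseteq> G \<and> card R = s}) {R. Q \<subseteq> R} \<le> (real s / real (card G)) ^ card Q"
proof -
  define N where "N = card G"
  define RR where "RR = {R. R \<subseteq> G \<and> card R = s}"
  have finRR: "finite RR" using G by (simp add: RR_def)
  have cardRR: "card RR = N choose s" using n_subsets[OF G(1)] by (simp add: RR_def N_def)
  have pos: "0 < N choose s" using G by (simp add: N_def)
  then have ne: "RR \<noteq> {}" using cardRR by auto
  have finQ: "finite Q" using Q G finite_subset by blast
  have eq: "measure_pmf.prob (pmf_of_set RR) {R. Q \<subseteq> R} = card (RR \<inter> {R. Q \<subseteq> R}) / (N choose s)"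
    using ne finRR cardRR by (simp add: measure_pmf_of_set)
  show ?thesis
  proof (cases "card Q \<le> s")
    case True
    have "inj_on (\<lambda>R. R - Q) (RR \<inter> {R. Q \<subseteq> R})" by (auto simp: inj_on_def)
    then have "card (RR \<inter> {R. Q \<subseteq> R}) = card ((\<lambda>R. R - Q) ` (RR \<inter> {R. Q \<subseteq> R}))" by (simp add: card_image)
    also have "\<dots> \<le> card {T. T \<subseteq> G - Q \<and> card T = s - card Q}"
      using G finQ by (intro card_mono) (auto simp: RR_def card_Diff_subset)
    also have "\<dots> = (N - card Q) choose (s - card Q)"
      using n_subsets[of "G - Q" "s - card Q"] G Q finQ by (simp add: N_def card_Diff_subset)
    finally have "N ^ card Q * card (RR \<inter> {R. Q \<subseteq> R}) \<le> N ^ card Q * ((N - card Q) choose (s - card Q))"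
      by simp
    also have "\<dots> \<le> s ^ card Q * (N choose s)"
      using binomial_sample_le[OF _ True] G(2) by (simp add: N_def)
    finally have "real (N ^ card Q * card (RR \<inter> {R. Q \<subseteq> R})) \<le> real (s ^ card Q * (N choose s))"
      by (simp only: of_nat_le_iff)
    moreover have "0 < real N ^ card Q" using G by (simp add: N_def)
    ultimately have "card (RR \<inter> {R. Q \<subseteq> R}) / (N choose s) \<le> real s ^ card Q / real N ^ card Q"
      using pos by (simp add: field_simps)
    then show ?thesis using eq by (simp add: RR_def N_def power_divide)
  next
    case False
    have "RR \<inter> {R. Q \<subseteq> R} = {}"
    proof (rule ccontr)
      assume "RR \<inter> {R. Q \<subseteq> R} \<noteq> {}"
      then obtain R where "R \<subseteq> G" "card R = s" "Q \<subseteq> R" by (auto simp: RR_def)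
      then have "card Q \<le> s" using card_mono[of R Q] G finite_subset by metis
      then show False using False by simp
    qed
    then show ?thesis using eq by (simp add: RR_def)
  qed
qed

text \<open>A copy found inside the random sample uses only sampled edges, so each prescribed edge
  contributes a factor \<open>s / card G\<close>: one goes to \<open>\<alpha>\<close>, the others to
  \<open>\<beta>\<close>. A prescription that repeats an edge or leaves \<open>G\<close> has
  probability 0, so the edges may be taken to be distinct.\<close>

lemma sample_spread:
  assumes G: "finite G" "s \<le> card G" "0 < card G" and H: "finite H"
    and sp: "\<And>R. R \<subseteq> G \<Longrightarrow> card R = s \<Longrightarrow> \<exists>\<mu>. spread_copies H R \<alpha> \<beta> \<mu>" and \<alpha>\<beta>: "0 \<le> \<alpha>" "0 \<le> \<beta>"
  shows "\<exists>\<mu>. spread_copies H G (real s / real (card G) * \<alpha>) (real s / real (card G) * \<beta>) \<mu>"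
proof -
  define RR where "RR = {R. R \<subseteq> G \<and> card R = s}"
  have finRR: "finite RR" using G by (simp add: RR_def)
  have "card RR = card G choose s" using n_subsets[OF G(1)] by (simp add: RR_def)
  moreover have "0 < card G choose s" using G by simp
  ultimately have ne: "RR \<noteq> {}" by auto
  have "\<forall>R\<in>RR. \<exists>\<mu>. spread_copies H R \<alpha> \<beta> \<mu>" using sp by (simp add: RR_def)
  from bchoice[OF this] obtain M where "\<forall>R\<in>RR. spread_copies H R \<alpha> \<beta> (M R)" ..
  note M = bspec[OF this]
  define \<mu> where "\<mu> = bind_pmf (pmf_of_set RR) M"
  have setRR: "set_pmf (pmf_of_set RR) = RR" using ne finRR by (rule set_pmf_of_set)
  let ?r = "real s / real (card G)"
  have "measure_pmf.prob \<mu> {f. \<forall>E\<in>H'. f ` E = \<gamma> E} \<le> (?r * \<alpha>) * (?r * \<beta>) ^ (card H' - 1)"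
    if H': "H' \<subseteq> H" "H' \<noteq> {}" for H' \<gamma>
  proof -
    define Q where "Q = \<gamma> ` H'"
    have finH': "finite H'" using H' H finite_subset by blast
    have rn: "0 \<le> (?r * \<alpha>) * (?r * \<beta>) ^ (card H' - 1)" using \<alpha>\<beta> by simp
    have zero: "measure_pmf.prob (M R) {f. \<forall>E\<in>H'. f ` E = \<gamma> E} = 0"
      if R: "R \<in> RR" and bad: "\<not> (inj_on \<gamma> H' \<and> Q \<subseteq> R)" for R
    proof -
      have "f \<notin> {f. \<forall>E\<in>H'. f ` E = \<gamma> E}" if f: "f \<in> set_pmf (M R)" for f
      proof
        assume "f \<in> {f. \<forall>E\<in>H'. f ` E = \<gamma> E}"
        then have fg: "\<And>E. E \<in> H' \<Longrightarrow> f ` E = \<gamma> E" by simp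
        have "inj_on ((`) f) H" by (rule inj_on_image_edges[OF spread_copiesD(1)[OF M[OF R] f]])
        then have "inj_on ((`) f) H'" using H' inj_on_subset by blast
        then have "inj_on \<gamma> H'" using fg by (simp add: inj_on_def)
        moreover have "Q \<subseteq> R" unfolding Q_def
          using spread_copiesD(2)[OF M[OF R] f] fg H' by fastforce
        ultimately show False using bad by blast
      qed
      then have "set_pmf (M R) \<inter> {f. \<forall>E\<in>H'. f ` E = \<gamma> E} = {}" by blast
      then show ?thesis by (simp only: measure_pmf_zero_iff)
    qed
    show ?thesis
    proof (cases "inj_on \<gamma> H' \<and> Q \<subseteq> G")
      case True
      have "measure_pmf.prob \<mu> {f. \<forall>E\<in>H'. f ` E = \<gamma> E} \<le>
          (\<Sum>i\<in>{()}. (\<alpha> * \<beta> ^ (card H' - 1)) * measure_pmf.prob (pmf_of_set RR) {R. Q \<subseteq> R})"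
        unfolding \<mu>_def
      proof (rule prob_bind_pmf_le)
        fix R assume "R \<in> set_pmf (pmf_of_set RR)"
        then have R: "R \<in> RR" by (simp add: setRR)
        show "measure_pmf.prob (M R) {f. \<forall>E\<in>H'. f ` E = \<gamma> E}
            \<le> (\<Sum>i\<in>{()}. (\<alpha> * \<beta> ^ (card H' - 1)) * indicator {R. Q \<subseteq> R} R)"
        proof (cases "Q \<subseteq> R")
          case True
          then show ?thesis using spread_copiesD(3)[OF M[OF R] H'] by simp
        next
          case False
          then show ?thesis using zero[OF R] by simp
        qed
      qed simp
      also have "\<dots> \<le> (\<alpha> * \<beta> ^ (card H' - 1)) * ?r ^ card Q"
        using prob_random_subset_le[OF G, of Q] True \<alpha>\<beta> by (auto simp: RR_def intro!: mult_left_mono)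
      also have "card Q = Suc (card H' - 1)"
        using True finH' H'(2) by (simp add: Q_def card_image Suc_diff_Suc card_gt_0_iff)
      also have "(\<alpha> * \<beta> ^ (card H' - 1)) * ?r ^ Suc (card H' - 1) = (?r * \<alpha>) * (?r * \<beta>) ^ (card H' - 1)"
        unfolding power_Suc power_mult_distrib by (simp only: mult_ac)
      finally show ?thesis .
    next
      case False
      have "measure_pmf.prob \<mu> {f. \<forall>E\<in>H'. f ` E = \<gamma> E} \<le>
          (\<Sum>i\<in>{()}. 0 * measure_pmf.prob (pmf_of_set RR) UNIV)"
        unfolding \<mu>_def
      proof (rule prob_bind_pmf_le)
        fix R assume "R \<in> set_pmf (pmf_of_set RR)"
        then have R: "R \<in> RR" by (simp add: setRR)
        then have "\<not> (inj_on \<gamma> H' \<and> Q \<subseteq> R)" using False by (auto simp: RR_def)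
        from zero[OF R this] show "measure_pmf.prob (M R) {f. \<forall>E\<in>H'. f ` E = \<gamma> E}
            \<le> (\<Sum>i\<in>{()}. 0 * indicator UNIV R)" by simp
      qed simp
      then show ?thesis using rn by simp
    qed
  qed
  moreover have "inj_on f (\<Union>H) \<and> (\<forall>E\<in>H. f ` E \<in> G)" if f: "f \<in> set_pmf \<mu>" for f
  proof -
    obtain R where R: "R \<in> RR" "f \<in> set_pmf (M R)" using f by (auto simp: \<mu>_def setRR)
    then show ?thesis using spread_copiesD(1,2)[OF M[OF R(1)] R(2)] by (auto simp: RR_def)
  qed
  ultimately have "spread_copies H G (?r * \<alpha>) (?r * \<beta>) \<mu>"
    unfolding spread_copies_def by blast
  then show ?thesis ..
qed

text \<open>Translates spread into the degree condition of the container lemma, whose vertices are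
  the edges of \<open>G\<close>. A set \<open>J\<close> lies in the random copy only if
  \<open>card J\<close> edges of \<open>H\<close> are mapped onto it: at most \<open>2 ^ t\<close>
  choices of these edges and \<open>t ^ t\<close> assignments.\<close>

lemma spread_copies_weight:
  assumes sp: "spread_copies H G \<alpha> \<beta> \<mu>" and fin: "finite G" "finite H" and \<alpha>\<beta>: "0 \<le> \<alpha>" "0 \<le> \<beta>"
  defines "w \<equiv> pmf (map_pmf (\<lambda>f. (`) f ` H) \<mu>)" and "t \<equiv> card H"
  shows "weighted_on G t w" "wdeg G w {} = 1"
    and "\<And>F. F \<subseteq> G \<Longrightarrow> \<not> contains_copy F H \<Longrightarrow> independent_of w F"
    and "\<And>J. J \<noteq> {} \<Longrightarrow> J \<subseteq> G \<Longrightarrow>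
      wdeg G w J \<le> (if card J \<le> t then 2 ^ t * real t ^ t * (\<alpha> * \<beta> ^ (card J - 1)) else 0)"
proof -
  have supp: "\<exists>f\<in>set_pmf \<mu>. e = (`) f ` H" if "w e \<noteq> 0" for e
    using that unfolding w_def by (auto simp: pmf_eq_0_set_pmf)
  have injf: "inj_on ((`) f) H" if "f \<in> set_pmf \<mu>" for f
    by (rule inj_on_image_edges[OF spread_copiesD(1)[OF sp that]])
  show w_on: "weighted_on G t w"
    unfolding weighted_on_def
  proof (intro conjI allI impI)
    show "0 \<le> w e" for e by (simp add: w_def)
    fix e assume "w e \<noteq> 0"
    from supp[OF this] obtain f where f: "f \<in> set_pmf \<mu>" "e = (`) f ` H" by (rule bexE)
    show "e \<subseteq> G" using spread_copiesD(2)[OF sp f(1)] f(2) by blast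
    show "card e = t" unfolding f(2) t_def by (rule card_image[OF injf[OF f(1)]])
  qed
  have meas: "wdeg G w J = measure_pmf.prob \<mu> {f. (`) f ` H \<subseteq> G \<and> J \<subseteq> (`) f ` H}" for J
  proof -
    have "finite {e. e \<subseteq> G \<and> J \<subseteq> e}" using fin by simp
    then have "wdeg G w J = measure_pmf.prob (map_pmf (\<lambda>f. (`) f ` H) \<mu>) {e. e \<subseteq> G \<and> J \<subseteq> e}"
      unfolding wdeg_def w_def by (rule measure_measure_pmf_finite[symmetric])
    also have "\<dots> = measure_pmf.prob \<mu> {f. (`) f ` H \<subseteq> G \<and> J \<subseteq> (`) f ` H}"
      by (simp add: vimage_def)
    finally show ?thesis .
  qed
  show "wdeg G w {} = 1"
  proof -
    have "AE f in measure_pmf \<mu>. f \<in> {f. (`) f ` H \<subseteq> G \<and> {} \<subseteq> (`) f ` H}"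
      unfolding AE_measure_pmf_iff using spread_copiesD(2)[OF sp] by blast
    then show ?thesis unfolding meas by (subst measure_pmf.prob_eq_1) auto
  qed
  show "independent_of w F" if "F \<subseteq> G" "\<not> contains_copy F H" for F
    unfolding independent_of_def
  proof (intro allI impI notI)
    fix e assume "w e \<noteq> 0" "e \<subseteq> F"
    from supp[OF this(1)] obtain f where f: "f \<in> set_pmf \<mu>" "e = (`) f ` H" by (rule bexE)
    have "contains_copy F H" unfolding contains_copy_def
      using spread_copiesD(1)[OF sp f(1)] \<open>e \<subseteq> F\<close> unfolding f(2) by (intro exI[of _ f]) blast
    then show False using that(2) by blast
  qed
  show "wdeg G w J \<le> (if card J \<le> t then 2 ^ t * real t ^ t * (\<alpha> * \<beta> ^ (card J - 1)) else 0)"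
    if J: "J \<noteq> {}" "J \<subseteq> G" for J
  proof -
    have finJ: "finite J" using J fin finite_subset by blast
    \<comment> \<open>Index set of the union bound: a part of \<open>H\<close> with its prescribed
      images. Extensional functions keep it finite.\<close>
    define I where "I = (SIGMA H':{H'. H' \<subseteq> H \<and> card H' = card J}. H' \<rightarrow>\<^sub>E J)"
    have finI: "finite I" unfolding I_def using fin finJ
      by (intro finite_SigmaI finite_PiE) (auto intro: finite_subset)
    have "wdeg G w J \<le> (\<Sum>i\<in>I. measure_pmf.prob \<mu> {f. \<forall>E\<in>fst i. f ` E = snd i E})"
      unfolding meas
    proof (rule prob_pmf_le_sum[OF finI])
      fix f assume f: "f \<in> set_pmf \<mu>" "f \<in> {f. (`) f ` H \<subseteq> G \<and> J \<subseteq> (`) f ` H}"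
      define H' where "H' = {E\<in>H. f ` E \<in> J}"
      have "(`) f ` H' = J" using f(2) by (auto simp: H'_def)
      moreover have "inj_on ((`) f) H'" using injf[OF f(1)] by (rule inj_on_subset) (auto simp: H'_def)
      ultimately have "card H' = card J" by (metis card_image)
      then have "(H', restrict ((`) f) H') \<in> I" by (auto simp: I_def H'_def)
      then show "\<exists>i\<in>I. f \<in> {f. \<forall>E\<in>fst i. f ` E = snd i E}"
        by (rule bexI[rotated]) simp
    qed
    also have "\<dots> \<le> (\<Sum>i\<in>I. \<alpha> * \<beta> ^ (card J - 1))"
    proof (rule sum_mono)
      fix i assume "i \<in> I"
      then have i: "fst i \<subseteq> H" "card (fst i) = card J" by (auto simp: I_def)
      have "fst i \<noteq> {}" using i(2) J(1) finJ by auto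
      from spread_copiesD(3)[OF sp i(1) this, of "snd i"]
      show "measure_pmf.prob \<mu> {f. \<forall>E\<in>fst i. f ` E = snd i E} \<le> \<alpha> * \<beta> ^ (card J - 1)"
        using i(2) by simp
    qed
    also have "\<dots> = card I * (\<alpha> * \<beta> ^ (card J - 1))" by simp
    also have "\<dots> \<le> (if card J \<le> t then 2 ^ t * real t ^ t * (\<alpha> * \<beta> ^ (card J - 1)) else 0)"
    proof (cases "card J \<le> t")
      case True
      have "card I = (\<Sum>H' | H' \<subseteq> H \<and> card H' = card J. card (H' \<rightarrow>\<^sub>E J))"
        unfolding I_def using fin finJ by (intro card_SigmaI) (auto intro!: finite_PiE intro: finite_subset)
      also have "\<dots> \<le> (\<Sum>H' | H' \<subseteq> H \<and> card H' = card J. t ^ t)"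
      proof (rule sum_mono)
        fix H' assume H': "H' \<in> {H'. H' \<subseteq> H \<and> card H' = card J}"
        have "finite H'" using H' fin finite_subset by blast
        then have "card (H' \<rightarrow>\<^sub>E J) = card J ^ card J" using H' by (simp add: card_PiE)
        also have "\<dots> \<le> t ^ card J" using True by (intro power_mono) auto
        also have "\<dots> \<le> t ^ t"
        proof (rule power_increasing[OF True])
          have "0 < card J" using J(1) finJ by (simp add: card_gt_0_iff)
          then show "1 \<le> t" using True by simp
        qed
        finally show "card (H' \<rightarrow>\<^sub>E J) \<le> t ^ t" .
      qed
      also have "\<dots> = card {H'. H' \<subseteq> H \<and> card H' = card J} * t ^ t" by simp
      also have "\<dots> \<le> 2 ^ t * t ^ t"
      proof (rule mult_le_mono1)
        have "card {H'. H' \<subseteq> H \<and> card H' = card J} \<le> card (Pow H)" using fin by (intro card_mono) auto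
        then show "card {H'. H' \<subseteq> H \<and> card H' = card J} \<le> 2 ^ t" using fin by (simp add: card_Pow t_def)
      qed
      finally have "real (card I) \<le> real (2 ^ t * t ^ t)" by (simp only: of_nat_le_iff)
      then have "real (card I) \<le> 2 ^ t * real t ^ t" by simp
      then show ?thesis using True \<alpha>\<beta> by (simp add: mult_right_mono)
    next
      case False
      have "I = {}"
      proof (rule ccontr)
        assume "I \<noteq> {}"
        then obtain H' where "H' \<subseteq> H" "card H' = card J" by (auto simp: I_def)
        then show False using False card_mono[OF fin(2)] unfolding t_def by metis
      qed
      then show ?thesis using False by simp
    qed
    finally show ?thesis .
  qed
qed

section \<open>One container step and its iteration\<close>

lemma cross_cut_number_pos:
  assumes "k_tree k H" "two_contractible H"
  shows "1 \<le> cross_cut_number H"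
proof -
  have finH: "finite H" and HE: "\<And>E. E \<in> H \<Longrightarrow> finite E" and ne: "H \<noteq> {}"
    using assms hypertree_finite by (auto simp: k_tree_def uniform_def)
  obtain S where S: "cross_cut H S" "card S = cross_cut_number H"
    using cross_cut_min(1)[OF finH HE assms(2)] by blast
  obtain E where "E \<in> H" using ne by blast
  then have "card (S \<inter> E) = 1" using S(1) by (simp add: cross_cut_def)
  then have "S \<noteq> {}" by auto
  moreover have "finite S" using S(1) finH HE by (auto simp: cross_cut_def intro: finite_subset)
  ultimately have "0 < card S" by (simp add: card_gt_0_iff)
  then show ?thesis using S(2) by simp
qed

lemma k_subsets_finite: "finite (k_subsets k n)" and card_k_subsets: "card (k_subsets k n) = n choose k"
  using n_subsets[of "{1..n}" k] by (auto simp: k_subsets_def)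

text \<open>Sampling \<open>G\<close> down to order \<open>n ^ (k - 1)\<close> edges, applying
  supersaturation there and averaging back gives \<open>\<alpha>\<close> of order
  \<open>1 / card G\<close> and \<open>\<beta>\<close> of order
  \<open>\<tau> = n ^ l / card G\<close>. The product \<open>\<tau> * card G\<close> is
  \<open>n ^ l\<close> for every \<open>G\<close>, so all steps of the iteration have the same
  cost.\<close>

lemma container_step:
  fixes H :: "'a set set" and \<epsilon> :: real
  assumes k: "2 \<le> k" "l \<le> k - 2" and H: "k_tree k H" "two_contractible H" "overlapping l H"
    and \<epsilon>: "0 < \<epsilon>"
  shows "\<exists>A \<delta> n0. 0 < A \<and> 0 < \<delta> \<and> \<delta> \<le> 1 \<and> (\<forall>n\<ge>n0. \<forall>G\<subseteq>k_subsets k n.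
    (real (cross_cut_number H) - 1 + \<epsilon>) * real (n choose (k - 1)) < real (card G) \<longrightarrow>
    (\<exists>CC. finite CC \<and> real (card CC) \<le> exp (A * real n ^ l * ln (real n)) \<and>
      (\<forall>C\<in>CC. C \<subseteq> G \<and> real (card C) \<le> (1 - \<delta>) * real (card G)) \<and>
      (\<forall>F. F \<subseteq> G \<and> \<not> contains_copy F H \<longrightarrow> (\<exists>C\<in>CC. F \<subseteq> C))))"
proof -
  define \<sigma> where "\<sigma> = cross_cut_number H"
  have \<sigma>: "1 \<le> \<sigma>" unfolding \<sigma>_def by (rule cross_cut_number_pos[OF H(1,2)])
  have finH: "finite H" and ne: "H \<noteq> {}" using H hypertree_finite by (auto simp: k_tree_def)
  define t where "t = card H"
  have t: "Suc (t - 1) = t" using finH ne by (simp add: t_def Suc_diff_Suc card_gt_0_iff)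
  \<comment> \<open>The summand 1 absorbs the rounding in the sample size \<open>s\<close>.\<close>
  define C0 where "C0 = real \<sigma> + \<epsilon> + 1"
  have C0: "0 < C0" using \<epsilon> by (simp add: C0_def)
  obtain C n1 where *: "0 < C \<and> (\<forall>n\<ge>n1. \<forall>G\<subseteq>k_subsets k n.
    (real (cross_cut_number H) - 1 + \<epsilon>) * real (n choose (k - 1)) \<le> card G \<longrightarrow>
    card G \<le> C0 * real n ^ (k - 1) \<longrightarrow>
    (\<exists>\<mu>. spread_copies H G (C / real n ^ (k - 1)) (C / real n ^ (k - 1 - l)) \<mu>))"
    using supersaturation[OF k H \<epsilon> C0] by (elim exE) (rule that)
  have C: "0 < C" using * by simp
  note sat = *[THEN conjunct2, rule_format, folded \<sigma>_def]
  define D where "D = max 1 (C0 * C)"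
  have D: "1 \<le> D" "C0 * C \<le> D" by (auto simp: D_def)
  \<comment> \<open>The combinatorial factor comes from the passage to weights; \<open>D ^ t\<close>
    bounds the powers of \<open>D\<close> collected by \<open>\<alpha>\<close> and
    \<open>\<beta>\<close>.\<close>
  define K where "K = 2 ^ t * real t ^ t * D ^ t"
  have Kpos: "0 < K" using t D by (auto simp: K_def)
  obtain A0 \<delta>0 \<tau>0 :: real where *: "0 < A0 \<and> 0 < \<delta>0 \<and> 0 < \<tau>0 \<and> (\<forall>(V :: nat set set) w (\<tau> :: real).
    finite V \<and> V \<noteq> {} \<and> weighted_on V (Suc (t - 1)) w \<and> 0 < \<tau> \<and> \<tau> \<le> \<tau>0 \<and> 1 \<le> wdeg V w {} \<and>
    (\<forall>J. J \<noteq> {} \<and> J \<subseteq> V \<longrightarrow> wdeg V w J \<le> K * \<tau> ^ (card J - 1) / real (card V)) \<longrightarrow>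
    (\<exists>CC. finite CC \<and> real (card CC) \<le> (real (card V) + 1) powr (A0 * \<tau> * real (card V)) \<and>
      (\<forall>C\<in>CC. C \<subseteq> V \<and> real (card C) \<le> (1 - \<delta>0) * real (card V)) \<and>
      (\<forall>I. I \<subseteq> V \<and> independent_of w I \<longrightarrow> (\<exists>C\<in>CC. I \<subseteq> C))))"
    using container_lemma[OF Kpos zero_less_one, where s = "t - 1" and 'v = "nat set"] by (elim exE) (rule that)
  have pos: "0 < A0" "0 < \<delta>0" "0 < \<tau>0" using * by simp_all
  note cont = *[THEN conjunct2, THEN conjunct2, THEN conjunct2, unfolded t, THEN spec, THEN spec, THEN spec, THEN mp]
  define \<kappa> where "\<kappa> = 1 / real (k - 1) ^ (k - 1)"
  have \<kappa>: "0 < \<kappa>" using k by (simp add: \<kappa>_def)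
  define \<delta> where "\<delta> = min \<delta>0 1"
  define n0 where "n0 = max (max n1 (k + 2)) (nat \<lceil>1 / (\<epsilon> * \<kappa> * \<tau>0)\<rceil>)"
  have main: "\<exists>CC. finite CC \<and> real (card CC) \<le> exp (A0 * real (k + 1) * real n ^ l * ln (real n)) \<and>
      (\<forall>C\<in>CC. C \<subseteq> G \<and> real (card C) \<le> (1 - \<delta>) * real (card G)) \<and>
      (\<forall>F. F \<subseteq> G \<and> \<not> contains_copy F H \<longrightarrow> (\<exists>C\<in>CC. F \<subseteq> C))"
    if n: "n0 \<le> n" and G: "G \<subseteq> k_subsets k n"
      and large: "(real \<sigma> - 1 + \<epsilon>) * real (n choose (k - 1)) < real (card G)" for n G
  proof -
    define b where "b = real (n choose (k - 1))"
    define N where "N = real (card G)"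
    have nn: "n1 \<le> n" "k \<le> n" "2 \<le> n" using n by (auto simp: n0_def)
    have nt: "1 / (\<epsilon> * \<kappa> * \<tau>0) \<le> real n"
    proof -
      have "nat \<lceil>1 / (\<epsilon> * \<kappa> * \<tau>0)\<rceil> \<le> n" using n by (simp add: n0_def)
      then show ?thesis by linarith
    qed
    have npos: "0 < real n ^ j" for j using nn by simp
    have b: "\<kappa> * real n ^ (k - 1) \<le> b" "b \<le> real n ^ (k - 1)"
      using binomial_ge_power[of "k - 1" n] binomial_le_power[of n "k - 1"] k nn by (auto simp: \<kappa>_def b_def)
    have finG: "finite G" using G k_subsets_finite finite_subset by blast
    have "\<epsilon> * (\<kappa> * real n ^ (k - 1)) \<le> (real \<sigma> - 1 + \<epsilon>) * b"
      using b \<epsilon> \<sigma> \<kappa> by (intro mult_mono) auto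
    then have Nl: "\<epsilon> * \<kappa> * real n ^ (k - 1) \<le> N" using large by (simp add: b_def N_def)
    have "0 < \<epsilon> * \<kappa> * real n ^ (k - 1)" using \<epsilon> \<kappa> npos by (intro mult_pos_pos)
    then have Npos: "0 < N" using Nl by linarith
    define s where "s = nat \<lceil>(real \<sigma> - 1 + \<epsilon>) * b\<rceil>"
    have nonneg: "0 \<le> (real \<sigma> - 1 + \<epsilon>) * b" using \<sigma> \<epsilon> by (simp add: b_def)
    have s: "(real \<sigma> - 1 + \<epsilon>) * b \<le> real s" "real s \<le> (real \<sigma> - 1 + \<epsilon>) * b + 1"
      using nonneg unfolding s_def by linarith+
    have "real s < N + 1" using s(2) large by (simp add: b_def N_def)
    then have sN: "s \<le> card G" by (simp add: N_def)
    have sC: "real s \<le> C0 * real n ^ (k - 1)"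
    proof -
      have "(real \<sigma> - 1 + \<epsilon>) * b \<le> (real \<sigma> + \<epsilon>) * real n ^ (k - 1)"
        using b \<epsilon> by (intro mult_mono) (auto simp: b_def)
      moreover have "1 \<le> real n ^ (k - 1)" using nn by simp
      ultimately show ?thesis using s(2) by (simp add: C0_def algebra_simps)
    qed
    have "\<exists>\<mu>. spread_copies H G (real s / real (card G) * (C / real n ^ (k - 1)))
        (real s / real (card G) * (C / real n ^ (k - 1 - l))) \<mu>"
    proof (rule sample_spread[OF finG sN _ finH])
      show "0 < card G" using Npos by (simp add: N_def)
      show "0 \<le> C / real n ^ (k - 1)" "0 \<le> C / real n ^ (k - 1 - l)" using C by auto
      fix R assume R: "R \<subseteq> G" "card R = s"
      show "\<exists>\<mu>. spread_copies H R (C / real n ^ (k - 1)) (C / real n ^ (k - 1 - l)) \<mu>"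
        using R G s(1) sC by (intro sat[OF nn(1)]) (auto simp: b_def)
    qed
    then obtain \<mu> where \<mu>: "spread_copies H G (real s / N * (C / real n ^ (k - 1)))
        (real s / N * (C / real n ^ (k - 1 - l))) \<mu>" unfolding N_def ..
    define \<tau> where "\<tau> = real n ^ l / N"
    have \<tau>: "0 < \<tau>" using nn Npos by (simp add: \<tau>_def)
    have sp: "spread_copies H G (D / N) (D * \<tau>) \<mu>"
    proof (rule spread_copies_mono[OF \<mu> order.refl])
      have "real s * C \<le> (C0 * real n ^ (k - 1)) * C" using sC C by (intro mult_right_mono) auto
      also have "\<dots> = (C0 * C) * real n ^ (k - 1)" by simp
      also have "\<dots> \<le> D * real n ^ (k - 1)" using D by (intro mult_right_mono) auto
      finally have sD: "real s * C \<le> D * real n ^ (k - 1)" .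
      then show "real s / N * (C / real n ^ (k - 1)) \<le> D / N"
        using nn Npos by (simp add: field_simps)
      have "real n ^ (k - 1) = real n ^ l * real n ^ (k - 1 - l)"
        using k by (simp add: power_add[symmetric])
      then show "real s / N * (C / real n ^ (k - 1 - l)) \<le> D * \<tau>"
        using nn Npos sD by (simp add: field_simps \<tau>_def)
    qed (use C Npos in auto)
    define w where "w = pmf (map_pmf (\<lambda>f. (`) f ` H) \<mu>)"
    have D\<tau>: "0 \<le> D / N" "0 \<le> D * \<tau>" using D \<tau> Npos by auto
    note W = spread_copies_weight[OF sp finG finH D\<tau>, folded w_def t_def]
    have wd: "wdeg G w J \<le> K * \<tau> ^ (card J - 1) / real (card G)" if J: "J \<noteq> {}" "J \<subseteq> G" for J
    proof (cases "card J \<le> t")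
      case True
      have "finite J" using J finG finite_subset by blast
      then have cJ: "0 < card J" using J by (simp add: card_gt_0_iff)
      have "wdeg G w J \<le> 2 ^ t * real t ^ t * (D / N * (D * \<tau>) ^ (card J - 1))"
        using W(4)[OF J] True by simp
      also have "\<dots> = 2 ^ t * real t ^ t * D ^ card J * (\<tau> ^ (card J - 1) / N)"
        using cJ by (simp add: power_mult_distrib power_eq_if[of D "card J"])
      also have "\<dots> \<le> K * (\<tau> ^ (card J - 1) / N)"
        unfolding K_def using D True \<tau> Npos by (intro mult_right_mono mult_left_mono power_increasing) auto
      finally show ?thesis by (simp add: N_def)
    next
      case False
      then have "wdeg G w J \<le> 0" using W(4)[OF J] by simp
      also have "0 \<le> K * \<tau> ^ (card J - 1) / real (card G)" using Kpos \<tau> by simp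
      finally show ?thesis .
    qed
    \<comment> \<open>Since \<open>l \<le> k - 2\<close>, the exponent \<open>k - 1\<close> leaves a
      spare factor \<open>n\<close>, so \<open>\<tau>\<close> tends to 0.\<close>
    have \<tau>l: "\<tau> \<le> \<tau>0"
    proof -
      have "real n ^ l * real n \<le> real n ^ (k - 1)"
        unfolding power_Suc2[symmetric] using k nn by (intro power_increasing) auto
      then have "\<epsilon> * \<kappa> * (real n ^ l * real n) \<le> \<epsilon> * \<kappa> * real n ^ (k - 1)"
        using \<epsilon> \<kappa> by (intro mult_left_mono) auto
      then have 1: "\<epsilon> * \<kappa> * (real n ^ l * real n) \<le> N" using Nl by linarith
      have "1 \<le> \<epsilon> * \<kappa> * \<tau>0 * real n" using nt \<epsilon> \<kappa> pos by (simp add: field_simps)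
      then have "real n ^ l * 1 \<le> real n ^ l * (\<epsilon> * \<kappa> * \<tau>0 * real n)"
        by (intro mult_left_mono) auto
      also have "\<dots> = \<tau>0 * (\<epsilon> * \<kappa> * (real n ^ l * real n))" by simp
      also have "\<dots> \<le> \<tau>0 * N" using 1 pos by (intro mult_left_mono) auto
      finally show ?thesis using Npos by (simp add: \<tau>_def field_simps)
    qed
    have "finite G \<and> G \<noteq> {} \<and> weighted_on G t w \<and> 0 < \<tau> \<and> \<tau> \<le> \<tau>0 \<and> 1 \<le> wdeg G w {} \<and>
      (\<forall>J. J \<noteq> {} \<and> J \<subseteq> G \<longrightarrow> wdeg G w J \<le> K * \<tau> ^ (card J - 1) / real (card G))"
      using finG Npos W(1,2) \<tau> \<tau>l wd by (auto simp: N_def)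
    from cont[OF this, folded N_def] obtain CC where CC: "finite CC"
      "real (card CC) \<le> (N + 1) powr (A0 * \<tau> * N)"
      "\<forall>C\<in>CC. C \<subseteq> G \<and> real (card C) \<le> (1 - \<delta>0) * N"
      "\<forall>I. I \<subseteq> G \<and> independent_of w I \<longrightarrow> (\<exists>C\<in>CC. I \<subseteq> C)" by (elim exE conjE) (rule that)
    have "(N + 1) powr (A0 * \<tau> * N) \<le> exp (A0 * real (k + 1) * real n ^ l * ln (real n))"
    proof -
      have "card G \<le> n choose k"
        using card_mono[OF k_subsets_finite G] by (simp add: card_k_subsets)
      then have "N \<le> real n ^ k" using binomial_le_power[of n k] by (simp add: N_def)
      moreover have "1 \<le> real n ^ k" using nn by simp
      moreover have "2 * real n ^ k \<le> real n * real n ^ k" using nn by (intro mult_right_mono) auto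
      ultimately have "N + 1 \<le> real n ^ (k + 1)" by simp
      then have "(N + 1) powr (A0 * \<tau> * N) \<le> (real n ^ (k + 1)) powr (A0 * \<tau> * N)"
        using Npos pos \<tau> by (intro powr_mono2) auto
      also have "\<dots> = exp (A0 * \<tau> * N * (real (k + 1) * ln (real n)))"
        using nn by (simp add: powr_def ln_realpow del: power_Suc)
      also have "A0 * \<tau> * N * (real (k + 1) * ln (real n)) = A0 * real (k + 1) * real n ^ l * ln (real n)"
        using Npos by (simp add: \<tau>_def)
      finally show ?thesis .
    qed
    then have c1: "real (card CC) \<le> exp (A0 * real (k + 1) * real n ^ l * ln (real n))" using CC(2) by linarith
    have "(1 - \<delta>0) * N \<le> (1 - \<delta>) * N" using Npos by (intro mult_right_mono) (auto simp: \<delta>_def)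
    then have c2: "\<forall>C\<in>CC. C \<subseteq> G \<and> real (card C) \<le> (1 - \<delta>) * real (card G)"
      using CC(3) unfolding N_def by (meson order_trans)
    have c3: "\<forall>F. F \<subseteq> G \<and> \<not> contains_copy F H \<longrightarrow> (\<exists>C\<in>CC. F \<subseteq> C)"
      using CC(4) W(3) by simp
    show ?thesis using CC(1) c1 c2 c3 by (intro exI[of _ CC] conjI)
  qed
  show ?thesis
  proof (rule exI[of _ "A0 * real (k + 1)"], rule exI[of _ \<delta>], rule exI[of _ n0], intro conjI allI impI)
    show "0 < A0 * real (k + 1)" "0 < \<delta>" "\<delta> \<le> 1" using pos by (auto simp: \<delta>_def)
    fix n G assume "n0 \<le> n" "G \<subseteq> k_subsets k n"
      "(real (cross_cut_number H) - 1 + \<epsilon>) * real (n choose (k - 1)) < real (card G)"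
    from main[OF this(1,2)] this(3)
    show "\<exists>CC. finite CC \<and> real (card CC) \<le> exp (A0 * real (k + 1) * real n ^ l * ln (real n)) \<and>
      (\<forall>C\<in>CC. C \<subseteq> G \<and> real (card C) \<le> (1 - \<delta>) * real (card G)) \<and>
      (\<forall>F. F \<subseteq> G \<and> \<not> contains_copy F H \<longrightarrow> (\<exists>C\<in>CC. F \<subseteq> C))" unfolding \<sigma>_def by simp
  qed
qed

text \<open>A round multiplies the number of containers by at most \<open>Q\<close> and shrinks
  those still above the threshold by \<open>1 - \<delta>\<close>. Starting from at most
  \<open>n ^ k\<close> edges, order \<open>ln n\<close> rounds suffice, and the logarithm of
  \<open>Q\<close> contains another \<open>ln n\<close>.\<close>

lemma containers_exist:
  fixes H :: "'a set set" and \<epsilon> :: real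
  assumes k: "2 \<le> k" "l \<le> k - 2" and H: "k_tree k H" "two_contractible H" "overlapping l H"
    and \<epsilon>: "0 < \<epsilon>"
  shows "\<exists>A n0. 0 < A \<and> (\<forall>n\<ge>n0. \<exists>CC. finite CC \<and>
    real (card CC) \<le> exp (A * real n ^ l * (ln (real n))\<^sup>2) \<and>
    (\<forall>C\<in>CC. C \<subseteq> k_subsets k n \<and>
      real (card C) \<le> (real (cross_cut_number H) - 1 + \<epsilon>) * real (n choose (k - 1))) \<and>
    (\<forall>F. F \<subseteq> k_subsets k n \<and> \<not> contains_copy F H \<longrightarrow> (\<exists>C\<in>CC. F \<subseteq> C)))"
proof -
  define \<sigma> where "\<sigma> = cross_cut_number H"
  have \<sigma>: "1 \<le> \<sigma>" unfolding \<sigma>_def by (rule cross_cut_number_pos[OF H(1,2)])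
  obtain A \<delta> n1 where *: "0 < A \<and> 0 < \<delta> \<and> \<delta> \<le> 1 \<and> (\<forall>n\<ge>n1. \<forall>G\<subseteq>k_subsets k n.
    (real (cross_cut_number H) - 1 + \<epsilon>) * real (n choose (k - 1)) < real (card G) \<longrightarrow>
    (\<exists>CC. finite CC \<and> real (card CC) \<le> exp (A * real n ^ l * ln (real n)) \<and>
      (\<forall>C\<in>CC. C \<subseteq> G \<and> real (card C) \<le> (1 - \<delta>) * real (card G)) \<and>
      (\<forall>F. F \<subseteq> G \<and> \<not> contains_copy F H \<longrightarrow> (\<exists>C\<in>CC. F \<subseteq> C))))"
    using container_step[OF k H \<epsilon>] by (elim exE) (rule that)
  have pos: "0 < A" "0 < \<delta>" "\<delta> \<le> 1" using * by simp_all
  note step = *[THEN conjunct2, THEN conjunct2, THEN conjunct2, THEN spec, THEN mp, THEN spec, THEN mp, THEN mp, folded \<sigma>_def]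
  define A' where "A' = A * (real k / \<delta> + 2)"
  have A': "0 < A'" using pos by (simp add: A'_def add_nonneg_pos)
  have main: "\<exists>CC. finite CC \<and>
    real (card CC) \<le> exp (A' * real n ^ l * (ln (real n))\<^sup>2) \<and>
    (\<forall>C\<in>CC. C \<subseteq> k_subsets k n \<and> real (card C) \<le> (real \<sigma> - 1 + \<epsilon>) * real (n choose (k - 1))) \<and>
    (\<forall>F. F \<subseteq> k_subsets k n \<and> \<not> contains_copy F H \<longrightarrow> (\<exists>C\<in>CC. F \<subseteq> C))" if n: "max n1 3 \<le> n" for n
  proof -
    have nn: "n1 \<le> n" "3 \<le> n" using n by auto
    define s where "s = (real \<sigma> - 1 + \<epsilon>) * real (n choose (k - 1))"
    have s: "0 \<le> s" using \<sigma> \<epsilon> by (simp add: s_def)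
    define Q where "Q = exp (A * real n ^ l * ln (real n))"
    have ln: "1 \<le> ln (real n)"
    proof -
      have "exp 1 \<le> real n" using exp_le nn by linarith
      then show ?thesis using nn by (simp add: ln_ge_iff)
    qed
    have Q1: "1 \<le> Q" using pos ln by (simp add: Q_def)
    define P where "P m CC \<longleftrightarrow> finite CC \<and> real (card CC) \<le> Q ^ m \<and>
      (\<forall>C\<in>CC. C \<subseteq> k_subsets k n \<and> (real (card C) \<le> s \<or> real (card C) \<le> (1 - \<delta>) ^ m * real n ^ k)) \<and>
      (\<forall>F. F \<subseteq> k_subsets k n \<and> \<not> contains_copy F H \<longrightarrow> (\<exists>C\<in>CC. F \<subseteq> C))" for m CC
    have "\<exists>CC. P m CC" for m
    proof (induction m)
      case 0
      have "P 0 {k_subsets k n}"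
        using binomial_le_power[of n k] by (auto simp: P_def card_k_subsets)
      then show ?case ..
    next
      case (Suc m)
      then obtain CC where CC: "P m CC" ..
      define R where "R C FF \<longleftrightarrow> finite FF \<and> real (card FF) \<le> Q \<and>
        (\<forall>C'\<in>FF. C' \<subseteq> C \<and> (real (card C') \<le> s \<or> real (card C') \<le> (1 - \<delta>) ^ Suc m * real n ^ k)) \<and>
        (\<forall>F. F \<subseteq> C \<and> \<not> contains_copy F H \<longrightarrow> (\<exists>C'\<in>FF. F \<subseteq> C'))" for C :: "nat set set" and FF
      have "\<exists>FF. R C FF" if C: "C \<in> CC" for C
      proof (cases "real (card C) \<le> s")
        case True
        then have "R C {C}" using Q1 by (auto simp: R_def)
        then show ?thesis ..
      next
        case False
        have Ck: "C \<subseteq> k_subsets k n" "real (card C) \<le> (1 - \<delta>) ^ m * real n ^ k"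
          using CC C False by (auto simp: P_def)
        have "s < real (card C)" using False by simp
        from step[OF nn(1) Ck(1) this[unfolded s_def], folded Q_def]
        obtain FF where FF: "finite FF" "real (card FF) \<le> Q"
          "\<forall>C'\<in>FF. C' \<subseteq> C \<and> real (card C') \<le> (1 - \<delta>) * real (card C)"
          "\<forall>F. F \<subseteq> C \<and> \<not> contains_copy F H \<longrightarrow> (\<exists>C'\<in>FF. F \<subseteq> C')"
          by (elim exE conjE) (rule that)
        have "(1 - \<delta>) * real (card C) \<le> (1 - \<delta>) * ((1 - \<delta>) ^ m * real n ^ k)"
          using Ck(2) pos by (intro mult_left_mono) auto
        then have "\<forall>C'\<in>FF. C' \<subseteq> C \<and> real (card C') \<le> (1 - \<delta>) ^ Suc m * real n ^ k"
          using FF(3) by (auto simp: mult.assoc intro: order_trans)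
        then have "R C FF" using FF by (auto simp: R_def)
        then show ?thesis ..
      qed
      then have "\<forall>C\<in>CC. \<exists>FF. R C FF" by blast
      from bchoice[OF this] obtain FF where "\<forall>C\<in>CC. R C (FF C)" ..
      note FF = bspec[OF this]
      define CC' where "CC' = (\<Union>C\<in>CC. FF C)"
      have finCC: "finite CC" using CC by (simp add: P_def)
      have "real (card CC') \<le> (\<Sum>C\<in>CC. real (card (FF C)))"
        unfolding CC'_def of_nat_sum[symmetric] of_nat_le_iff by (rule card_UN_le[OF finCC])
      also have "\<dots> \<le> (\<Sum>C\<in>CC. Q)" using FF by (intro sum_mono) (simp add: R_def)
      also have "\<dots> = real (card CC) * Q" by simp
      also have "\<dots> \<le> Q ^ m * Q" using CC Q1 by (intro mult_right_mono) (auto simp: P_def)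
      finally have 1: "real (card CC') \<le> Q ^ Suc m" by (simp add: mult.commute)
      have 2: "finite CC'" using finCC FF by (auto simp: CC'_def R_def)
      have 3: "C' \<subseteq> k_subsets k n \<and> (real (card C') \<le> s \<or> real (card C') \<le> (1 - \<delta>) ^ Suc m * real n ^ k)"
        if C': "C' \<in> CC'" for C'
      proof -
        obtain C where C: "C \<in> CC" "C' \<in> FF C" using C' by (auto simp: CC'_def)
        have "C \<subseteq> k_subsets k n" using CC C(1) by (simp add: P_def)
        then show ?thesis using FF[OF C(1)] C(2) unfolding R_def by blast
      qed
      have 4: "\<exists>C'\<in>CC'. F \<subseteq> C'" if F: "F \<subseteq> k_subsets k n \<and> \<not> contains_copy F H" for F
      proof -
        obtain C where C: "C \<in> CC" "F \<subseteq> C" using CC F unfolding P_def by blast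
        have "\<exists>C'\<in>FF C. F \<subseteq> C'" using FF[OF C(1)] C(2) F unfolding R_def by blast
        then show ?thesis using C(1) unfolding CC'_def by blast
      qed
      have "P (Suc m) CC'" unfolding P_def using 1 2 3 4 by blast
      then show ?case ..
    qed
    \<comment> \<open>Large enough for \<open>(1 - \<delta>) ^ m * n ^ k < 1\<close>, so that the
      second alternative in \<open>P\<close> allows only the empty container.\<close>
    define m where "m = nat \<lceil>real k * ln (real n) / \<delta>\<rceil> + 1"
    have mnn: "0 \<le> real k * ln (real n) / \<delta>" using ln pos by simp
    have m: "real k * ln (real n) / \<delta> < real m" "real m \<le> real k * ln (real n) / \<delta> + 2"
      using mnn unfolding m_def by linarith+
    obtain CC where CC: "P m CC" using \<open>\<exists>CC. P m CC\<close> ..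
    have small: "(1 - \<delta>) ^ m * real n ^ k < 1"
    proof -
      have "(1 - \<delta>) ^ m \<le> exp (- \<delta>) ^ m"
        using pos exp_ge_add_one_self[of "- \<delta>"] by (intro power_mono) auto
      also have "\<dots> = exp (- (\<delta> * real m))" by (simp add: exp_of_nat_mult[symmetric] mult.commute)
      finally have "(1 - \<delta>) ^ m * real n ^ k \<le> exp (- (\<delta> * real m)) * real n ^ k"
        by (intro mult_right_mono) auto
      also have "exp (- (\<delta> * real m)) * real n ^ k = exp (real k * ln (real n) - \<delta> * real m)"
      proof -
        have "real n ^ k = exp (real k * ln (real n))" using nn by (simp add: exp_of_nat_mult)
        then show ?thesis by (simp add: exp_add[symmetric] algebra_simps)
      qed
      also have "\<dots> < 1" using m(1) pos by (simp add: field_simps)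
      finally show ?thesis .
    qed
    have "Q ^ m = exp (real m * (A * real n ^ l * ln (real n)))" by (simp add: Q_def exp_of_nat_mult)
    also have "\<dots> \<le> exp (A' * real n ^ l * (ln (real n))\<^sup>2)"
    proof -
      have "real m \<le> (real k / \<delta> + 2) * ln (real n)" using m(2) ln by (simp add: algebra_simps)
      then have "real m * (A * real n ^ l * ln (real n)) \<le> ((real k / \<delta> + 2) * ln (real n)) * (A * real n ^ l * ln (real n))"
        using pos ln by (intro mult_right_mono) auto
      also have "\<dots> = A' * real n ^ l * (ln (real n))\<^sup>2"
        unfolding A'_def power2_eq_square by (simp only: mult_ac)
      finally show ?thesis by simp
    qed
    finally have 1: "real (card CC) \<le> exp (A' * real n ^ l * (ln (real n))\<^sup>2)"
      using CC unfolding P_def by linarith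
    have 2: "real (card C) \<le> s" if "C \<in> CC" for C
    proof (cases "real (card C) \<le> s")
      case False
      then have "real (card C) \<le> (1 - \<delta>) ^ m * real n ^ k" using CC that by (auto simp: P_def)
      then have "real (card C) < 1" using small by linarith
      then show ?thesis using s by simp
    qed
    show ?thesis
      using CC 1 2 unfolding P_def s_def by (intro exI[of _ CC] conjI) auto
  qed
  show ?thesis
    by (rule exI[of _ A'], rule exI[of _ "max n1 3"]) (use A' main in \<open>simp add: \<sigma>_def\<close>)
qed

section \<open>Concentration and the main theorem\<close>

lemma set_random_k_graph: "G \<in> set_pmf (random_k_graph k n p) \<Longrightarrow> G \<subseteq> k_subsets k n"
  by (auto simp: random_k_graph_def)

lemma finite_set_random_k_graph: "finite (set_pmf (random_k_graph k n p))"
  using set_random_k_graph k_subsets_finite by (metis PowI finite_Pow_iff finite_subset subsetI)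

lemma expectation_exp_card_Int:
  assumes p: "0 \<le> p" "p \<le> 1" and C: "C \<subseteq> k_subsets k n"
  shows "measure_pmf.expectation (random_k_graph k n p) (\<lambda>G. exp (x * real (card (G \<inter> C)))) =
    (p * exp x + (1 - p)) ^ card C"
proof -
  define K where "K = k_subsets k n"
  have finK: "finite K" by (simp add: K_def k_subsets_finite)
  have CK: "C \<subseteq> K" using C by (simp add: K_def)
  have finC: "finite C" using CK finK finite_subset by blast
  define g where "g e b = (if e \<in> C \<and> b then exp x else 1)" for e :: "nat set" and b
  have prod: "exp (x * real (card ({e\<in>K. y e} \<inter> C))) = (\<Prod>e\<in>K. g e (y e))" for y
  proof -
    have "(\<Prod>e\<in>K. g e (y e)) = (\<Prod>e\<in>{e\<in>K. e \<in> C \<and> y e}. exp x)"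
      unfolding g_def using finK by (simp add: prod.If_cases Int_def)
    also have "{e\<in>K. e \<in> C \<and> y e} = {e\<in>K. y e} \<inter> C" by auto
    finally show ?thesis by (simp add: exp_of_nat2_mult)
  qed
  have "measure_pmf.expectation (random_k_graph k n p) (\<lambda>G. exp (x * real (card (G \<inter> C)))) =
      measure_pmf.expectation (Pi_pmf K False (\<lambda>_. bernoulli_pmf p)) (\<lambda>y. \<Prod>e\<in>K. g e (y e))"
    unfolding random_k_graph_def K_def[symmetric] by (simp add: prod)
  also have "\<dots> = (\<Prod>e\<in>K. measure_pmf.expectation (bernoulli_pmf p) (g e))"
    by (rule expectation_prod_Pi_pmf[OF finK])
      (auto simp: g_def intro!: integrable_measure_pmf_finite intro: finite_subset[of _ UNIV])
  also have "\<dots> = (\<Prod>e\<in>K. if e \<in> C then p * exp x + (1 - p) else 1)"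
    using p by (intro prod.cong) (auto simp: g_def algebra_simps)
  also have "\<dots> = (\<Prod>e\<in>C. p * exp x + (1 - p))"
    using finK CK by (simp add: prod.If_cases Int_absorb1)
  finally show ?thesis by simp
qed

text \<open>Markov's inequality for the exponential moment. The factor \<open>x\<close> is kept on
  both sides of the event, so negative \<open>x\<close> gives the lower tail.\<close>

lemma prob_card_Int_le:
  assumes p: "0 \<le> p" "p \<le> 1" and C: "C \<subseteq> k_subsets k n"
  shows "measure_pmf.prob (random_k_graph k n p) {G. x * a \<le> x * real (card (G \<inter> C))} \<le>
    exp (p * real (card C) * (exp x - 1) - x * a)"
proof -
  let ?M = "random_k_graph k n p"
  let ?X = "{G. x * a \<le> x * real (card (G \<inter> C))}"
  have int: "integrable (measure_pmf ?M) h" for h :: "nat set set \<Rightarrow> real"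
    by (rule integrable_measure_pmf_finite[OF finite_set_random_k_graph])
  have "measure_pmf.prob ?M ?X = measure_pmf.expectation ?M (indicator ?X)" by simp
  also have "\<dots> \<le> measure_pmf.expectation ?M (\<lambda>G. exp (x * real (card (G \<inter> C))) * exp (- (x * a)))"
    by (rule integral_mono[OF int int]) (auto simp: indicator_def exp_add[symmetric])
  also have "\<dots> = (p * exp x + (1 - p)) ^ card C * exp (- (x * a))"
    by (simp add: expectation_exp_card_Int[OF p C])
  also have "(p * exp x + (1 - p)) ^ card C \<le> exp (p * (exp x - 1)) ^ card C"
  proof (rule power_mono)
    show "p * exp x + (1 - p) \<le> exp (p * (exp x - 1))"
      using exp_ge_add_one_self[of "p * (exp x - 1)"] by (simp add: algebra_simps)
    show "0 \<le> p * exp x + (1 - p)" using p by simp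
  qed
  finally have "measure_pmf.prob ?M ?X \<le> exp (p * (exp x - 1)) ^ card C * exp (- (x * a))" by simp
  also have "\<dots> = exp (p * real (card C) * (exp x - 1) - x * a)"
    by (simp add: exp_of_nat_mult[symmetric] exp_add[symmetric] algebra_simps)
  finally show ?thesis .
qed

lemma exp_minus_le: "0 \<le> x \<Longrightarrow> exp (- x) \<le> 1 - x + x\<^sup>2" for x :: real
proof -
  assume x: "0 \<le> x"
  have "1 + x \<le> exp x" by (rule exp_ge_add_one_self)
  then have "exp (- x) \<le> 1 / (1 + x)" using x by (simp add: exp_minus field_simps)
  also have "\<dots> \<le> 1 - x + x\<^sup>2"
  proof -
    have "(1 - x + x\<^sup>2) * (1 + x) = 1 + x ^ 3" by (simp add: algebra_simps power2_eq_square power3_eq_cube)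
    then have "1 \<le> (1 - x + x\<^sup>2) * (1 + x)" using x by simp
    then show ?thesis using x by (simp add: pos_divide_le_eq)
  qed
  finally show ?thesis .
qed

text \<open>Second-order bounds on the exponential leave an exponent
  \<open>p * b * (m * x\<^sup>2 - x * \<epsilon>)\<close>, and
  \<open>x * m \<le> \<epsilon> / 2\<close> makes the quadratic term at most half of the linear one.
  Deviations are measured against \<open>p * b\<close> and not against the mean, so that containers
  of any smaller size obey the same bound.\<close>

lemma random_k_graph_tails:
  fixes m \<epsilon> b x p :: real
  assumes p: "0 \<le> p" "p \<le> 1" and C: "C \<subseteq> k_subsets k n" and card: "real (card C) \<le> m * b"
    and b: "0 \<le> b" and m: "0 \<le> m" and x: "0 < x" "x \<le> 1" "x * m \<le> \<epsilon> / 2"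
  shows "measure_pmf.prob (random_k_graph k n p) {G. (m + \<epsilon>) * (p * b) \<le> real (card (G \<inter> C))}
      \<le> exp (- (x * \<epsilon> / 2 * (p * b)))"
    and "measure_pmf.prob (random_k_graph k n p) {G. real (card (G \<inter> C)) \<le> p * real (card C) - \<epsilon> * (p * b)}
      \<le> exp (- (x * \<epsilon> / 2 * (p * b)))"
proof -
  have pb: "0 \<le> p * b" using p b by simp
  have mx: "m * x\<^sup>2 - x * \<epsilon> \<le> - (x * \<epsilon> / 2)"
  proof -
    have "x * (x * m) \<le> x * (\<epsilon> / 2)" using x by (intro mult_left_mono) auto
    then show ?thesis by (simp add: power2_eq_square algebra_simps)
  qed
  have key: "(p * b) * (m * x\<^sup>2 - x * \<epsilon>) \<le> - (x * \<epsilon> / 2 * (p * b))"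
    using mult_left_mono[OF mx pb] by (simp add: algebra_simps)
  have pC: "p * real (card C) \<le> p * (m * b)" using p card by (intro mult_left_mono)
  have "exp x \<le> 1 + x + x\<^sup>2" using x by (intro exp_bound) auto
  then have e1: "exp x - 1 \<le> x + x\<^sup>2" by simp
  have "p * real (card C) * (exp x - 1) \<le> (p * (m * b)) * (x + x\<^sup>2)"
    using p m b x by (intro mult_mono[OF pC e1]) auto
  moreover have "(p * (m * b)) * (x + x\<^sup>2) - x * ((m + \<epsilon>) * (p * b)) = (p * b) * (m * x\<^sup>2 - x * \<epsilon>)"
    by (simp add: algebra_simps)
  ultimately have u: "p * real (card C) * (exp x - 1) - x * ((m + \<epsilon>) * (p * b)) \<le> - (x * \<epsilon> / 2 * (p * b))"
    using key by linarith
  have "measure_pmf.prob (random_k_graph k n p) {G. x * ((m + \<epsilon>) * (p * b)) \<le> x * real (card (G \<inter> C))}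
      \<le> exp (- (x * \<epsilon> / 2 * (p * b)))"
    using order_trans[OF prob_card_Int_le[OF p C] iffD2[OF exp_le_cancel_iff u]] .
  then show "measure_pmf.prob (random_k_graph k n p) {G. (m + \<epsilon>) * (p * b) \<le> real (card (G \<inter> C))}
      \<le> exp (- (x * \<epsilon> / 2 * (p * b)))" using x by simp
  have "p * real (card C) * (exp (- x) - 1) \<le> p * real (card C) * (- x + x\<^sup>2)"
    using exp_minus_le[of x] x p by (intro mult_left_mono) auto
  then have "p * real (card C) * (exp (- x) - 1) - (- x) * (p * real (card C) - \<epsilon> * (p * b)) \<le>
      p * real (card C) * x\<^sup>2 - x * \<epsilon> * (p * b)" by (simp add: algebra_simps)
  also have "\<dots> \<le> p * (m * b) * x\<^sup>2 - x * \<epsilon> * (p * b)"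
    using pC by (intro diff_right_mono mult_right_mono) auto
  also have "\<dots> = (p * b) * (m * x\<^sup>2 - x * \<epsilon>)" by (simp add: algebra_simps)
  also note key
  finally have v: "p * real (card C) * (exp (- x) - 1) - (- x) * (p * real (card C) - \<epsilon> * (p * b))
      \<le> - (x * \<epsilon> / 2 * (p * b))" .
  have "measure_pmf.prob (random_k_graph k n p) {G. (- x) * (p * real (card C) - \<epsilon> * (p * b)) \<le> (- x) * real (card (G \<inter> C))}
      \<le> exp (- (x * \<epsilon> / 2 * (p * b)))"
    using order_trans[OF prob_card_Int_le[OF p C] iffD2[OF exp_le_cancel_iff v]] .
  then show "measure_pmf.prob (random_k_graph k n p) {G. real (card (G \<inter> C)) \<le> p * real (card C) - \<epsilon> * (p * b)}
      \<le> exp (- (x * \<epsilon> / 2 * (p * b)))" using x by simp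
qed

section \<open>Attained extremal numbers and the star construction\<close>

lemma not_contains_copy_empty: "H \<noteq> {} \<Longrightarrow> \<not> contains_copy {} H"
  by (auto simp: contains_copy_def)

lemma contains_copy_mono: "contains_copy F H \<Longrightarrow> F \<subseteq> F' \<Longrightarrow> contains_copy F' H"
  by (auto simp: contains_copy_def)

text \<open>For \<open>H \<noteq> {}\<close> the empty graph has no copy, so the maximum is over a
  nonempty family; an edgeless \<open>H\<close> would have a copy in every graph.\<close>

lemma ex_in_attained:
  assumes "finite G" "H \<noteq> {}"
  shows "\<exists>F\<subseteq>G. \<not> contains_copy F H \<and> card F = ex_in G H"
    and "\<And>F. F \<subseteq> G \<Longrightarrow> \<not> contains_copy F H \<Longrightarrow> card F \<le> ex_in G H"
proof -
  have fin: "finite {F. F \<subseteq> G \<and> \<not> contains_copy F H}" using assms by simp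
  have ne: "{F. F \<subseteq> G \<and> \<not> contains_copy F H} \<noteq> {}" using not_contains_copy_empty[OF assms(2)] by blast
  have "ex_in G H \<in> card ` {F. F \<subseteq> G \<and> \<not> contains_copy F H}"
    unfolding ex_in_def using fin ne by (intro Max_in) auto
  then show "\<exists>F\<subseteq>G. \<not> contains_copy F H \<and> card F = ex_in G H" by auto
  show "card F \<le> ex_in G H" if "F \<subseteq> G" "\<not> contains_copy F H" for F
    unfolding ex_in_def using fin that by (intro Max_ge) auto
qed

definition star_family :: "nat \<Rightarrow> nat \<Rightarrow> nat \<Rightarrow> nat set set" where
  "star_family k n s = {e \<in> k_subsets k n. card (e \<inter> {1..s}) = 1}"

lemma star_family_no_copy:
  assumes "k_tree k H" "two_contractible H" "s < cross_cut_number H"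
  shows "\<not> contains_copy (star_family k n s) H"
proof
  assume "contains_copy (star_family k n s) H"
  then obtain f where f: "inj_on f (\<Union>H)" "\<And>E. E \<in> H \<Longrightarrow> f ` E \<in> star_family k n s"
    by (auto simp: contains_copy_def)
  have finH: "finite H" and HE: "\<And>E. E \<in> H \<Longrightarrow> finite E"
    using assms hypertree_finite by (auto simp: k_tree_def uniform_def)
  define S where "S = {v \<in> \<Union>H. f v \<in> {1..s}}"
  have "card (S \<inter> E) = 1" if E: "E \<in> H" for E
  proof -
    have "f ` (S \<inter> E) = f ` E \<inter> {1..s}" using E by (auto simp: S_def)
    moreover have "inj_on f (S \<inter> E)" using f(1) E by (auto intro: inj_on_subset)
    ultimately have "card (S \<inter> E) = card (f ` E \<inter> {1..s})" by (metis card_image)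
    then show ?thesis using f(2)[OF E] by (simp add: star_family_def)
  qed
  then have "cross_cut H S" by (auto simp: cross_cut_def S_def)
  then have "cross_cut_number H \<le> card S" using HE by (intro cross_cut_min(2)[OF finH _ assms(2)])
  also have "card S = card (f ` S)"
    using f(1) by (intro card_image[symmetric] inj_on_subset[OF f(1)]) (auto simp: S_def)
  also have "\<dots> \<le> card {1..s}" by (intro card_mono) (auto simp: S_def)
  finally show False using assms(3) by simp
qed

text \<open>Deleting the points one at a time, each deletion loses by Pascal's rule at most
  \<open>n choose r\<close> subsets.\<close>

lemma binomial_diff_ge: "s \<le> n \<Longrightarrow> n choose Suc r \<le> ((n - s) choose Suc r) + s * (n choose r)"
proof (induction s)
  case (Suc s)
  have "(n - s) choose Suc r = ((n - Suc s) choose Suc r) + ((n - Suc s) choose r)"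
  proof -
    have "n - s = Suc (n - Suc s)" using Suc.prems by simp
    then show ?thesis by simp
  qed
  moreover have "(n - Suc s) choose r \<le> n choose r" by (rule binomial_right_mono) simp
  ultimately show ?case using Suc by simp
qed simp

text \<open>An edge is one special vertex together with a (k-1)-set of ordinary ones; excluding the
  \<open>s\<close> special vertices from the latter is a correction of order
  \<open>n ^ (k - 2)\<close>.\<close>

lemma card_star_family:
  assumes "2 \<le> k" "s \<le> n"
  shows "real s * real (n choose (k - 1)) - real s * real s * real n ^ (k - 2) \<le> real (card (star_family k n s))"
    and "card (star_family k n s) \<le> s * (n choose (k - 1))"
proof -
  define DD where "DD = {D. D \<subseteq> {s<..n} \<and> card D = k - 1}"
  have finD: "finite DD" by (simp add: DD_def)
  have cardD: "card DD = (n - s) choose (k - 1)"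
    using n_subsets[of "{s<..n}" "k - 1"] by (simp add: DD_def)
  have im: "star_family k n s = (\<lambda>(x, D). insert x D) ` ({1..s} \<times> DD)"
  proof (intro equalityI subsetI)
    fix e assume e: "e \<in> star_family k n s"
    then have ee: "e \<subseteq> {1..n}" "card e = k" "card (e \<inter> {1..s}) = 1" by (auto simp: star_family_def k_subsets_def)
    then obtain x where x: "e \<inter> {1..s} = {x}" by (auto simp: card_1_singleton_iff)
    have "finite e" using ee finite_subset by auto
    have "e - {x} \<in> DD"
    proof -
      have "y \<in> {s<..n}" if "y \<in> e - {x}" for y
      proof -
        have "y \<in> {1..n}" "y \<notin> {1..s}" using that x ee by blast+
        then show ?thesis by auto
      qed
      moreover have "card (e - {x}) = k - 1" using x ee \<open>finite e\<close> by (subst card_Diff_singleton) auto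
      ultimately show ?thesis unfolding DD_def by (intro CollectI conjI subsetI)
    qed
    moreover have "x \<in> {1..s}" "insert x (e - {x}) = e" using x by auto
    ultimately show "e \<in> (\<lambda>(x, D). insert x D) ` ({1..s} \<times> DD)"
      by (intro image_eqI[of _ _ "(x, e - {x})"]) auto
  next
    fix e assume "e \<in> (\<lambda>(x, D). insert x D) ` ({1..s} \<times> DD)"
    then obtain x D where xD: "x \<in> {1..s}" "D \<subseteq> {s<..n}" "card D = k - 1" "e = insert x D" by (auto simp: DD_def)
    have "finite D" using xD finite_subset by auto
    moreover have "x \<notin> D" using xD by auto
    ultimately have "card e = k" using xD assms by simp
    moreover have "e \<inter> {1..s} = {x}" using xD by auto
    moreover have "e \<subseteq> {1..n}" using xD assms by auto
    ultimately show "e \<in> star_family k n s" by (simp add: star_family_def k_subsets_def)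
  qed
  have "inj_on (\<lambda>(x, D). insert x D) ({1..s} \<times> DD)"
  proof (rule inj_onI, clarify)
    fix x D y D' assume "x \<in> {1..s}" "D \<in> DD" "y \<in> {1..s}" "D' \<in> DD" and eq: "insert x D = insert y D'"
    then have *: "insert x D \<inter> {1..s} = {x}" "insert y D' \<inter> {1..s} = {y}" "x \<notin> D" "y \<notin> D'"
      by (auto simp: DD_def)
    then have "x = y" using eq by (metis singleton_inject)
    then show "x = y \<and> D = D'" using eq * by (metis insert_ident)
  qed
  then have card: "card (star_family k n s) = s * ((n - s) choose (k - 1))"
    unfolding im by (simp add: card_image card_cartesian_product cardD)
  have "(n - s) choose (k - 1) \<le> n choose (k - 1)" by (rule binomial_right_mono) simp
  then show "card (star_family k n s) \<le> s * (n choose (k - 1))" unfolding card by simp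
  have "n choose (k - 1) \<le> ((n - s) choose (k - 1)) + s * (n choose (k - 2))"
  proof -
    have "Suc (k - 2) = k - 1" using assms(1) by simp
    with binomial_diff_ge[OF assms(2), of "k - 2"] show ?thesis by (simp only:)
  qed
  then have "real (n choose (k - 1)) \<le> real ((n - s) choose (k - 1)) + real s * real (n choose (k - 2))"
    by (metis of_nat_add of_nat_le_iff of_nat_mult)
  also have "\<dots> \<le> real ((n - s) choose (k - 1)) + real s * real n ^ (k - 2)"
    using binomial_le_power[of n "k - 2"] by (intro add_left_mono mult_left_mono) auto
  finally have "real s * real (n choose (k - 1)) \<le> real s * (real ((n - s) choose (k - 1)) + real s * real n ^ (k - 2))"
    by (intro mult_left_mono) auto
  then show "real s * real (n choose (k - 1)) - real s * real s * real n ^ (k - 2) \<le> real (card (star_family k n s))"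
    unfolding card by (simp add: algebra_simps)
qed

lemma star_family_asymptotics:
  fixes \<epsilon> :: real
  assumes "2 \<le> k" "0 < \<epsilon>"
  shows "\<exists>n0. \<forall>n\<ge>n0. (real s - \<epsilon>) * real (n choose (k - 1)) \<le> real (card (star_family k n s))"
proof -
  define \<kappa> where "\<kappa> = 1 / real (k - 1) ^ (k - 1)"
  have \<kappa>: "0 < \<kappa>" using assms by (simp add: \<kappa>_def)
  show ?thesis
  proof (intro exI[of _ "max (max k s) (nat \<lceil>real s * real s / (\<epsilon> * \<kappa>)\<rceil>)"] allI impI)
    fix n assume n: "max (max k s) (nat \<lceil>real s * real s / (\<epsilon> * \<kappa>)\<rceil>) \<le> n"
    have "nat \<lceil>real s * real s / (\<epsilon> * \<kappa>)\<rceil> \<le> n" using n by linarith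
    then have nn: "k \<le> n" "s \<le> n" "real s * real s / (\<epsilon> * \<kappa>) \<le> real n" using n by linarith+
    have b: "\<kappa> * real n ^ (k - 1) \<le> real (n choose (k - 1))"
      using binomial_ge_power[of "k - 1" n] assms(1) nn by (simp add: \<kappa>_def)
    have "real s * real s \<le> \<epsilon> * \<kappa> * real n" using nn(3) \<kappa> assms by (simp add: field_simps)
    then have "real s * real s * real n ^ (k - 2) \<le> \<epsilon> * \<kappa> * real n * real n ^ (k - 2)"
      by (intro mult_right_mono) auto
    also have "\<dots> = \<epsilon> * (\<kappa> * real n ^ (k - 1))"
    proof -
      have "k - 1 = Suc (k - 2)" using assms by simp
      then show ?thesis by simp
    qed
    also have "\<dots> \<le> \<epsilon> * real (n choose (k - 1))" using b assms by (intro mult_left_mono) auto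
    finally show "(real s - \<epsilon>) * real (n choose (k - 1)) \<le> real (card (star_family k n s))"
      using card_star_family(1)[OF assms(1) nn(2)] by (simp add: algebra_simps)
  qed
qed

text \<open>The relation between \<open>l\<close> and \<open>k\<close> on which supersaturation
  rests is forced by \<open>p n \<le> 1\<close>: otherwise the exponent is at most 0, the rate is at
  least 1 for \<open>n \<ge> 3\<close>, and growth beyond twice the rate would give
  \<open>p n \<ge> 2\<close>.\<close>

lemma sparse_rate_imp_overlap:
  fixes p :: "nat \<Rightarrow> real"
  assumes p1: "\<And>n. 0 \<le> p n \<and> p n \<le> 1"
    and p: "p \<in> \<omega>(\<lambda>n. (ln (real n))\<^sup>2 / real n powr (real k - real l - 1))"
  shows "l + 2 \<le> k"
proof (rule ccontr)
  assume "\<not> l + 2 \<le> k"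
  then have neg: "real k - real l - 1 \<le> 0" by simp
  have "eventually (\<lambda>n. norm (p n) \<ge> 2 * norm ((ln (real n))\<^sup>2 / real n powr (real k - real l - 1))) sequentially"
    by (rule landau_omega.smallD[OF p]) simp
  moreover have "eventually (\<lambda>n::nat. 3 \<le> n) sequentially" by (rule eventually_ge_at_top)
  ultimately have "eventually (\<lambda>n::nat. False) sequentially"
  proof eventually_elim
    case (elim n)
    have "exp 1 \<le> real n" using exp_le elim(2) by linarith
    then have "1 \<le> ln (real n)" using elim(2) by (simp add: ln_ge_iff)
    then have "1 \<le> (ln (real n))\<^sup>2" by (simp add: one_le_power)
    moreover have "real n powr (real k - real l - 1) \<le> 1"
    proof -
      have "real n powr (real k - real l - 1) \<le> real n powr 0" using neg elim(2) by (intro powr_mono) auto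
      then show ?thesis using elim(2) by simp
    qed
    moreover have "0 < real n powr (real k - real l - 1)" using elim(2) by simp
    ultimately have "1 \<le> (ln (real n))\<^sup>2 / real n powr (real k - real l - 1)"
      by (simp add: le_divide_eq)
    then have "2 \<le> norm (p n)" using elim(1) by simp
    then show False using p1[of n] by simp
  qed
  then show False by simp
qed

text \<open>Since \<open>n ^ (k - 1) = n ^ l * n ^ (k - 1 - l)\<close>, the growth of
  \<open>p\<close> means that the expected scale exceeds any constant multiple of
  \<open>n ^ l * (ln n)\<^sup>2\<close>, the order of the logarithm of the number of
  containers.\<close>

lemma rate_lower_bound:
  fixes p :: "nat \<Rightarrow> real"
  assumes kl: "l + 2 \<le> k" and p0: "\<And>n. 0 \<le> p n"
    and p: "p \<in> \<omega>(\<lambda>n. (ln (real n))\<^sup>2 / real n powr (real k - real l - 1))" and M: "0 < M"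
  shows "eventually (\<lambda>n. M * (real n ^ l * (ln (real n))\<^sup>2) \<le> p n * real (n choose (k - 1))) sequentially"
proof -
  define \<kappa> where "\<kappa> = 1 / real (k - 1) ^ (k - 1)"
  have \<kappa>: "0 < \<kappa>" using kl by (simp add: \<kappa>_def)
  have "eventually (\<lambda>n. norm (p n) \<ge> (M / \<kappa>) * norm ((ln (real n))\<^sup>2 / real n powr (real k - real l - 1))) sequentially"
    by (rule landau_omega.smallD[OF p]) (use M \<kappa> in simp)
  moreover have "eventually (\<lambda>n. k \<le> n) sequentially" by (rule eventually_ge_at_top)
  ultimately show ?thesis
  proof eventually_elim
    case (elim n)
    have n: "0 < real n" using elim kl by simp
    have pw: "real n powr (real k - real l - 1) = real n ^ (k - 1 - l)"
    proof -
      have "real k - real l - 1 = real (k - 1 - l)" using kl by simp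
      then show ?thesis using n by (simp only: powr_realpow)
    qed
    have b: "\<kappa> * real n ^ (k - 1) \<le> real (n choose (k - 1))"
      using binomial_ge_power[of "k - 1" n] kl elim by (simp add: \<kappa>_def)
    have eq: "real n ^ (k - 1) = real n ^ l * real n ^ (k - 1 - l)"
      using kl by (simp add: power_add[symmetric])
    have "M * (real n ^ l * (ln (real n))\<^sup>2) = (M / \<kappa>) * ((ln (real n))\<^sup>2 / real n ^ (k - 1 - l)) * (\<kappa> * real n ^ (k - 1))"
      unfolding eq using \<kappa> n by (simp add: field_simps)
    also have "\<dots> \<le> p n * (\<kappa> * real n ^ (k - 1))"
    proof (rule mult_right_mono)
      show "M / \<kappa> * ((ln (real n))\<^sup>2 / real n ^ (k - 1 - l)) \<le> p n"
        using elim(1) p0[of n] unfolding pw by simp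
      show "0 \<le> \<kappa> * real n ^ (k - 1)" using \<kappa> by simp
    qed
    also have "\<dots> \<le> p n * real (n choose (k - 1))" using b p0 by (intro mult_left_mono)
    finally show ?case .
  qed
qed

lemma prob_tendsto_1I:
  assumes "eventually (\<lambda>n. measure_pmf.prob (M n) (- X n) \<le> u n) sequentially" "u \<longlonglongrightarrow> 0"
  shows "(\<lambda>n. measure_pmf.prob (M n) (X n)) \<longlonglongrightarrow> 1"
proof (rule tendsto_sandwich)
  show "eventually (\<lambda>n. 1 - u n \<le> measure_pmf.prob (M n) (X n)) sequentially"
    using assms(1)
  proof eventually_elim
    case (elim n)
    have "measure_pmf.prob (M n) (- X n) = 1 - measure_pmf.prob (M n) (X n)"
      using measure_pmf.prob_compl[of "X n" "M n"] by (simp add: Compl_eq_Diff_UNIV)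
    then show ?case using elim by simp
  qed
  show "eventually (\<lambda>n. measure_pmf.prob (M n) (X n) \<le> 1) sequentially" by simp
  show "(\<lambda>n. 1 - u n) \<longlonglongrightarrow> 1" using tendsto_diff[OF tendsto_const assms(2), of 1] by simp
qed simp

lemma random_turan_concentration:
  fixes p :: "nat \<Rightarrow> real"
  assumes k: "2 \<le> k" and H: "k_tree k H" "two_contractible H" "overlapping l H"
    and p1: "\<And>n. 0 \<le> p n \<and> p n \<le> 1"
    and p: "p \<in> \<omega>(\<lambda>n. (ln (real n))\<^sup>2 / real n powr (real k - real l - 1))" and \<epsilon>: "0 < \<epsilon>"
  shows "(\<lambda>n. measure_pmf.prob (random_k_graph k n (p n))
    {G. \<bar>real (ex_in G H) - (real (cross_cut_number H) - 1) * p n * real (n choose (k - 1))\<bar>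
      \<le> \<epsilon> * p n * real (n choose (k - 1))}) \<longlonglongrightarrow> 1"
proof -
  have kl: "l + 2 \<le> k" by (rule sparse_rate_imp_overlap[OF p1 p])
  then have l: "l \<le> k - 2" by simp
  define \<sigma> where "\<sigma> = cross_cut_number H"
  have \<sigma>: "1 \<le> \<sigma>" unfolding \<sigma>_def by (rule cross_cut_number_pos[OF H(1,2)])
  have Hne: "H \<noteq> {}" using H hypertree_finite by (auto simp: k_tree_def)
  \<comment> \<open>One part covers the error in the size of a container or of the star, one the
    random deviation; the third is slack.\<close>
  define \<epsilon>' where "\<epsilon>' = \<epsilon> / 3"
  have \<epsilon>': "0 < \<epsilon>'" using \<epsilon> by (simp add: \<epsilon>'_def)
  obtain A n1 where *: "0 < A \<and> (\<forall>n\<ge>n1. \<exists>CC. finite CC \<and>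
    real (card CC) \<le> exp (A * real n ^ l * (ln (real n))\<^sup>2) \<and>
    (\<forall>C\<in>CC. C \<subseteq> k_subsets k n \<and>
      real (card C) \<le> (real (cross_cut_number H) - 1 + \<epsilon>') * real (n choose (k - 1))) \<and>
    (\<forall>F. F \<subseteq> k_subsets k n \<and> \<not> contains_copy F H \<longrightarrow> (\<exists>C\<in>CC. F \<subseteq> C)))"
    using containers_exist[OF k l H \<epsilon>'] by (elim exE) (rule that)
  have A: "0 < A" using * by simp
  note cont = *[THEN conjunct2, THEN spec, THEN mp, folded \<sigma>_def]
  obtain n2 where n2: "\<forall>n\<ge>n2. (real (\<sigma> - 1) - \<epsilon>') * real (n choose (k - 1)) \<le> real (card (star_family k n (\<sigma> - 1)))"
    using star_family_asymptotics[OF k \<epsilon>'] ..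
  define m where "m = real \<sigma> - 1 + \<epsilon>'"
  have m: "0 < m" using \<sigma> \<epsilon>' by (simp add: m_def)
  define x where "x = min 1 (\<epsilon>' / (2 * m))"
  have x: "0 < x" "x \<le> 1" using m \<epsilon>' by (auto simp: x_def)
  have xm: "x * m \<le> \<epsilon>' / 2"
  proof -
    have "x * m \<le> (\<epsilon>' / (2 * m)) * m" using m by (intro mult_right_mono) (auto simp: x_def)
    then show ?thesis using m by simp
  qed
  define c where "c = x * \<epsilon>' / 2"
  have c: "0 < c" using x \<epsilon>' by (simp add: c_def)
  \<comment> \<open>\<open>A\<close> pays for the union bound over the containers; the additional 1
    leaves \<open>exp (- L) \<le> 1 / n\<close>.\<close>
  have M: "0 < (A + 1) / c" using A c by simp
  have "eventually (\<lambda>n. (A + 1) / c * (real n ^ l * (ln (real n))\<^sup>2) \<le> p n * real (n choose (k - 1))) sequentially"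
    by (rule rate_lower_bound[OF kl _ p M]) (use p1 in auto)
  moreover have "eventually (\<lambda>n. max (max n1 n2) (max 3 \<sigma>) \<le> n) sequentially" by (rule eventually_ge_at_top)
  ultimately have "eventually (\<lambda>n. measure_pmf.prob (random_k_graph k n (p n))
    (- {G. \<bar>real (ex_in G H) - (real \<sigma> - 1) * p n * real (n choose (k - 1))\<bar>
      \<le> \<epsilon> * p n * real (n choose (k - 1))}) \<le> 2 / real n) sequentially"
  proof eventually_elim
    case (elim n)
    have nn: "n1 \<le> n" "n2 \<le> n" "3 \<le> n" "\<sigma> \<le> n" using elim(2) by auto
    define b where "b = real (n choose (k - 1))"
    have b: "0 \<le> b" by (simp add: b_def)
    have pn: "0 \<le> p n" "p n \<le> 1" using p1[of n] by auto
    have pb: "0 \<le> p n * b" using pn b by simp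
    define L where "L = real n ^ l * (ln (real n))\<^sup>2"
    let ?R = "random_k_graph k n (p n)"
    have ln1: "1 \<le> ln (real n)"
    proof -
      have "exp 1 \<le> real n" using exp_le nn by linarith
      then show ?thesis using nn by (simp add: ln_ge_iff)
    qed
    have Ln: "ln (real n) \<le> L"
    proof -
      have "1 * ln (real n) \<le> ln (real n) * ln (real n)" using ln1 by (intro mult_right_mono) auto
      also have "\<dots> = 1 * (ln (real n))\<^sup>2" by (simp add: power2_eq_square)
      also have "\<dots> \<le> real n ^ l * (ln (real n))\<^sup>2" using nn by (intro mult_right_mono) auto
      finally show ?thesis by (simp add: L_def)
    qed
    have cpb: "(A + 1) * L \<le> c * (p n * b)"
    proof -
      have "c * ((A + 1) / c * L) \<le> c * (p n * b)"
        using elim(1) c unfolding L_def b_def by (intro mult_left_mono) auto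
      then show ?thesis using c by simp
    qed
    have inv: "exp (- ln (real n)) = 1 / real n" using nn by (simp add: exp_minus inverse_eq_divide)
    have "L \<le> c * (p n * b)"
    proof -
      have "1 * L \<le> (A + 1) * L" using A ln1 Ln by (intro mult_right_mono) auto
      then show ?thesis using cpb by simp
    qed
    then have t1: "exp (- (c * (p n * b))) \<le> 1 / real n"
      unfolding inv[symmetric] using Ln by simp
    have t2: "exp (A * L) * exp (- (c * (p n * b))) \<le> 1 / real n"
      unfolding inv[symmetric] exp_add[symmetric] using Ln cpb by (simp add: algebra_simps)
    obtain CC where CC: "finite CC" "real (card CC) \<le> exp (A * real n ^ l * (ln (real n))\<^sup>2)"
      "\<forall>C\<in>CC. C \<subseteq> k_subsets k n \<and> real (card C) \<le> (real \<sigma> - 1 + \<epsilon>') * real (n choose (k - 1))"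
      "\<forall>F. F \<subseteq> k_subsets k n \<and> \<not> contains_copy F H \<longrightarrow> (\<exists>C\<in>CC. F \<subseteq> C)"
      using cont[OF nn(1)] by (elim exE conjE) (rule that)
    define F0 where "F0 = star_family k n (\<sigma> - 1)"
    have F0K: "F0 \<subseteq> k_subsets k n" by (auto simp: F0_def star_family_def)
    have F0free: "\<not> contains_copy F0 H"
      unfolding F0_def using \<sigma> by (intro star_family_no_copy[OF H(1,2)]) (simp add: \<sigma>_def)
    have F0l: "(real \<sigma> - 1 - \<epsilon>') * b \<le> real (card F0)"
      using n2 nn(2) \<sigma> by (simp add: F0_def b_def of_nat_diff)
    have F0u: "real (card F0) \<le> m * b"
    proof -
      have "\<sigma> - 1 \<le> n" using nn by simp
      from card_star_family(2)[OF k this]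
      have "real (card F0) \<le> real ((\<sigma> - 1) * (n choose (k - 1)))" unfolding F0_def by (simp only: of_nat_le_iff)
      also have "\<dots> = (real \<sigma> - 1) * b" using \<sigma> by (simp add: b_def of_nat_diff)
      also have "\<dots> \<le> m * b" using \<epsilon>' b by (intro mult_right_mono) (auto simp: m_def)
      finally show ?thesis .
    qed
    define XU where "XU C = {G. (m + \<epsilon>') * (p n * b) \<le> real (card (G \<inter> C))}" for C :: "nat set set"
    define XL where "XL = {G. real (card (G \<inter> F0)) \<le> p n * real (card F0) - \<epsilon>' * (p n * b)}"
    \<comment> \<open>The bad events in one union bound: \<open>None\<close> stands for the lower
      tail on the star, \<open>Some C\<close> for the upper tail on the container
      \<open>C\<close>.\<close>
    define S where "S i = (case i of None \<Rightarrow> XL | Some C \<Rightarrow> XU C)" for i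
    have fin: "finite (insert None (Some ` CC))" using CC by simp
    have "measure_pmf.prob ?R (- {G. \<bar>real (ex_in G H) - (real \<sigma> - 1) * p n * real (n choose (k - 1))\<bar>
      \<le> \<epsilon> * p n * real (n choose (k - 1))}) \<le> (\<Sum>i\<in>insert None (Some ` CC). measure_pmf.prob ?R (S i))"
    proof (rule prob_pmf_le_sum[OF fin])
      fix G assume G: "G \<in> set_pmf ?R" and bad: "G \<in> - {G. \<bar>real (ex_in G H) - (real \<sigma> - 1) * p n * real (n choose (k - 1))\<bar>
      \<le> \<epsilon> * p n * real (n choose (k - 1))}"
      have GK: "G \<subseteq> k_subsets k n" by (rule set_random_k_graph[OF G])
      have finG: "finite G" using GK k_subsets_finite finite_subset by blast
      define y where "y = p n * b"
      have bad': "\<not> \<bar>real (ex_in G H) - (real \<sigma> - 1) * y\<bar> \<le> \<epsilon> * y"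
        using bad by (simp add: y_def b_def mult.assoc)
      show "\<exists>i\<in>insert None (Some ` CC). G \<in> S i"
      proof (cases "real (ex_in G H) > (real \<sigma> - 1) * y + \<epsilon> * y")
        case True
        obtain F where F: "F \<subseteq> G" "\<not> contains_copy F H" "card F = ex_in G H"
          using ex_in_attained(1)[OF finG Hne] by blast
        have "F \<subseteq> k_subsets k n" using F(1) GK by blast
        then obtain C where C: "C \<in> CC" "F \<subseteq> C" using CC(4) F(2) by blast
        have "card F \<le> card (G \<inter> C)" using F(1) C(2) finG by (intro card_mono) auto
        then have "(real \<sigma> - 1) * y + \<epsilon> * y < real (card (G \<inter> C))" using True F(3) by linarith
        moreover have "(m + \<epsilon>') * y \<le> (real \<sigma> - 1) * y + \<epsilon> * y"
        proof -
          have "(m + \<epsilon>') * y = (real \<sigma> - 1) * y + (2 / 3) * (\<epsilon> * y)"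
            by (simp add: m_def \<epsilon>'_def algebra_simps)
          moreover have "0 \<le> \<epsilon> * y" using \<epsilon> pb by (simp add: y_def)
          ultimately show ?thesis by linarith
        qed
        ultimately have "G \<in> XU C" by (simp add: XU_def y_def)
        then show ?thesis using C(1) by (intro bexI[of _ "Some C"]) (auto simp: S_def)
      next
        case False
        then have low: "real (ex_in G H) < (real \<sigma> - 1) * y - \<epsilon> * y" using bad' by linarith
        have "\<not> contains_copy (G \<inter> F0) H" using F0free contains_copy_mono by (metis inf_le2)
        then have "card (G \<inter> F0) \<le> ex_in G H" by (intro ex_in_attained(2)[OF finG Hne]) auto
        then have "real (card (G \<inter> F0)) \<le> (real \<sigma> - 1) * y - \<epsilon> * y" using low by linarith
        also have "\<dots> \<le> p n * real (card F0) - \<epsilon>' * y"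
        proof -
          have "p n * ((real \<sigma> - 1 - \<epsilon>') * b) \<le> p n * real (card F0)" using F0l pn by (intro mult_left_mono)
          moreover have "p n * ((real \<sigma> - 1 - \<epsilon>') * b) = (real \<sigma> - 1) * y - \<epsilon>' * y"
            by (simp add: y_def algebra_simps)
          moreover have "\<epsilon> * y = 3 * (\<epsilon>' * y)" by (simp add: \<epsilon>'_def)
          moreover have "0 \<le> \<epsilon>' * y" using \<epsilon>' pb by (simp add: y_def)
          ultimately show ?thesis by linarith
        qed
        finally have "G \<in> XL" by (simp add: XL_def y_def)
        then show ?thesis by (intro bexI[of _ None]) (auto simp: S_def)
      qed
    qed
    also have "\<dots> = measure_pmf.prob ?R XL + (\<Sum>C\<in>CC. measure_pmf.prob ?R (XU C))"
      using CC(1) by (subst sum.insert) (auto simp: S_def sum.reindex)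
    also have "\<dots> \<le> exp (- (c * (p n * b))) + (\<Sum>C\<in>CC. exp (- (c * (p n * b))))"
    proof (intro add_mono sum_mono)
      show "measure_pmf.prob ?R XL \<le> exp (- (c * (p n * b)))"
        unfolding XL_def c_def by (rule random_k_graph_tails(2)[OF pn F0K F0u b _ x xm]) (use m in simp)
      show "measure_pmf.prob ?R (XU C) \<le> exp (- (c * (p n * b)))" if C: "C \<in> CC" for C
        unfolding XU_def c_def
        by (rule random_k_graph_tails(1)[OF pn _ _ b _ x xm]) (use CC(3) C m in \<open>auto simp: m_def b_def\<close>)
    qed
    also have "\<dots> = exp (- (c * (p n * b))) + real (card CC) * exp (- (c * (p n * b)))" by simp
    also have "\<dots> \<le> exp (- (c * (p n * b))) + exp (A * L) * exp (- (c * (p n * b)))"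
      using CC(2) by (intro add_left_mono mult_right_mono) (auto simp: L_def mult.assoc)
    also have "\<dots> \<le> 2 / real n" using t1 t2 by simp
    finally show ?case .
  qed
  then show ?thesis unfolding \<sigma>_def
  proof (rule prob_tendsto_1I)
    show "(\<lambda>n. 2 / real n) \<longlonglongrightarrow> 0" by (rule lim_const_over_n)
  qed
qed

text \<open>The containers also give the deterministic upper bound, because an extremal graph lies
  inside one of them; the star family gives the lower bound.\<close>

lemma turan_number_asymptotics:
  assumes k: "2 \<le> k" "l \<le> k - 2" and H: "k_tree k H" "two_contractible H" "overlapping l H"
  shows "(\<lambda>n. real (turan_number k n H) / real (n choose (k - 1))) \<longlonglongrightarrow> real (cross_cut_number H) - 1"
proof (rule LIMSEQ_I)
  fix r :: real assume r: "0 < r"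
  define \<sigma> where "\<sigma> = cross_cut_number H"
  have \<sigma>: "1 \<le> \<sigma>" unfolding \<sigma>_def by (rule cross_cut_number_pos[OF H(1,2)])
  have Hne: "H \<noteq> {}" using H hypertree_finite by (auto simp: k_tree_def)
  have r2: "0 < r / 2" using r by simp
  obtain A n1 where *: "0 < A \<and> (\<forall>n\<ge>n1. \<exists>CC. finite CC \<and>
    real (card CC) \<le> exp (A * real n ^ l * (ln (real n))\<^sup>2) \<and>
    (\<forall>C\<in>CC. C \<subseteq> k_subsets k n \<and>
      real (card C) \<le> (real (cross_cut_number H) - 1 + r / 2) * real (n choose (k - 1))) \<and>
    (\<forall>F. F \<subseteq> k_subsets k n \<and> \<not> contains_copy F H \<longrightarrow> (\<exists>C\<in>CC. F \<subseteq> C)))"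
    using containers_exist[OF k H r2] by (elim exE) (rule that)
  note cont = *[THEN conjunct2, THEN spec, THEN mp, folded \<sigma>_def]
  obtain n2 where n2: "\<forall>n\<ge>n2. (real (\<sigma> - 1) - r / 2) * real (n choose (k - 1)) \<le> real (card (star_family k n (\<sigma> - 1)))"
    using star_family_asymptotics[OF k(1) r2] ..
  show "\<exists>no. \<forall>n\<ge>no. norm (real (turan_number k n H) / real (n choose (k - 1)) - (real (cross_cut_number H) - 1)) < r"
  proof (intro exI[of _ "max (max n1 n2) k"] allI impI)
    fix n assume "max (max n1 n2) k \<le> n"
    then have nn: "n1 \<le> n" "n2 \<le> n" "k \<le> n" by auto
    define b where "b = real (n choose (k - 1))"
    have b: "0 < b" using nn by (simp add: b_def)
    define T where "T = real (turan_number k n H)"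
    have TK: "turan_number k n H = ex_in (k_subsets k n) H" by (simp add: turan_number_def ex_in_def)
    obtain F where F: "F \<subseteq> k_subsets k n" "\<not> contains_copy F H" "card F = turan_number k n H"
      using ex_in_attained(1)[OF k_subsets_finite Hne] unfolding TK by blast
    obtain CC where CC: "finite CC" "real (card CC) \<le> exp (A * real n ^ l * (ln (real n))\<^sup>2)"
      "\<forall>C\<in>CC. C \<subseteq> k_subsets k n \<and> real (card C) \<le> (real \<sigma> - 1 + r / 2) * real (n choose (k - 1))"
      "\<forall>F. F \<subseteq> k_subsets k n \<and> \<not> contains_copy F H \<longrightarrow> (\<exists>C\<in>CC. F \<subseteq> C)"
      using cont[OF nn(1)] by (elim exE conjE) (rule that)
    obtain C where C: "C \<in> CC" "F \<subseteq> C" using CC(4) F by blast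
    have "finite C" using CC(3) C(1) k_subsets_finite finite_subset by blast
    then have "card F \<le> card C" using C(2) by (intro card_mono)
    then have up: "T \<le> (real \<sigma> - 1 + r / 2) * b"
      using CC(3) C(1) F(3) unfolding T_def b_def by (metis of_nat_le_iff order_trans)
    have "card (star_family k n (\<sigma> - 1)) \<le> turan_number k n H"
      unfolding TK
    proof (rule ex_in_attained(2)[OF k_subsets_finite Hne])
      show "star_family k n (\<sigma> - 1) \<subseteq> k_subsets k n" by (auto simp: star_family_def)
      show "\<not> contains_copy (star_family k n (\<sigma> - 1)) H"
        using \<sigma> by (intro star_family_no_copy[OF H(1,2)]) (simp add: \<sigma>_def)
    qed
    moreover have "(real \<sigma> - 1 - r / 2) * b \<le> real (card (star_family k n (\<sigma> - 1)))"
      using n2 nn(2) \<sigma> by (simp add: b_def of_nat_diff)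
    ultimately have lo: "(real \<sigma> - 1 - r / 2) * b \<le> T" unfolding T_def by linarith
    have "T / b \<le> real \<sigma> - 1 + r / 2" "real \<sigma> - 1 - r / 2 \<le> T / b"
      using up lo b by (simp_all add: pos_divide_le_eq pos_le_divide_eq)
    then have "\<bar>T / b - (real \<sigma> - 1)\<bar> < r" using r by linarith
    then show "norm (real (turan_number k n H) / real (n choose (k - 1)) - (real (cross_cut_number H) - 1)) < r"
      by (simp add: T_def b_def \<sigma>_def)
  qed
qed

text \<open>The o(1) terms appear as one limit for each fixed \<open>\<epsilon>\<close>. The
  comparison with the Turan number is relative; for cross-cut number 1 the main term is 0 and errors
  of order \<open>\<epsilon> * p n * (n choose (k - 1))\<close> cannot be compared with it, so there
  the statement consists of the two absolute asymptotics.\<close>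

theorem theorem1p5:
  fixes k l :: nat and H :: "'a set set" and p :: "nat \<Rightarrow> real"
  assumes "k \<ge> 4"
    and "k_tree k H"
    and "two_contractible H"
    and "overlapping l H"
    and "\<And>n. 0 \<le> p n \<and> p n \<le> 1"
    and "p \<in> \<omega>(\<lambda>n. (ln (real n))\<^sup>2 / real n powr (real k - real l - 1))"
  shows "(\<forall>\<epsilon>>0. (\<lambda>n. measure_pmf.prob (random_k_graph k n (p n))
            {G. \<bar>real (ex_in G H) - (real (cross_cut_number H) - 1) * p n * real (n choose (k - 1))\<bar>
                \<le> \<epsilon> * p n * real (n choose (k - 1))}) \<longlonglongrightarrow> 1)
       \<and> (\<lambda>n. real (turan_number k n H) / real (n choose (k - 1)))
            \<longlonglongrightarrow> real (cross_cut_number H) - 1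
       \<and> (cross_cut_number H \<ge> 2 \<longrightarrow>
            (\<forall>\<epsilon>>0. (\<lambda>n. measure_pmf.prob (random_k_graph k n (p n))
              {G. \<bar>real (ex_in G H) - p n * real (turan_number k n H)\<bar>
                  \<le> \<epsilon> * p n * real (turan_number k n H)}) \<longlonglongrightarrow> 1))"
proof (intro conjI allI impI)
  have k: "2 \<le> k" "l \<le> k - 2"
    using assms(1) sparse_rate_imp_overlap[OF assms(5,6)] by auto
  note conc = random_turan_concentration[OF k(1) assms(2-6)]
  show "(\<lambda>n. measure_pmf.prob (random_k_graph k n (p n))
            {G. \<bar>real (ex_in G H) - (real (cross_cut_number H) - 1) * p n * real (n choose (k - 1))\<bar>
                \<le> \<epsilon> * p n * real (n choose (k - 1))}) \<longlonglongrightarrow> 1" if "0 < \<epsilon>" for \<epsilon>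
    by (rule conc[OF that])
  show turan: "(\<lambda>n. real (turan_number k n H) / real (n choose (k - 1)))
      \<longlonglongrightarrow> real (cross_cut_number H) - 1"
    by (rule turan_number_asymptotics[OF k assms(2-4)])
  fix \<epsilon> :: real assume \<sigma>: "cross_cut_number H \<ge> 2" and \<epsilon>: "0 < \<epsilon>"
  define s where "s = real (cross_cut_number H) - 1"
  have s: "1 \<le> s" using \<sigma> by (simp add: s_def)
  \<comment> \<open>The bound \<open>1 / 2\<close> gives \<open>b / 2 \<le> T\<close>, as
    \<open>s \<ge> 1\<close>. The error \<open>r\<close> occurs twice, once for the random graph and
    once for the Turan number, and
    \<open>2 * r * b \<le> 4 * r * T \<le> \<epsilon> * T\<close>.\<close>
  define r where "r = min (\<epsilon> / 4) (1 / 2)"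
  have r: "0 < r" "r \<le> \<epsilon> / 4" "r \<le> 1 / 2" using \<epsilon> by (auto simp: r_def)
  have "eventually (\<lambda>n. \<bar>real (turan_number k n H) / real (n choose (k - 1)) - s\<bar> < r) sequentially"
    using tendstoD[OF turan r(1)] by (simp add: dist_real_def s_def)
  moreover have "eventually (\<lambda>n. k \<le> n) sequentially" by (rule eventually_ge_at_top)
  ultimately have ev: "eventually (\<lambda>n. measure_pmf.prob (random_k_graph k n (p n))
      {G. \<bar>real (ex_in G H) - s * p n * real (n choose (k - 1))\<bar> \<le> r * p n * real (n choose (k - 1))}
    \<le> measure_pmf.prob (random_k_graph k n (p n))
      {G. \<bar>real (ex_in G H) - p n * real (turan_number k n H)\<bar> \<le> \<epsilon> * p n * real (turan_number k n H)}) sequentially"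
  proof eventually_elim
    case (elim n)
    define b where "b = real (n choose (k - 1))"
    define T where "T = real (turan_number k n H)"
    have b: "0 < b" using elim(2) by (simp add: b_def)
    have pn: "0 \<le> p n" using assms(5) by simp
    have "\<bar>T / b - s\<bar> < r" using elim(1) by (simp add: T_def b_def)
    then have T: "\<bar>T - s * b\<bar> \<le> r * b"
    proof -
      have "\<bar>T - s * b\<bar> = \<bar>T / b - s\<bar> * b" using b by (simp add: abs_mult_pos left_diff_distrib)
      then show ?thesis using \<open>\<bar>T / b - s\<bar> < r\<close> b by simp
    qed
    have "b / 2 \<le> T"
    proof -
      have "1 * b \<le> s * b" "r * b \<le> 1 / 2 * b" using s r b by (intro mult_right_mono; simp)+
      then show ?thesis using T by linarith
    qed
    then have pT: "p n * b \<le> 2 * (p n * T)" using mult_left_mono[of "b / 2" T "p n"] pn by simp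
    have pTs: "\<bar>p n * T - s * (p n * b)\<bar> \<le> r * (p n * b)"
    proof -
      have "\<bar>p n * T - s * (p n * b)\<bar> = p n * \<bar>T - s * b\<bar>"
        using pn by (simp add: abs_mult_pos' algebra_simps)
      also have "\<dots> \<le> p n * (r * b)" using T pn by (intro mult_left_mono)
      finally show ?thesis by (simp add: mult_ac)
    qed
    have "2 * (r * (p n * b)) \<le> \<epsilon> * (p n * T)"
    proof -
      have "r * (p n * b) \<le> \<epsilon> / 4 * (2 * (p n * T))"
        using pn b \<epsilon> by (intro mult_mono[OF r(2) pT]) auto
      then show ?thesis by (simp add: mult_ac)
    qed
    then have "\<bar>y - p n * T\<bar> \<le> \<epsilon> * (p n * T)" if "\<bar>y - s * (p n * b)\<bar> \<le> r * (p n * b)" for y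
      using that pTs by linarith
    then show ?case
      unfolding b_def[symmetric] T_def[symmetric]
      by (intro measure_pmf.finite_measure_mono) (auto simp: mult.assoc)
  qed
  have conc_r: "(\<lambda>n. measure_pmf.prob (random_k_graph k n (p n))
      {G. \<bar>real (ex_in G H) - s * p n * real (n choose (k - 1))\<bar> \<le> r * p n * real (n choose (k - 1))}) \<longlonglongrightarrow> 1"
    unfolding s_def by (rule conc[OF r(1)])
  show "(\<lambda>n. measure_pmf.prob (random_k_graph k n (p n))
      {G. \<bar>real (ex_in G H) - p n * real (turan_number k n H)\<bar> \<le> \<epsilon> * p n * real (turan_number k n H)}) \<longlonglongrightarrow> 1"
    by (rule tendsto_sandwich[OF ev _ conc_r tendsto_const]) simp
qed

end
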